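(* (i) Let $d\ge 3$ and let $G$ be the disjointness graph of a finite set of lines in $\mathbb{R}^d$. Then $\chi(G)\le(\omega(G))^3$. (ii) Let $d\ge 3$ and let $G$ be the disjointness graph of a finite set of lines in the real projective space $\mathbb{P}^d$. Then $\chi(G)\le(\omega(G))^2$. In both cases, there are polynomial time algorithms that, given the lines corresponding to the vertices of $G$, find complete subgraphs $K\subseteq G$ and proper colorings of $G$ with at most $|V(K)|^3$ colors (in case (i)) and at most $|V(K)|^2$ colors (in case (ii)), respectively.
   Context: The disjointness graph of a family of sets is the graph whose vertices are the members of the family, two vertices being adjacent if and only if the corresponding sets are disjoint. $\chi(G)$ denotes the chromatic number and $\omega(G)$ the clique number of $G$. Note that parallel lines in $\mathbb{R}^d$ are disjoint, whereas projective lines in $\mathbb{P}^d$ lying in a common plane intersect. *)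

theory Defs
  imports "Jordan_Normal_Form.Matrix" "HOL-Computational_Algebra.Polynomial"
begin

section \<open>Graphs\<close>

record 'a graph =
  verts :: "'a set"
  edges :: "'a set set"

definition disjointness_graph :: "'a set set \<Rightarrow> 'a set graph" where
  "disjointness_graph F =
     \<lparr> verts = F, edges = {{A, B} | A B. A \<in> F \<and> B \<in> F \<and> A \<noteq> B \<and> A \<inter> B = {}} \<rparr>"

definition is_clique :: "'a graph \<Rightarrow> 'a set \<Rightarrow> bool" where
  "is_clique G K \<longleftrightarrow> K \<subseteq> verts G \<and> (\<forall>x\<in>K. \<forall>y\<in>K. x \<noteq> y \<longrightarrow> {x, y} \<in> edges G)"

definition proper_coloring :: "'a graph \<Rightarrow> ('a \<Rightarrow> nat) \<Rightarrow> bool" where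
  "proper_coloring G f \<longleftrightarrow>
     (\<forall>x\<in>verts G. \<forall>y\<in>verts G. {x, y} \<in> edges G \<longrightarrow> f x \<noteq> f y)"

text \<open>The next two numbers are meaningful for finite graphs only.\<close>

definition chromatic_number :: "'a graph \<Rightarrow> nat" where
  "chromatic_number G = (LEAST k. \<exists>f. proper_coloring G f \<and> f ` verts G \<subseteq> {..<k})"

definition clique_number :: "'a graph \<Rightarrow> nat" where
  "clique_number G = Max {card K | K. is_clique G K}"


section \<open>Lines\<close>

definition affine_line :: "real vec \<Rightarrow> real vec \<Rightarrow> real vec set" where
  "affine_line p v = {p + t \<cdot>\<^sub>v v | t. True}"

definition affine_lines :: "nat \<Rightarrow> real vec set set" where
  "affine_lines d =
     {affine_line p v | p v. p \<in> carrier_vec d \<and> v \<in> carrier_vec d \<and> v \<noteq> 0\<^sub>v d}"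

text \<open>
  A point of the projective space of dimension \<open>d\<close> is a one-dimensional linear subspace
  of the real vector space of dimension \<open>d + 1\<close>. A projective line is the set of those
  points that are contained in a two-dimensional subspace; here the subspace is given by
  a basis \<open>u\<close>, \<open>w\<close>.
\<close>

definition proj_point :: "real vec \<Rightarrow> real vec set" where
  "proj_point x = {c \<cdot>\<^sub>v x | c. True}"

definition independent_pair :: "nat \<Rightarrow> real vec \<Rightarrow> real vec \<Rightarrow> bool" where
  "independent_pair m u w \<longleftrightarrow>
     u \<in> carrier_vec m \<and> w \<in> carrier_vec m \<and>
     (\<forall>a b. a \<cdot>\<^sub>v u + b \<cdot>\<^sub>v w = 0\<^sub>v m \<longrightarrow> a = 0 \<and> b = 0)"

definition proj_line :: "real vec \<Rightarrow> real vec \<Rightarrow> real vec set set" where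
  "proj_line u w =
     {proj_point (a \<cdot>\<^sub>v u + b \<cdot>\<^sub>v w) | a b. a \<cdot>\<^sub>v u + b \<cdot>\<^sub>v w \<noteq> 0\<^sub>v (dim_vec u)}"

definition proj_lines :: "nat \<Rightarrow> real vec set set set" where
  "proj_lines d = {proj_line u w | u w. independent_pair (d + 1) u w}"


section \<open>Real RAM programs\<close>

text \<open>
  Algorithms are programs for a real RAM, presented as a structured language. A program
  uses finitely many named registers and two-dimensional arrays, holding either natural
  numbers or reals. Reals admit exact field arithmetic and comparison. Natural numbers are
  used for control and for addressing; they admit only addition, truncated subtraction and
  comparison. There is no conversion between the two sorts (in particular no rounding), and
  the only real constants are integers.

  Each assignment and each evaluation of a guard takes one step. Since the expressions of a
  fixed program have bounded size, this agrees up to a constant factor with counting single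
  operations.
\<close>

type_synonym name = string

record state =
  nreg :: "name \<Rightarrow> nat"
  narr :: "name \<Rightarrow> nat \<Rightarrow> nat \<Rightarrow> nat"
  rreg :: "name \<Rightarrow> real"
  rarr :: "name \<Rightarrow> nat \<Rightarrow> nat \<Rightarrow> real"

datatype nexp =
    NConst nat
  | NReg name
  | NArr name nexp nexp
  | NAdd nexp nexp
  | NSub nexp nexp

datatype rexp =
    RConst int
  | RReg name
  | RArr name nexp nexp
  | RAdd rexp rexp
  | RSub rexp rexp
  | RMul rexp rexp
  | RDiv rexp rexp

datatype bexp =
    NLess nexp nexp
  | RLess rexp rexp
  | BNot bexp
  | BAnd bexp bexp

datatype com =
    Skip
  | NSet name nexp
  | NArrSet name nexp nexp nexp
  | RSet name rexp
  | RArrSet name nexp nexp rexp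
  | Seq com com
  | Cond bexp com com
  | While bexp com

primrec nval :: "nexp \<Rightarrow> state \<Rightarrow> nat" where
  "nval (NConst k) s = k"
| "nval (NReg x) s = nreg s x"
| "nval (NArr x i j) s = narr s x (nval i s) (nval j s)"
| "nval (NAdd a b) s = nval a s + nval b s"
| "nval (NSub a b) s = nval a s - nval b s"

text \<open>Division by zero yields zero, as everywhere in HOL.\<close>

primrec rval :: "rexp \<Rightarrow> state \<Rightarrow> real" where
  "rval (RConst k) s = of_int k"
| "rval (RReg x) s = rreg s x"
| "rval (RArr x i j) s = rarr s x (nval i s) (nval j s)"
| "rval (RAdd a b) s = rval a s + rval b s"
| "rval (RSub a b) s = rval a s - rval b s"
| "rval (RMul a b) s = rval a s * rval b s"
| "rval (RDiv a b) s = rval a s / rval b s"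

primrec bval :: "bexp \<Rightarrow> state \<Rightarrow> bool" where
  "bval (NLess a b) s \<longleftrightarrow> nval a s < nval b s"
| "bval (RLess a b) s \<longleftrightarrow> rval a s < rval b s"
| "bval (BNot b) s \<longleftrightarrow> \<not> bval b s"
| "bval (BAnd b c) s \<longleftrightarrow> bval b s \<and> bval c s"

definition upd2 :: "(nat \<Rightarrow> nat \<Rightarrow> 'a) \<Rightarrow> nat \<Rightarrow> nat \<Rightarrow> 'a \<Rightarrow> nat \<Rightarrow> nat \<Rightarrow> 'a" where
  "upd2 A i j x = A(i := (A i)(j := x))"

text \<open>\<open>exec c s k t\<close>: started in state \<open>s\<close>, the program \<open>c\<close> halts in state \<open>t\<close> after \<open>k\<close> steps.\<close>

inductive exec :: "com \<Rightarrow> state \<Rightarrow> nat \<Rightarrow> state \<Rightarrow> bool" where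
  Skip: "exec Skip s 1 s"
| NSet: "exec (NSet x a) s 1 (s\<lparr>nreg := (nreg s)(x := nval a s)\<rparr>)"
| NArrSet: "exec (NArrSet x i j a) s 1
    (s\<lparr>narr := (narr s)(x := upd2 (narr s x) (nval i s) (nval j s) (nval a s))\<rparr>)"
| RSet: "exec (RSet x a) s 1 (s\<lparr>rreg := (rreg s)(x := rval a s)\<rparr>)"
| RArrSet: "exec (RArrSet x i j a) s 1
    (s\<lparr>rarr := (rarr s)(x := upd2 (rarr s x) (nval i s) (nval j s) (rval a s))\<rparr>)"
| Seq: "exec c1 s1 k1 s2 \<Longrightarrow> exec c2 s2 k2 s3 \<Longrightarrow> exec (Seq c1 c2) s1 (k1 + k2) s3"
| CondTrue: "bval b s \<Longrightarrow> exec c1 s k t \<Longrightarrow> exec (Cond b c1 c2) s (k + 1) t"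
| CondFalse: "\<not> bval b s \<Longrightarrow> exec c2 s k t \<Longrightarrow> exec (Cond b c1 c2) s (k + 1) t"
| WhileFalse: "\<not> bval b s \<Longrightarrow> exec (While b c) s 1 s"
| WhileTrue: "bval b s1 \<Longrightarrow> exec c s1 k1 s2 \<Longrightarrow> exec (While b c) s2 k2 s3 \<Longrightarrow>
    exec (While b c) s1 (k1 + k2 + 1) s3"


section \<open>Input and output of the algorithms\<close>

text \<open>
  The input consists of \<open>n\<close> lines, the \<open>i\<close>-th one given by two vectors \<open>a i\<close> and \<open>b i\<close> with \<open>m\<close>
  coordinates each (a point and a direction, or two points in homogeneous coordinates).
  It comprises \<open>2 * n * m\<close> reals. All other memory is initially zero.
\<close>

definition input_state :: "nat \<Rightarrow> nat \<Rightarrow> (nat \<Rightarrow> real vec) \<Rightarrow> (nat \<Rightarrow> real vec) \<Rightarrow> state" where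
  "input_state n m a b =
     \<lparr> nreg = (\<lambda>_. 0)(''n'' := n, ''m'' := m),
       narr = (\<lambda>_ _ _. 0),
       rreg = (\<lambda>_. 0),
       rarr = (\<lambda>_ _ _. 0)
         (''a'' := (\<lambda>i j. if i < n \<and> j < m then a i $ j else 0),
          ''b'' := (\<lambda>i j. if i < n \<and> j < m then b i $ j else 0)) \<rparr>"

text \<open>
  The output is read off the first column of two arrays: \<open>clique\<close> holds the characteristic
  function of the vertex set \<open>K\<close> of a complete subgraph, and \<open>color\<close> holds the colors.
\<close>

definition outputs_clique_coloring ::
    "state \<Rightarrow> nat \<Rightarrow> (nat \<Rightarrow> 'a set) \<Rightarrow> 'a set set \<Rightarrow> ('a set \<Rightarrow> nat) \<Rightarrow> bool" where
  "outputs_clique_coloring t n L K f \<longleftrightarrow>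
     K = L ` {i. i < n \<and> narr t ''clique'' i 0 \<noteq> 0} \<and>
     (\<forall>i<n. f (L i) = narr t ''color'' i 0)"

text \<open>
  \<open>poly_time_clique_coloring c e D valid L\<close>: the program \<open>c\<close>, given representations of
  pairwise distinct lines, finds in polynomial time a complete subgraph with vertex set \<open>K\<close>
  of their disjointness graph and a proper coloring with at most \<open>card K ^ e\<close> colors.
  Here \<open>D\<close> is the set of admissible numbers of coordinates, \<open>valid m u v\<close> says that the pair
  \<open>u\<close>, \<open>v\<close> with \<open>m\<close> coordinates represents a line, and \<open>L u v\<close> is that line. The program and
  the polynomial do not depend on the dimension.
\<close>

definition poly_time_clique_coloring ::
    "com \<Rightarrow> nat \<Rightarrow> nat set \<Rightarrow> (nat \<Rightarrow> real vec \<Rightarrow> real vec \<Rightarrow> bool) \<Rightarrow>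
     (real vec \<Rightarrow> real vec \<Rightarrow> 'a set) \<Rightarrow> bool" where
  "poly_time_clique_coloring c e D valid L \<longleftrightarrow>
     (\<exists>p :: nat poly. \<forall>m\<in>D. \<forall>n a b.
        (\<forall>i<n. valid m (a i) (b i)) \<longrightarrow>
        inj_on (\<lambda>i. L (a i) (b i)) {..<n} \<longrightarrow>
        (\<exists>k t K f.
           exec c (input_state n m a b) k t \<and>
           k \<le> poly p (2 * n * m) \<and>
           outputs_clique_coloring t n (\<lambda>i. L (a i) (b i)) K f \<and>
           (let G = disjointness_graph ((\<lambda>i. L (a i) (b i)) ` {..<n}) in
              is_clique G K \<and>
              proper_coloring G f \<and>
              card (f ` verts G) \<le> card K ^ e)))"

end

theory Submission
  imports Defs
begin

text \<open>
  Let \<open>C\<close> be a maximal clique in the disjointness graph of projective lines. Every other line meets a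
  member of \<open>C\<close>, its owner. Two lines with the same owner \<open>l\<close> meet if and only if they pass through
  the same point of \<open>l\<close> or lie in the same plane with \<open>l\<close>; viewing them as edges between points and
  planes, they are disjoint if and only if these edges of a bipartite multigraph are disjoint. By
  Koenig's theorem a largest matching has as many edges as a suitable vertex cover has vertices, and the
  lines at one vertex of the cover can share a color. With \<open>k\<close> the size of the largest clique found,
  this uses at most \<open>k * k\<close> colors. Affine lines are homogenized and first split into at most \<open>k\<close>
  layers without parallel lines, a parallel class being a clique.

  Koenig's theorem is obtained from an auction: an edge at an unmatched point bids for its plane, whose
  price rises by one with each bid. When all the remaining bids have become too expensive, an unused price
  level separates the planes that enter the cover from those replaced by points. All geometric tests
  are equations between Gram determinants.
\<close>

section \<open>Bounded loop programs\<close>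

text \<open>The chromatic bounds are read off the algorithms, as the clique found has at most
  \<open>clique_number\<close> vertices. One factor k counts the owners of a layer, which form its
  greedy clique; the second counts the colors used for one owner, namely matched lines with that
  owner, again a clique. The owner meets all its lines and joins one of these colors. For affine
  lines, meeting in homogeneous coordinates is not the opposite of disjointness: parallel lines
  share a point at infinity. Ranking each line within its parallel class separates them, and there
  are at most as many ranks as lines in a largest class, whence the third factor. Pivoting and the
  computation of intersection points are avoided: every geometric question asks whether a nontrivial
  combination of two vectors falls into a subspace, hence whether a positive semidefinite binary
  form has a nontrivial zero, which is one polynomial equation in the input. One auction serves all
  owners, as each label contains the owner.\<close>

text \<open>
  The only loops are of the form \<open>for x < b + k\<close> with \<open>b\<close> the name of an input size that the program
  never changes, so that termination in polynomial time can be read off the syntax.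
\<close>

datatype prog =
    PNSet name nexp
  | PNArrSet name nexp nexp nexp
  | PRArrSet name nexp nexp rexp
  | PSeq prog prog  (infixr ";;" 60)
  | PIf bexp prog
  | PFor name name nat prog

primrec cmd :: "prog \<Rightarrow> com" where
  "cmd (PNSet x a) = NSet x a"
| "cmd (PNArrSet x i j a) = NArrSet x i j a"
| "cmd (PRArrSet x i j a) = RArrSet x i j a"
| "cmd (p ;; q) = Seq (cmd p) (cmd q)"
| "cmd (PIf b p) = Cond b (cmd p) Skip"
| "cmd (PFor x b k p) =
    Seq (NSet x (NConst 0))
      (While (NLess (NReg x) (NAdd (NReg b) (NConst k)))
        (Seq (cmd p) (NSet x (NAdd (NReg x) (NConst 1)))))"

abbreviation set_nreg :: "name \<Rightarrow> nat \<Rightarrow> state \<Rightarrow> state" where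
  "set_nreg x v s \<equiv> s\<lparr>nreg := (nreg s)(x := v)\<rparr>"

primrec for_iter :: "name \<Rightarrow> (state \<Rightarrow> state) \<Rightarrow> state \<Rightarrow> nat \<Rightarrow> state" where
  "for_iter x f s 0 = s"
| "for_iter x f s (Suc i) = f (set_nreg x i (for_iter x f s i))"

text \<open>A total function, so that programs are analyzed by recursion on their syntax. Each round
  sets the counter to its index and the bound is evaluated once; this describes \<open>cmd\<close>
  only if the body changes neither of them, which \<open>wf_prog\<close> ensures.\<close>

primrec run :: "prog \<Rightarrow> state \<Rightarrow> state" where
  "run (PNSet x a) s = set_nreg x (nval a s) s"
| "run (PNArrSet x i j a) s =
    s\<lparr>narr := (narr s)(x := upd2 (narr s x) (nval i s) (nval j s) (nval a s))\<rparr>"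
| "run (PRArrSet x i j a) s =
    s\<lparr>rarr := (rarr s)(x := upd2 (rarr s x) (nval i s) (nval j s) (rval a s))\<rparr>"
| "run (p ;; q) s = run q (run p s)"
| "run (PIf b p) s = (if bval b s then run p s else s)"
| "run (PFor x b k p) s =
    set_nreg x (nreg s b + k) (for_iter x (run p) s (nreg s b + k))"

primrec writes :: "prog \<Rightarrow> name set" where
  "writes (PNSet x a) = {x}"
| "writes (PNArrSet x i j a) = {x}"
| "writes (PRArrSet x i j a) = {x}"
| "writes (p ;; q) = writes p \<union> writes q"
| "writes (PIf b p) = writes p"
| "writes (PFor x b k p) = insert x (writes p)"

primrec wf_prog :: "prog \<Rightarrow> bool" where
  "wf_prog (PNSet x a) \<longleftrightarrow> x \<notin> {''n'', ''m''}"
| "wf_prog (PNArrSet x i j a) \<longleftrightarrow> x \<notin> {''n'', ''m''}"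
| "wf_prog (PRArrSet x i j a) \<longleftrightarrow> x \<notin> {''n'', ''m''}"
| "wf_prog (p ;; q) \<longleftrightarrow> wf_prog p \<and> wf_prog q"
| "wf_prog (PIf b p) \<longleftrightarrow> wf_prog p"
| "wf_prog (PFor x b k p) \<longleftrightarrow>
    b \<in> {''n'', ''m''} \<and> x \<notin> {''n'', ''m''} \<and> x \<notin> writes p \<and> wf_prog p"

text \<open>A polynomial in \<open>n + m\<close>. A loop has at most \<open>n + m + k\<close>
  rounds, each paying 2 for guard and increment; the last 2 pays for the initialization and the
  failing guard. A conditional costs 2 when it falls through to \<open>Skip\<close>.\<close>

primrec time :: "prog \<Rightarrow> nat poly" where
  "time (PNSet x a) = 1"
| "time (PNArrSet x i j a) = 1"
| "time (PRArrSet x i j a) = 1"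
| "time (p ;; q) = time p + time q"
| "time (PIf b p) = time p + 2"
| "time (PFor x b k p) = [:k, 1:] * (time p + 2) + 2"

text \<open>Registers and arrays share one name space, so that a single set of names is the frame of
  a program.\<close>

definition agree :: "name set \<Rightarrow> state \<Rightarrow> state \<Rightarrow> bool" where
  "agree W s t \<longleftrightarrow>
    (\<forall>x. x \<notin> W \<longrightarrow> nreg t x = nreg s x \<and> narr t x = narr s x \<and> rarr t x = rarr s x)"

lemma agreeD:
  assumes "agree W s t" "x \<notin> W"
  shows "nreg t x = nreg s x" "narr t x = narr s x" "rarr t x = rarr s x"
  using assms by (auto simp: agree_def)

lemma agree_refl: "agree W s s"
  by (simp add: agree_def)

lemma agree_trans: "agree W s t \<Longrightarrow> agree W t u \<Longrightarrow> agree W s u"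
  by (simp add: agree_def)

lemma agree_mono: "agree W s t \<Longrightarrow> W \<subseteq> W' \<Longrightarrow> agree W' s t"
  by (auto simp: agree_def)

lemma agree_set_nreg: "x \<in> W \<Longrightarrow> agree W s t \<Longrightarrow> agree W s (set_nreg x v t)"
  by (auto simp: agree_def)

lemma agree_for_iter:
  assumes "\<And>s. agree W s (f s)"
  shows "agree (insert x W) s (for_iter x f s i)"
proof (induction i)
  case 0
  show ?case by (simp add: agree_refl)
next
  case (Suc i)
  have "agree (insert x W) s (set_nreg x i (for_iter x f s i))"
    using Suc by (rule agree_set_nreg[rotated]) simp
  moreover have "agree (insert x W) u (f u)" for u
    using assms by (rule agree_mono) auto
  ultimately show ?case
    by (auto intro: agree_trans)
qed

lemma agree_run: "agree (writes p) s (run p s)"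
proof (induction p arbitrary: s)
  case (PSeq p q)
  show ?case
    using agree_mono[OF PSeq.IH(1)[of s], of "writes (p ;; q)"]
      agree_mono[OF PSeq.IH(2)[of "run p s"], of "writes (p ;; q)"]
    by (auto intro: agree_trans)
next
  case (PFor x b k p)
  show ?case
    by (auto intro: agree_set_nreg agree_for_iter PFor.IH)
qed (auto simp: agree_def)

lemmas run_unchanged = agreeD[OF agree_run]

text \<open>
  In the loop rule the states \<open>t\<close> reached by the loop agree with its initial state \<open>s\<close> outside
  of the names the loop may write, so that invariants need not mention the rest of the memory.
\<close>

lemma run_PForI:
  assumes "N = nreg s b + k"
    and "I 0 s"
    and step: "\<And>i t. i < N \<Longrightarrow> agree (insert x (writes p)) s t \<Longrightarrow> I i t
      \<Longrightarrow> I (Suc i) (run p (set_nreg x i t))"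
    and final: "\<And>t. agree (insert x (writes p)) s t \<Longrightarrow> I N t \<Longrightarrow> Q (set_nreg x N t)"
  shows "Q (run (PFor x b k p) s)"
proof -
  have "I i (for_iter x (run p) s i)" if "i \<le> N" for i
    using that
  proof (induction i)
    case 0
    then show ?case using assms(2) by simp
  next
    case (Suc i)
    then show ?case using step agree_for_iter[OF agree_run] by simp
  qed
  then show ?thesis
    using final[OF agree_for_iter[OF agree_run]] assms(1) by simp
qed

lemma wf_prog_writes: "wf_prog p \<Longrightarrow> ''n'' \<notin> writes p \<and> ''m'' \<notin> writes p"
  by (induction p) auto

lemma exec_cmd:
  assumes "wf_prog p"
  shows "\<exists>k \<le> poly (time p) (nreg s ''n'' + nreg s ''m''). exec (cmd p) s k (run p s)"
  using assms
proof (induction p arbitrary: s)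
  case (PNSet x a)
  then show ?case by (auto intro!: exI[of _ 1] exec.NSet[simplified])
next
  case (PNArrSet x i j a)
  then show ?case by (auto intro!: exI[of _ 1] exec.NArrSet[simplified])
next
  case (PRArrSet x i j a)
  then show ?case by (auto intro!: exI[of _ 1] exec.RArrSet[simplified])
next
  case (PSeq p q)
  let ?N = "nreg s ''n'' + nreg s ''m''"
  have "wf_prog p" "wf_prog q"
    using PSeq.prems by auto
  then have eq: "nreg (run p s) ''n'' = nreg s ''n''" "nreg (run p s) ''m'' = nreg s ''m''"
    using run_unchanged(1) wf_prog_writes by auto
  obtain k where k: "k \<le> poly (time p) ?N" "exec (cmd p) s k (run p s)"
    using PSeq \<open>wf_prog p\<close> by blast
  obtain l where l: "l \<le> poly (time q) ?N" "exec (cmd q) (run p s) l (run q (run p s))"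
    using PSeq.IH(2)[OF \<open>wf_prog q\<close>, of "run p s"] eq by auto
  show ?case
    using exec.Seq[OF k(2) l(2)] k(1) l(1) by (auto intro!: exI[of _ "k + l"])
next
  case (PIf b p)
  show ?case
  proof (cases "bval b s")
    case True
    obtain k where "k \<le> poly (time p) (nreg s ''n'' + nreg s ''m'')" "exec (cmd p) s k (run p s)"
      using PIf by auto
    then show ?thesis
      using True exec.CondTrue[of b s "cmd p" k "run p s" Skip] by (auto intro!: exI[of _ "k + 1"])
  next
    case False
    then show ?thesis
      using exec.CondFalse[OF False exec.Skip, of "cmd p"] by (auto intro!: exI[of _ "1 + 1"])
  qed
next
  case (PFor x b k p)
  define N where "N = nreg s b + k"
  define M where "M = nreg s ''n'' + nreg s ''m''"
  define T where "T = poly (time p) M"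
  define st where "st i = set_nreg x i (for_iter x (run p) s i)" for i
  let ?b = "NLess (NReg x) (NAdd (NReg b) (NConst k))"
  let ?c = "Seq (cmd p) (NSet x (NAdd (NReg x) (NConst 1)))"
  have wf: "wf_prog p" and x: "x \<notin> writes p" "x \<notin> {''n'', ''m''}" and b: "b \<in> {''n'', ''m''}"
    using PFor.prems by auto
  have "writes p \<inter> {''n'', ''m''} = {}"
    using wf_prog_writes[OF wf] by auto
  then have nm: "nreg (st i) y = nreg s y" if "y \<in> {''n'', ''m''}" for i y
    using that x agreeD(1)[OF agree_for_iter[OF agree_run], of y x p s i] by (auto simp: st_def)
  have body: "\<exists>l \<le> T + 1. exec ?c (st i) l (st (Suc i))" for i
  proof -
    obtain l where "l \<le> T" "exec (cmd p) (st i) l (run p (st i))"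
      using PFor.IH[OF wf, of "st i"] nm by (auto simp: T_def M_def)
    moreover have "exec (NSet x (NAdd (NReg x) (NConst 1))) (run p (st i)) 1 (st (Suc i))"
      using exec.NSet[of x "NAdd (NReg x) (NConst 1)" "run p (st i)"] run_unchanged(1)[OF x(1), of "st i"]
      by (simp add: st_def)
    ultimately show ?thesis
      using exec.Seq by (metis add_le_mono1)
  qed
  \<comment> \<open>Downward induction from \<open>N\<close>, since the rule for a true guard puts
    one round in front of the remaining loop.\<close>
  have loop: "i \<le> N \<Longrightarrow> \<exists>l \<le> (N - i) * (T + 2) + 1. exec (While ?b ?c) (st i) l (st N)" for i
  proof (induction i rule: inc_induct)
    case base
    have "\<not> bval ?b (st N)"
      using nm[OF b] by (simp add: N_def) (simp add: st_def)
    then have "exec (While ?b ?c) (st N) 1 (st N)"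
      by (rule exec.WhileFalse)
    then show ?case by (intro exI[of _ 1]) simp
  next
    case (step i)
    have "bval ?b (st i)"
      using nm[OF b] step(2) by (simp add: N_def) (simp add: st_def)
    moreover obtain l where l: "l \<le> T + 1" "exec ?c (st i) l (st (Suc i))"
      using body by blast
    moreover obtain l' where l': "l' \<le> (N - Suc i) * (T + 2) + 1"
      "exec (While ?b ?c) (st (Suc i)) l' (st N)"
      using step by blast
    ultimately have "exec (While ?b ?c) (st i) (l + l' + 1) (st N)"
      using exec.WhileTrue by blast
    moreover have "N - i = Suc (N - Suc i)"
      using step(2) by simp
    then have "l + l' + 1 \<le> (N - i) * (T + 2) + 1"
      using l l' by simp
    ultimately show ?case by blast
  qed
  obtain l where l: "l \<le> N * (T + 2) + 1" "exec (While ?b ?c) (st 0) l (st N)"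
    using loop[of 0] by auto
  have "exec (NSet x (NConst 0)) s 1 (st 0)"
    using exec.NSet[of x "NConst 0" s] by (simp add: st_def)
  from exec.Seq[OF this l(2)]
  have "exec (cmd (PFor x b k p)) s (1 + l) (run (PFor x b k p) s)"
    by (simp add: st_def N_def)
  moreover have "N \<le> M + k"
    using b by (auto simp: N_def M_def)
  then have "1 + l \<le> (k + M) * (T + 2) + 2"
    using l(1) mult_le_mono1[of N "k + M" "T + 2"] by linarith
  moreover have "poly (time (PFor x b k p)) M = (k + M) * (T + 2) + 2"
    by (simp add: T_def distrib_right)
  ultimately show ?case
    unfolding M_def by metis
qed

section \<open>Matchings by auction\<close>

text \<open>Prices belong to \<open>q\<close>-ends; as a function on edges the price is constant on
  edges with the same \<open>q\<close>-end. Unmatched \<open>q\<close>-ends are still free. The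
  condition with \<open>Suc\<close> on the right of \<open>pr m\<close> is the approximate
  complementary slackness of auction algorithms: a matched edge costs at most 1 more than any other
  edge at its \<open>p\<close>-end. The last bound holds because no bid is made on an edge that
  costs more than \<open>n\<close>.\<close>

definition auction_inv ::
    "nat \<Rightarrow> ('e \<Rightarrow> 'p) \<Rightarrow> ('e \<Rightarrow> 'q) \<Rightarrow> 'e set \<Rightarrow> 'e set \<Rightarrow> ('e \<Rightarrow> nat) \<Rightarrow> bool" where
  "auction_inv n p q E M pr \<longleftrightarrow>
     M \<subseteq> E \<and> inj_on p M \<and> inj_on q M \<and>
     (\<forall>x\<in>E. \<forall>y\<in>E. q x = q y \<longrightarrow> pr x = pr y) \<and>
     (\<forall>x\<in>E. q x \<notin> q ` M \<longrightarrow> pr x = 0) \<and>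
     (\<forall>m\<in>M. \<forall>y\<in>E. p m = p y \<longrightarrow> pr m \<le> Suc (pr y)) \<and>
     (\<forall>x\<in>E. pr x \<le> Suc n)"

lemma auction_inv_init: "auction_inv n p q E {} (\<lambda>_. 0)"
  by (simp add: auction_inv_def)

text \<open>The former holder of the \<open>q\<close>-end is evicted. After the raise,
  \<open>x\<close> exceeds each edge at its \<open>p\<close>-end by at most 1, because these edges
  have an unmatched \<open>p\<close>-end as well and are covered by \<open>least\<close>. A
  surviving matched edge keeps its price while its competitors can only become more expensive.
  Ownership of a \<open>q\<close>-end passes on but is never given up.\<close>

lemma auction_inv_step:
  assumes inv: "auction_inv n p q E M pr"
    and x: "x \<in> E" "p x \<notin> p ` M" "pr x \<le> n"
    and least: "\<And>y. y \<in> E \<Longrightarrow> p y \<notin> p ` M \<Longrightarrow> pr x \<le> pr y"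
  shows "auction_inv n p q E (insert x {m \<in> M. q m \<noteq> q x})
    (\<lambda>y. if q y = q x then Suc (pr y) else pr y)"
proof -
  let ?M = "insert x {m \<in> M. q m \<noteq> q x}"
  let ?pr = "\<lambda>y. if q y = q x then Suc (pr y) else pr y"
  have M: "M \<subseteq> E" "inj_on p M" "inj_on q M"
    and const: "\<And>x y. x \<in> E \<Longrightarrow> y \<in> E \<Longrightarrow> q x = q y \<Longrightarrow> pr x = pr y"
    and unowned: "\<And>x. x \<in> E \<Longrightarrow> q x \<notin> q ` M \<Longrightarrow> pr x = 0"
    and cheap: "\<And>m y. m \<in> M \<Longrightarrow> y \<in> E \<Longrightarrow> p m = p y \<Longrightarrow> pr m \<le> Suc (pr y)"
    and bound: "\<And>x. x \<in> E \<Longrightarrow> pr x \<le> Suc n"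
    using inv unfolding auction_inv_def by blast+
  have "?M \<subseteq> E"
    using M x by auto
  moreover have "inj_on p ?M" "inj_on q ?M"
    using M(2,3) x(2) by (auto simp: intro: inj_on_subset)
  moreover have "\<forall>x\<in>E. \<forall>y\<in>E. q x = q y \<longrightarrow> ?pr x = ?pr y"
    by (auto dest: const)
  moreover have "\<forall>y\<in>E. q y \<notin> q ` ?M \<longrightarrow> ?pr y = 0"
  proof (intro ballI impI)
    fix y assume y: "y \<in> E" "q y \<notin> q ` ?M"
    then have "q y \<noteq> q x" by blast
    have "q y \<noteq> q m" if "m \<in> M" for m
    proof
      assume "q y = q m"
      then have "q y \<in> q ` ?M" using that \<open>q y \<noteq> q x\<close> by (intro image_eqI[of _ _ m]) auto
      then show False using y(2) by blast
    qed
    then have "q y \<notin> q ` M" by (metis imageE)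
    then show "?pr y = 0" using unowned[OF y(1)] \<open>q y \<noteq> q x\<close> by simp
  qed
  moreover have "\<forall>m\<in>?M. \<forall>y\<in>E. p m = p y \<longrightarrow> ?pr m \<le> Suc (?pr y)"
  proof (intro ballI impI)
    fix m y assume m: "m \<in> ?M" and y: "y \<in> E" "p m = p y"
    show "?pr m \<le> Suc (?pr y)"
    proof (cases "m = x")
      case True
      then have "pr x \<le> pr y" using least[OF y(1)] y(2) x(2) by metis
      then show ?thesis using True by simp
    next
      case False
      then have "m \<in> M" "q m \<noteq> q x" using m by blast+
      then show ?thesis using cheap[OF _ y] by (simp add: le_SucI)
    qed
  qed
  moreover have "\<forall>y\<in>E. ?pr y \<le> Suc n"
  proof
    fix y assume y: "y \<in> E"
    show "?pr y \<le> Suc n"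
    proof (cases "q y = q x")
      case True
      then have "pr y = pr x" using const[OF y x(1)] by blast
      then show ?thesis using x(3) by simp
    next
      case False
      then show ?thesis using bound[OF y] by simp
    qed
  qed
  ultimately show ?thesis
    unfolding auction_inv_def by - (intro conjI; assumption)
qed

lemma auction_step_progress:
  assumes "finite E" "x \<in> E"
  shows "(\<Sum>y\<in>E. pr y) < (\<Sum>y\<in>E. if q y = q x then Suc (pr y) else pr y)"
proof (rule sum_strict_mono_ex1[OF assms(1)])
  show "\<forall>y\<in>E. pr y \<le> (if q y = q x then Suc (pr y) else pr y)" by simp
  show "\<exists>y\<in>E. pr y < (if q y = q x then Suc (pr y) else pr y)"
    using assms(2) by (intro bexI[of _ x]) simp_all
qed

lemma auction_total_price:
  assumes "auction_inv n p q E M pr" "finite E" "card E \<le> n"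
  shows "(\<Sum>y\<in>E. pr y) < Suc n * Suc n"
proof -
  have "(\<Sum>y\<in>E. pr y) \<le> (\<Sum>y\<in>E. Suc n)"
    using assms(1) unfolding auction_inv_def by (intro sum_mono) blast
  also have "\<dots> \<le> n * Suc n"
    using assms mult_le_mono1[of "card E" n "Suc n"] by simp
  finally show ?thesis by simp
qed

text \<open>Pigeonhole: the \<open>n + 1\<close> levels from 1 to \<open>n + 1\<close> cannot all be
  hit by at most \<open>n\<close> prices.\<close>

lemma price_gap:
  assumes "finite E" "card E \<le> n"
  shows "\<exists>t \<le> n. \<forall>y\<in>E. pr y \<noteq> Suc t"
proof (rule ccontr)
  assume "\<not> ?thesis"
  then have "\<forall>t\<in>{..n}. Suc t \<in> pr ` E" by force
  then have "Suc ` {..n} \<subseteq> pr ` E" by blast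
  then have "card (Suc ` {..n}) \<le> card (pr ` E)"
    using assms by (intro card_mono) auto
  also have "\<dots> \<le> n" using card_image_le[OF assms(1)] assms(2) le_trans by blast
  finally show False by (simp add: card_image)
qed

text \<open>
  Koenig's theorem in terms of prices: a matched edge \<open>m\<close> contributes its \<open>q\<close>-end to the vertex
  cover if its price lies above the gap \<open>t\<close>, and its \<open>p\<close>-end otherwise. The edge \<open>x\<close> is charged to
  the matched edge \<open>m\<close> at a covering end of \<open>x\<close>.
\<close>

definition charged :: "('e \<Rightarrow> 'p) \<Rightarrow> ('e \<Rightarrow> 'q) \<Rightarrow> ('e \<Rightarrow> nat) \<Rightarrow> nat \<Rightarrow> 'e \<Rightarrow> 'e \<Rightarrow> bool" where
  "charged p q pr t x m \<longleftrightarrow> (t < pr x \<and> q x = q m) \<or> (pr x < t \<and> p x = p m)"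

context
  fixes n t :: nat and p :: "'e \<Rightarrow> 'p" and q :: "'e \<Rightarrow> 'q" and E M :: "'e set" and pr :: "'e \<Rightarrow> nat"
  assumes inv: "auction_inv n p q E M pr"
    and finished: "\<And>x. x \<in> E \<Longrightarrow> p x \<notin> p ` M \<Longrightarrow> n < pr x"
    and t: "t \<le> Suc n" "\<And>x. x \<in> E \<Longrightarrow> pr x \<noteq> t"
begin

text \<open>Above the gap the price is positive, so the \<open>q\<close>-end is owned. Below the gap
  it is at most \<open>n\<close>, so an unmatched \<open>p\<close>-end would still be
  bidding.\<close>

lemma charged_exists:
  assumes "x \<in> E"
  shows "\<exists>m\<in>M. charged p q pr t x m"
proof (cases "t < pr x")
  case True
  then have "q x \<in> q ` M"
    using inv assms unfolding auction_inv_def by (metis less_nat_zero_code)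
  then show ?thesis using True by (auto simp: charged_def)
next
  case False
  then have "pr x < t" using t(2)[OF assms] by simp
  moreover from this have "p x \<in> p ` M" using finished[OF assms] t(1) by force
  ultimately show ?thesis by (auto simp: charged_def)
qed

text \<open>The price of \<open>m\<close> alone decides at which end edges are charged to
  \<open>m\<close>: if \<open>z\<close> is charged at the \<open>p\<close>-end, then
  \<open>pr m \<le> Suc (pr z) \<le> t\<close>, and \<open>pr m < t\<close> because no price equals
  \<open>t\<close>. The gap absorbs the 1 lost in the slackness condition.\<close>

lemma charged_same:
  assumes x: "x \<in> E" and y: "y \<in> E" and m: "m \<in> M"
    and ch: "charged p q pr t x m" "charged p q pr t y m"
  shows "p x = p y \<or> q x = q y"
proof -
  have mE: "m \<in> E"
    and const: "\<And>x y. x \<in> E \<Longrightarrow> y \<in> E \<Longrightarrow> q x = q y \<Longrightarrow> pr x = pr y"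
    and cheap: "\<And>y. y \<in> E \<Longrightarrow> p m = p y \<Longrightarrow> pr m \<le> Suc (pr y)"
    using inv m unfolding auction_inv_def by blast+
  have "t < pr z \<longleftrightarrow> t < pr m" if "z \<in> E" "charged p q pr t z m" for z
  proof (cases "t < pr z")
    case True
    then have "q z = q m" using that by (auto simp: charged_def)
    then have "pr z = pr m" using const that mE by blast
    then show ?thesis by simp
  next
    case False
    then have z: "pr z < t" "p z = p m" using that by (auto simp: charged_def)
    then have "pr m \<le> Suc (pr z)" using cheap[OF that(1)] by simp
    then show ?thesis using False z t(2)[OF mE] by simp
  qed
  from this[OF x ch(1)] this[OF y ch(2)] show ?thesis
    using ch by (auto simp: charged_def)
qed

end

section \<open>Lines as planes of homogeneous coordinates\<close>

text \<open>Vectors are functions on \<open>nat\<close>, so that the linear algebra carries no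
  dimension along; \<open>vanishes\<close> bounds the support where inner products enter.\<close>

definition lc :: "real \<Rightarrow> (nat \<Rightarrow> real) \<Rightarrow> real \<Rightarrow> (nat \<Rightarrow> real) \<Rightarrow> nat \<Rightarrow> real" where
  "lc a u b w = (\<lambda>j. a * u j + b * w j)"

definition indep :: "(nat \<Rightarrow> real) \<Rightarrow> (nat \<Rightarrow> real) \<Rightarrow> bool" where
  "indep u w \<longleftrightarrow> (\<forall>a b. lc a u b w = (\<lambda>_. 0) \<longrightarrow> a = 0 \<and> b = 0)"

definition span2 :: "(nat \<Rightarrow> real) \<Rightarrow> (nat \<Rightarrow> real) \<Rightarrow> (nat \<Rightarrow> real) set" where
  "span2 u w = {lc a u b w | a b. True}"

definition plane :: "(nat \<Rightarrow> real) set \<Rightarrow> bool" where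
  "plane S \<longleftrightarrow> (\<exists>u w. indep u w \<and> S = span2 u w)"

text \<open>Subspaces always share zero; a common nonzero vector is a common projective
  point.\<close>

definition meets :: "(nat \<Rightarrow> real) set \<Rightarrow> (nat \<Rightarrow> real) set \<Rightarrow> bool" where
  "meets S T \<longleftrightarrow> (\<exists>v. v \<in> S \<and> v \<in> T \<and> v \<noteq> (\<lambda>_. 0))"

text \<open>For two distinct planes that meet, this is the three-dimensional subspace containing
  both: the projective plane through two lines.\<close>

definition sumset :: "(nat \<Rightarrow> real) set \<Rightarrow> (nat \<Rightarrow> real) set \<Rightarrow> (nat \<Rightarrow> real) set" where
  "sumset S T = {lc 1 s 1 t | s t. s \<in> S \<and> t \<in> T}"

lemma lc_lc: "lc a (lc p u q w) b (lc r u s w) = lc (a * p + b * r) u (a * q + b * s) w"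
  by (auto simp: lc_def algebra_simps)

lemma lc_mem_span2: "v \<in> span2 u w \<Longrightarrow> v' \<in> span2 u w \<Longrightarrow> lc a v b v' \<in> span2 u w"
  unfolding span2_def using lc_lc by blast

lemma plane_lc: "plane S \<Longrightarrow> v \<in> S \<Longrightarrow> v' \<in> S \<Longrightarrow> lc a v b v' \<in> S"
  by (auto simp: plane_def lc_mem_span2)

lemma lc_units: "lc 1 u 0 w = u" "lc 0 u 1 w = w" "lc a u 0 w = (\<lambda>j. a * u j)"
  by (auto simp: lc_def)

lemma span2_self: "u \<in> span2 u w" "w \<in> span2 u w"
  using lc_units unfolding span2_def by (metis (mono_tags, lifting) mem_Collect_eq)+

lemma plane_span2: "indep u w \<Longrightarrow> plane (span2 u w)"
  by (auto simp: plane_def)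

lemma plane_zero: "plane S \<Longrightarrow> (\<lambda>_. 0) \<in> S"
proof -
  assume "plane S"
  then obtain u w where "S = span2 u w" by (auto simp: plane_def)
  moreover have "(\<lambda>_. 0) = lc 0 u 0 w" by (auto simp: lc_def)
  ultimately show ?thesis by (auto simp: span2_def)
qed

lemma meets_sym: "meets S T \<longleftrightarrow> meets T S"
  by (auto simp: meets_def)

lemma indep_nonzero: "indep u w \<Longrightarrow> u \<noteq> (\<lambda>_. 0)" "indep u w \<Longrightarrow> w \<noteq> (\<lambda>_. 0)"
  unfolding indep_def by (metis lc_units(1) zero_neq_one, metis lc_units(2) zero_neq_one)

lemma not_indep_multiple:
  assumes "\<not> indep u w" "u \<noteq> (\<lambda>_. 0)"
  obtains c where "w = (\<lambda>j. c * u j)"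
proof -
  obtain a b where ab: "lc a u b w = (\<lambda>_. 0)" "a \<noteq> 0 \<or> b \<noteq> 0"
    using assms(1) by (auto simp: indep_def)
  have eq: "a * u j + b * w j = 0" for j using fun_cong[OF ab(1), of j] by (simp add: lc_def)
  have "b \<noteq> 0"
  proof
    assume "b = 0"
    then have "u j = 0" for j using eq[of j] ab(2) by simp
    then show False using assms(2) by auto
  qed
  then have "w j = (- a / b) * u j" for j using eq[of j] by (simp add: field_simps add_eq_0_iff)
  then show ?thesis using that by blast
qed

text \<open>Cramer's rule: \<open>D\<close> is the determinant of the coordinates of
  \<open>v\<close> and \<open>v'\<close> in a basis of \<open>S\<close>. If it vanished, the
  adjugate matrix would provide dependencies between \<open>v\<close> and \<open>v'\<close>.\<close>

lemma plane_eq_span2: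
  assumes "plane S" "v \<in> S" "v' \<in> S" "indep v v'"
  shows "S = span2 v v'"
proof -
  obtain u w where S: "S = span2 u w" using assms(1) by (auto simp: plane_def)
  obtain a b c d where v: "v = lc a u b w" and v': "v' = lc c u d w"
    using assms(2,3) S by (auto simp: span2_def)
  define D where "D = a * d - b * c"
  have "D \<noteq> 0"
  proof
    assume D: "D = 0"
    then have "lc d v (- b) v' = (\<lambda>_. 0)" "lc (- c) v a v' = (\<lambda>_. 0)"
      unfolding v v' lc_lc by (auto simp: lc_def D_def algebra_simps)
    then have "d = 0 \<and> - b = 0" "- c = 0 \<and> a = 0"
      using assms(4) unfolding indep_def by blast+
    then have "a = 0" "b = 0" by simp_all
    then have "v = (\<lambda>_. 0)" by (simp add: v lc_def)
    then show False using indep_nonzero(1)[OF assms(4)] by simp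
  qed
  have "u = lc (d / D) v (- b / D) v'"
  proof -
    have "d / D * a + - b / D * c = 1" "d / D * b + - b / D * d = 0"
      using \<open>D \<noteq> 0\<close> by (simp_all add: field_simps) (simp add: D_def algebra_simps)
    then show ?thesis unfolding v v' lc_lc by (simp add: lc_units)
  qed
  moreover have "w = lc (- c / D) v (a / D) v'"
  proof -
    have "- c / D * a + a / D * c = 0" "- c / D * b + a / D * d = 1"
      using \<open>D \<noteq> 0\<close> by (simp_all add: field_simps) (simp add: D_def algebra_simps)
    then show ?thesis unfolding v v' lc_lc by (simp add: lc_units)
  qed
  ultimately have "u \<in> span2 v v'" "w \<in> span2 v v'"
    by (auto simp: span2_def)
  then have "S \<subseteq> span2 v v'"
    unfolding S by (auto simp: span2_def[of u w] lc_mem_span2)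
  moreover have "span2 v v' \<subseteq> S"
    using assms by (auto simp: span2_def[of v v'] plane_lc)
  ultimately show ?thesis by blast
qed

text \<open>Two distinct projective lines share at most one point: a common vector independent of
  \<open>v\<close> would make both equal to the span of the two. So either intersection consists of
  the multiples of \<open>v\<close>.\<close>

lemma distinct_planes_Int_eq:
  assumes "plane L" "plane S" "plane T" "S \<noteq> L" "T \<noteq> L"
    and v: "v \<in> L" "v \<in> S" "v \<in> T" "v \<noteq> (\<lambda>_. 0)"
  shows "S \<inter> L = T \<inter> L"
proof -
  have "X \<inter> L \<subseteq> Y" if "plane X" "plane Y" "X \<noteq> L" "v \<in> X" "v \<in> Y" for X Y
  proof
    fix z assume z: "z \<in> X \<inter> L"
    have "\<not> indep v z"
      using plane_eq_span2[of X v z] plane_eq_span2[of L v z] that z v assms by auto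
    then obtain c where "z = (\<lambda>j. c * v j)"
      using not_indep_multiple v(4) by blast
    then have "z = lc c v 0 v" by (simp add: lc_units)
    then show "z \<in> Y" using plane_lc that by auto
  qed
  from this[of S T] this[of T S] show ?thesis using assms by blast
qed

text \<open>\<open>S\<close> is spanned by \<open>v\<close> and a vector \<open>w\<close> of
  \<open>L\<close>, and the multiples of \<open>w\<close> are absorbed by \<open>L\<close>. Hence a
  single vector of \<open>S\<close> outside \<open>L\<close> determines the sum.\<close>

lemma sumset_meeting_planes:
  assumes "plane L" "plane S" "meets L S" and v: "v \<in> S" "v \<notin> L"
  shows "sumset L S = {lc 1 z c v | z c. z \<in> L}"
proof -
  obtain w where w: "w \<in> L" "w \<in> S" "w \<noteq> (\<lambda>_. 0)"
    using assms by (auto simp: meets_def)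
  have "indep w v"
  proof (rule ccontr)
    assume "\<not> indep w v"
    then obtain c where "v = (\<lambda>j. c * w j)" using not_indep_multiple w by blast
    then have "v = lc c w 0 w" by (simp add: lc_units)
    then show False using plane_lc[OF assms(1) w(1) w(1)] v by auto
  qed
  then have S: "S = span2 w v"
    using plane_eq_span2 assms w by blast
  show ?thesis
  proof (intro equalityI subsetI)
    fix y assume "y \<in> sumset L S"
    then obtain z a b where z: "z \<in> L" "y = lc 1 z 1 (lc a w b v)"
      unfolding S sumset_def span2_def by blast
    then have "y = lc 1 (lc 1 z a w) b v"
      by (simp add: lc_def algebra_simps)
    then show "y \<in> {lc 1 z c v | z c. z \<in> L}"
      using plane_lc[OF assms(1) z(1) w(1)] by blast
  next
    fix y assume "y \<in> {lc 1 z c v | z c. z \<in> L}"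
    then obtain z c where z: "z \<in> L" "y = lc 1 z c v" by blast
    then have "y = lc 1 z 1 (lc c v 0 v)" by (simp add: lc_def)
    then show "y \<in> sumset L S"
      using z plane_lc[OF assms(2) v(1) v(1)] by (auto simp: sumset_def)
  qed
qed

lemma sumset_commute: "sumset S T = sumset T S"
  unfolding sumset_def lc_def by (auto simp: add.commute) (metis add.commute)+

lemma sumset_supset: "plane S \<Longrightarrow> T \<subseteq> sumset S T"
proof
  fix t assume "plane S" "t \<in> T"
  moreover have "t = lc 1 (\<lambda>_. 0) 1 t" by (simp add: lc_def)
  ultimately show "t \<in> sumset S T" using plane_zero unfolding sumset_def by blast
qed

lemma plane_not_subset: "plane S \<Longrightarrow> plane T \<Longrightarrow> S \<noteq> T \<Longrightarrow> \<exists>v. v \<in> S \<and> v \<notin> T"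
proof (rule ccontr)
  assume *: "plane S" "plane T" "S \<noteq> T" "\<nexists>v. v \<in> S \<and> v \<notin> T"
  obtain u w where "indep u w" "S = span2 u w" using * by (auto simp: plane_def)
  moreover from this have "u \<in> T" "w \<in> T" using * span2_self by blast+
  ultimately show False using * plane_eq_span2 by blast
qed

text \<open>The sum is \<open>S\<close> plus the multiples of one vector \<open>f\<close> of
  \<open>L\<close>. Eliminating \<open>f\<close> between two basis vectors of \<open>T\<close>
  leaves a nonzero vector of \<open>S\<close>.\<close>

lemma coplanar_meets:
  assumes "plane L" "plane S" "plane T" "S \<noteq> L" "meets L S" "T \<subseteq> sumset L S"
  shows "meets S T"
proof -
  obtain f where f: "f \<in> L" "f \<notin> S" using plane_not_subset assms by blast
  have sum: "sumset L S = {lc 1 z c f | z c. z \<in> S}"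
    using sumset_meeting_planes[OF assms(2,1) _ f] assms(5) meets_sym sumset_commute by auto
  obtain y y' where y: "indep y y'" "T = span2 y y'" using assms(3) by (auto simp: plane_def)
  then have "y \<in> sumset L S" "y' \<in> sumset L S" using span2_self assms(6) by blast+
  then obtain s c s' c' where s: "s \<in> S" "s' \<in> S" "y = lc 1 s c f" "y' = lc 1 s' c' f"
    unfolding sum by blast
  show ?thesis
  proof (cases "c = 0 \<and> c' = 0")
    case True
    then have "y \<in> S" using s by (simp add: lc_units)
    then show ?thesis
      using y(2) indep_nonzero(1)[OF y(1)] span2_self(1)[of y y'] unfolding meets_def by blast
  next
    case False
    have "lc c' y (- c) y' = lc c' s (- c) s'"
      using s by (simp add: lc_def algebra_simps)
    then have "lc c' y (- c) y' \<in> S" using plane_lc s assms by auto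
    moreover have "lc c' y (- c) y' \<noteq> (\<lambda>_. 0)"
      using y(1) False unfolding indep_def by (metis neg_equal_0_iff_equal)
    moreover have "lc c' y (- c) y' \<in> T" using y by (auto simp: span2_def)
    ultimately show ?thesis by (auto simp: meets_def)
  qed
qed

text \<open>A common vector on \<open>L\<close> spans both intersections with \<open>L\<close>; one
  off \<open>L\<close> generates the same sum with \<open>L\<close> from either side. Conversely,
  two lines in a common projective plane meet.\<close>

lemma meets_iff_same_point_or_plane:
  assumes L: "plane L" and S: "plane S" "S \<noteq> L" "meets L S" and T: "plane T" "T \<noteq> L" "meets L T"
  shows "meets S T \<longleftrightarrow> S \<inter> L = T \<inter> L \<or> sumset L S = sumset L T"
proof
  assume "meets S T"
  then obtain v where v: "v \<in> S" "v \<in> T" "v \<noteq> (\<lambda>_. 0)" by (auto simp: meets_def)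
  show "S \<inter> L = T \<inter> L \<or> sumset L S = sumset L T"
  proof (cases "v \<in> L")
    case True
    then show ?thesis using distinct_planes_Int_eq[OF L S(1) T(1) S(2) T(2)] v by blast
  next
    case False
    then show ?thesis
      using sumset_meeting_planes[OF L S(1) S(3) v(1)] sumset_meeting_planes[OF L T(1) T(3) v(2)]
      by simp
  qed
next
  assume "S \<inter> L = T \<inter> L \<or> sumset L S = sumset L T"
  then show "meets S T"
  proof
    assume "S \<inter> L = T \<inter> L"
    then show ?thesis using S(3) unfolding meets_def by blast
  next
    assume "sumset L S = sumset L T"
    then show ?thesis
      using coplanar_meets[OF L S(1) T(1) S(2,3)] sumset_supset[OF L] by auto
  qed
qed

text \<open>Linear dependence in the quotient by \<open>L\<close>, phrased by a nontrivial
  combination because that is what the criterion for quadratic forms delivers.\<close>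

definition dep_mod :: "(nat \<Rightarrow> real) set \<Rightarrow> (nat \<Rightarrow> real) \<Rightarrow> (nat \<Rightarrow> real) \<Rightarrow> bool" where
  "dep_mod L u v \<longleftrightarrow> (\<exists>a b. (a \<noteq> 0 \<or> b \<noteq> 0) \<and> lc a u b v \<in> L)"

text \<open>In the quotient by \<open>L\<close> both planes shrink to lines, and the sums agree if
  and only if these lines do. All four pairs are tested because a basis vector lying in
  \<open>L\<close> is dependent on everything, and the program does not search for one outside
  \<open>L\<close>.\<close>

lemma sumset_eq_iff_dep_mod:
  assumes L: "plane L"
    and S: "indep x x'" "span2 x x' \<noteq> L" "meets L (span2 x x')"
    and T: "indep y y'" "span2 y y' \<noteq> L" "meets L (span2 y y')"
  shows "sumset L (span2 x x') = sumset L (span2 y y') \<longleftrightarrow>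
    (\<forall>u\<in>{x, x'}. \<forall>v\<in>{y, y'}. dep_mod L u v)"
proof
  assume eq: "sumset L (span2 x x') = sumset L (span2 y y')"
  obtain e where e: "e \<in> span2 x x'" "e \<notin> L"
    using plane_not_subset[OF plane_span2[OF S(1)] L S(2)] by blast
  note sum = sumset_meeting_planes[OF L plane_span2[OF S(1)] S(3) e]
  show "\<forall>u\<in>{x, x'}. \<forall>v\<in>{y, y'}. dep_mod L u v"
  proof (intro ballI)
    fix u v assume uv: "u \<in> {x, x'}" "v \<in> {y, y'}"
    then have "u \<in> span2 x x'" "v \<in> span2 y y'"
      using span2_self by auto
    then have "u \<in> sumset L (span2 x x')" "v \<in> sumset L (span2 x x')"
      using sumset_supset[OF L, of "span2 x x'"] sumset_supset[OF L, of "span2 y y'"]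
      unfolding eq by auto
    then obtain z c z' c' where z: "z \<in> L" "z' \<in> L" "u = lc 1 z c e" "v = lc 1 z' c' e"
      unfolding sum by blast
    show "dep_mod L u v"
    proof (cases "c = 0 \<and> c' = 0")
      case True
      then have "lc 1 u 0 v \<in> L" using z by (simp add: lc_units)
      then show ?thesis unfolding dep_mod_def by (metis zero_neq_one)
    next
      case False
      have "lc c' u (- c) v = lc c' z (- c) z'"
        using z by (simp add: lc_def algebra_simps)
      then show ?thesis using plane_lc[OF L z(1,2)] False unfolding dep_mod_def
        by (metis neg_equal_0_iff_equal)
    qed
  qed
next
  assume dep: "\<forall>u\<in>{x, x'}. \<forall>v\<in>{y, y'}. dep_mod L u v"
  have basis: "\<exists>u\<in>{r, r'}. u \<notin> L" if "indep r r'" "span2 r r' \<noteq> L" for r r'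
    using plane_eq_span2[OF L _ _ that(1)] that(2) by blast
  obtain u v where u: "u \<in> {x, x'}" "u \<notin> L" and v: "v \<in> {y, y'}" "v \<notin> L"
    using basis[OF S(1,2)] basis[OF T(1,2)] by blast
  then obtain a b where ab: "a \<noteq> 0 \<or> b \<noteq> 0" "lc a u b v \<in> L"
    using dep by (auto simp: dep_mod_def)
  \<comment> \<open>A relation that involves \<open>r\<close> alone would put \<open>r\<close> into
    \<open>L\<close>. Hence both coefficients in the relation between \<open>u\<close> and
    \<open>v\<close> are nonzero, and either vector can be replaced by the other.\<close>
  have ne: "c = 0" if "lc c r 0 s \<in> L" "r \<notin> L" for c r s
  proof (rule ccontr)
    assume "c \<noteq> 0"
    then have "r = lc (1 / c) (lc c r 0 s) 0 (lc c r 0 s)" by (simp add: lc_def)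
    then show False using plane_lc[OF L that(1) that(1)] that(2) by metis
  qed
  have "b \<noteq> 0" using ne[of a u v] ab u by auto
  moreover have "lc b v 0 u = lc a u b v" if "a = 0" using that by (simp add: lc_def)
  then have "a \<noteq> 0" using ne[of b v u] ab v by auto
  define k where "k = lc a u b v"
  have k: "k \<in> L" using ab k_def by simp
  have vk: "v = lc (1 / b) k (- a / b) u" and uk: "u = lc (1 / a) k (- b / a) v"
    using \<open>a \<noteq> 0\<close> \<open>b \<noteq> 0\<close> by (auto simp: k_def lc_def field_simps)
  have "{lc 1 z c u | z c. z \<in> L} = {lc 1 z c v | z c. z \<in> L}"
  proof (intro equalityI subsetI)
    fix t assume "t \<in> {lc 1 z c u | z c. z \<in> L}"
    then obtain z c where z: "z \<in> L" "t = lc 1 z c u" by blast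
    then have "t = lc 1 (lc 1 z (c / a) k) (- c * b / a) v"
      by (subst (asm) uk) (simp add: lc_def algebra_simps)
    then show "t \<in> {lc 1 z c v | z c. z \<in> L}" using plane_lc[OF L z(1) k] by blast
  next
    fix t assume "t \<in> {lc 1 z c v | z c. z \<in> L}"
    then obtain z c where z: "z \<in> L" "t = lc 1 z c v" by blast
    then have "t = lc 1 (lc 1 z (c / b) k) (- c * a / b) u"
      by (subst (asm) vk) (simp add: lc_def algebra_simps)
    then show "t \<in> {lc 1 z c u | z c. z \<in> L}" using plane_lc[OF L z(1) k] by blast
  qed
  moreover have "u \<in> span2 x x'" "v \<in> span2 y y'" using u v span2_self by blast+
  ultimately show "sumset L (span2 x x') = sumset L (span2 y y')"
    using sumset_meeting_planes[OF L plane_span2[OF S(1)] S(3), of u]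
      sumset_meeting_planes[OF L plane_span2[OF T(1)] T(3), of v] u v by simp
qed

section \<open>Inner products, Gram determinants and binary quadratic forms\<close>

definition ip :: "nat \<Rightarrow> (nat \<Rightarrow> real) \<Rightarrow> (nat \<Rightarrow> real) \<Rightarrow> real" where
  "ip d u w = (\<Sum>j<d. u j * w j)"

definition vanishes :: "nat \<Rightarrow> (nat \<Rightarrow> real) \<Rightarrow> bool" where
  "vanishes d v \<longleftrightarrow> (\<forall>j\<ge>d. v j = 0)"

lemma ip_commute: "ip d u w = ip d w u"
  by (simp add: ip_def mult.commute)

lemma ip_lc: "ip d (lc a u b w) v = a * ip d u v + b * ip d w v"
  "ip d v (lc a u b w) = a * ip d v u + b * ip d v w"
  by (simp_all add: ip_def lc_def algebra_simps sum.distrib sum_distrib_left)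

lemma ip_self_nonneg: "0 \<le> ip d v v"
  by (simp add: ip_def sum_nonneg)

lemma ip_self_eq_0: "vanishes d v \<Longrightarrow> ip d v v = 0 \<longleftrightarrow> v = (\<lambda>_. 0)"
proof
  assume v: "vanishes d v" and "ip d v v = 0"
  then have "\<forall>j\<in>{..<d}. v j * v j = 0"
    unfolding ip_def by (subst (asm) sum_nonneg_eq_0_iff) auto
  then have "v j = 0" for j using v by (cases "j < d") (auto simp: vanishes_def)
  then show "v = (\<lambda>_. 0)" by blast
qed (simp add: ip_def)

lemma vanishes_lc: "vanishes d u \<Longrightarrow> vanishes d w \<Longrightarrow> vanishes d (lc a u b w)"
  by (simp add: vanishes_def lc_def)

text \<open>The values at \<open>(c, - b)\<close> and \<open>(- b, a)\<close> are multiples of the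
  determinant \<open>a * c - b * b\<close>. Conversely, completing the square at a nontrivial zero
  rules out a positive determinant.\<close>

lemma semidefinite_form:
  fixes a b c :: real
  assumes psd: "\<And>x y. 0 \<le> x * x * a + 2 * x * y * b + y * y * c"
  shows "b * b \<le> a * c"
    and "a * c = b * b \<longleftrightarrow> (\<exists>x y. (x \<noteq> 0 \<or> y \<noteq> 0) \<and> x * x * a + 2 * x * y * b + y * y * c = 0)"
proof -
  have a: "0 \<le> a" and c: "0 \<le> c"
    using psd[of 1 0] psd[of 0 1] by auto
  show "b * b \<le> a * c"
  proof (cases "c = 0")
    case True
    \<comment> \<open>For \<open>c = 0\<close> the form at \<open>(- b, a + 1)\<close> equals
      \<open>- b * b * (a + 2)\<close>, so \<open>b\<close> must vanish.\<close>
    have "0 \<le> (- b) * (- b) * 0 + 2 * (- b) * (a + 1) * b + (a + 1) * (a + 1) * c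
        + b * b * a"
      using psd[of "- b" "a + 1"] by simp
    then have "b * b * (a + 2) \<le> 0" using True by (simp add: algebra_simps)
    then have "b * b \<le> 0" using a by (metis add_nonneg_pos mult_le_0_iff not_le zero_less_numeral)
    then show ?thesis using True by simp
  next
    case False
    have "0 \<le> c * (a * c - b * b)"
      using psd[of c "- b"] by (simp add: algebra_simps)
    then show ?thesis using False c by (simp add: zero_le_mult_iff)
  qed
  show "a * c = b * b \<longleftrightarrow> (\<exists>x y. (x \<noteq> 0 \<or> y \<noteq> 0) \<and> x * x * a + 2 * x * y * b + y * y * c = 0)"
  proof
    assume eq: "a * c = b * b"
    show "\<exists>x y. (x \<noteq> 0 \<or> y \<noteq> 0) \<and> x * x * a + 2 * x * y * b + y * y * c = 0"
    proof (cases "a = 0")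
      case True
      then show ?thesis by (intro exI[of _ 1] exI[of _ 0]) simp
    next
      case False
      have "(- b) * (- b) * a + 2 * (- b) * a * b + a * a * c = a * (a * c - b * b)"
        by (simp add: algebra_simps)
      then show ?thesis using False eq by (intro exI[of _ "- b"] exI[of _ a]) simp
    qed
  next
    assume "\<exists>x y. (x \<noteq> 0 \<or> y \<noteq> 0) \<and> x * x * a + 2 * x * y * b + y * y * c = 0"
    then obtain x y where xy: "x \<noteq> 0 \<or> y \<noteq> 0" "x * x * a + 2 * x * y * b + y * y * c = 0"
      by blast
    have "a * (x * x * a + 2 * x * y * b + y * y * c) = (x * a + y * b)\<^sup>2 + y\<^sup>2 * (a * c - b * b)"
      "c * (x * x * a + 2 * x * y * b + y * y * c) = (x * b + y * c)\<^sup>2 + x\<^sup>2 * (a * c - b * b)"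
      by (simp_all add: algebra_simps power2_eq_square)
    then have "y\<^sup>2 * (a * c - b * b) \<le> 0" "x\<^sup>2 * (a * c - b * b) \<le> 0"
      unfolding xy(2) using zero_le_power2[of "x * a + y * b"] zero_le_power2[of "x * b + y * c"]
      by linarith+
    moreover have "0 < x\<^sup>2 \<or> 0 < y\<^sup>2"
      using xy(1) by simp
    ultimately have "\<not> 0 < a * c - b * b"
      using mult_pos_pos not_le by metis
    then show "a * c = b * b" using \<open>b * b \<le> a * c\<close> by linarith
  qed
qed

text \<open>
  The Gram matrix \<open>g\<close> of four vectors determines the inner product of the components of \<open>r\<close> and \<open>s\<close>
  orthogonal to \<open>u\<close> and \<open>w\<close>; \<open>residual\<close> is this number times the Gram determinant of \<open>u\<close>, \<open>w\<close>.
\<close>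

definition residual :: "('v \<Rightarrow> 'v \<Rightarrow> real) \<Rightarrow> 'v \<Rightarrow> 'v \<Rightarrow> 'v \<Rightarrow> 'v \<Rightarrow> real" where
  "residual g u w r s = (g u u * g w w - g u w * g u w) * g r s
     - g r u * (g w w * g u s - g u w * g w s)
     - g r w * (g u u * g w s - g u w * g u s)"

lemma residual_lc:
  "residual (ip d) u w (lc a r b s) (lc a r b s) =
     a * a * residual (ip d) u w r r + 2 * a * b * residual (ip d) u w r s
     + b * b * residual (ip d) u w s s"
proof -
  have c: "ip d w u = ip d u w" "ip d r u = ip d u r" "ip d r w = ip d w r"
    "ip d s u = ip d u s" "ip d s w = ip d w s" "ip d s r = ip d r s"
    by (simp_all add: ip_commute)
  show ?thesis unfolding residual_def ip_lc c by (simp add: algebra_simps)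
qed

text \<open>The residual of a combination of \<open>u\<close> and \<open>w\<close> with coefficients
  \<open>x\<close> and \<open>y\<close>, where \<open>a\<close>, \<open>b\<close>, \<open>c\<close>
  are the Gram entries of \<open>u\<close> and \<open>w\<close>; over plain reals it is a polynomial
  identity.\<close>

lemma residual_identity:
  fixes a b c x y :: real
  shows "(a * c - b * b) * (x * (x * a + y * b) + y * (x * b + y * c))
    - (x * a + y * b) * (c * (x * a + y * b) - b * (x * b + y * c))
    - (x * b + y * c) * (a * (x * b + y * c) - b * (x * a + y * b)) = 0"
  by (simp add: algebra_simps)

text \<open>\<open>r\<close> is \<open>D\<close> times the component of \<open>v\<close> orthogonal
  to \<open>u\<close> and \<open>w\<close>, the projection coefficients coming from Cramer's rule
  without the division. Its squared length is \<open>D\<close> times the residual, and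
  \<open>D > 0\<close> by independence.\<close>

lemma residual_self:
  assumes "indep u w" "vanishes d u" "vanishes d w" "vanishes d v"
  shows "0 \<le> residual (ip d) u w v v"
    and "residual (ip d) u w v v = 0 \<longleftrightarrow> v \<in> span2 u w"
proof -
  define D where "D = ip d u u * ip d w w - ip d u w * ip d u w"
  define r where "r = lc D v 1 (lc (- (ip d w w * ip d u v - ip d u w * ip d w v)) u
    (- (ip d u u * ip d w v - ip d u w * ip d u v)) w)"
  have form: "x * x * ip d u u + 2 * x * y * ip d u w + y * y * ip d w w =
      ip d (lc x u y w) (lc x u y w)" for x y
    unfolding ip_lc ip_commute[of d w u] by (simp add: algebra_simps)
  have psd: "0 \<le> x * x * ip d u u + 2 * x * y * ip d u w + y * y * ip d w w" for x y
    unfolding form by (rule ip_self_nonneg)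
  have "lc x u y w \<noteq> (\<lambda>_. 0)" if "x \<noteq> 0 \<or> y \<noteq> 0" for x y
    using assms(1) that by (auto simp: indep_def)
  then have "ip d u u * ip d w w \<noteq> ip d u w * ip d u w"
    using semidefinite_form(2)[OF psd] ip_self_eq_0[OF vanishes_lc[OF assms(2,3)]]
    unfolding form by blast
  then have D: "0 < D"
    using semidefinite_form(1)[OF psd] by (simp add: D_def)
  have rr: "ip d r r = D * residual (ip d) u w v v"
    unfolding r_def ip_lc D_def residual_def
      ip_commute[of d w u] ip_commute[of d v u] ip_commute[of d v w]
    by (simp add: algebra_simps)
  show nonneg: "0 \<le> residual (ip d) u w v v"
    using ip_self_nonneg[of d r] D by (simp add: rr zero_le_mult_iff)
  show "residual (ip d) u w v v = 0 \<longleftrightarrow> v \<in> span2 u w"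
  proof
    assume "residual (ip d) u w v v = 0"
    then have "r = (\<lambda>_. 0)"
      using ip_self_eq_0[of d r] rr assms by (simp add: r_def vanishes_lc)
    moreover define b c where "b = ip d w w * ip d u v - ip d u w * ip d w v"
      and "c = ip d u u * ip d w v - ip d u w * ip d u v"
    ultimately have "D * v j = b * u j + c * w j" for j
      using fun_cong[of r "\<lambda>_. 0" j]
      unfolding r_def lc_def b_def c_def by (simp add: algebra_simps)
    then have "v j = b / D * u j + c / D * w j" for j
      using D by (simp add: field_simps)
    then have "v = lc (b / D) u (c / D) w"
      by (auto simp: lc_def)
    then show "v \<in> span2 u w" by (auto simp: span2_def)
  next
    assume "v \<in> span2 u w"
    then obtain x y where v: "v = lc x u y w" by (auto simp: span2_def)
    show "residual (ip d) u w v v = 0"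
      unfolding v residual_def ip_lc ip_commute[of d w u] by (rule residual_identity)
  qed
qed

text \<open>
  With positive semidefinite forms every test below amounts to the vanishing of the determinant
  of a two-by-two matrix of residuals.
\<close>

lemma dep_mod_residual:
  assumes "indep u w" "vanishes d u" "vanishes d w" "vanishes d r" "vanishes d s"
  shows "dep_mod (span2 u w) r s \<longleftrightarrow>
    residual (ip d) u w r r * residual (ip d) u w s s = residual (ip d) u w r s * residual (ip d) u w r s"
proof -
  let ?R = "residual (ip d) u w"
  have R: "0 \<le> ?R (lc x r y s) (lc x r y s)"
    "?R (lc x r y s) (lc x r y s) = 0 \<longleftrightarrow> lc x r y s \<in> span2 u w" for x y
    using residual_self[OF assms(1-3) vanishes_lc[OF assms(4,5)]] by blast+
  show ?thesis
    using semidefinite_form(2)[of "?R r r" "?R r s" "?R s s", folded residual_lc] R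
    by (simp add: dep_mod_def)
qed

text \<open>Independence of \<open>r\<close> and \<open>s\<close> identifies nontrivial combinations
  with nonzero vectors, so meeting is dependence modulo the first plane.\<close>

lemma meets_residual:
  assumes "indep u w" "indep r s" "vanishes d u" "vanishes d w" "vanishes d r" "vanishes d s"
  shows "meets (span2 u w) (span2 r s) \<longleftrightarrow>
    residual (ip d) u w r r * residual (ip d) u w s s = residual (ip d) u w r s * residual (ip d) u w r s"
proof -
  have "meets (span2 u w) (span2 r s) \<longleftrightarrow> dep_mod (span2 u w) r s"
  proof
    assume "meets (span2 u w) (span2 r s)"
    then obtain a b where "lc a r b s \<in> span2 u w" "lc a r b s \<noteq> (\<lambda>_. 0)"
      by (auto simp: meets_def span2_def[of r s])
    moreover from this have "a \<noteq> 0 \<or> b \<noteq> 0" by (auto simp: lc_def)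
    ultimately show "dep_mod (span2 u w) r s" by (auto simp: dep_mod_def)
  next
    assume "dep_mod (span2 u w) r s"
    then obtain a b where "a \<noteq> 0 \<or> b \<noteq> 0" "lc a r b s \<in> span2 u w"
      by (auto simp: dep_mod_def)
    moreover from this have "lc a r b s \<noteq> (\<lambda>_. 0)" using assms(2) by (auto simp: indep_def)
    ultimately show "meets (span2 u w) (span2 r s)"
      by (auto simp: meets_def span2_def[of r s])
  qed
  then show ?thesis using dep_mod_residual assms by simp
qed

text \<open>A sum of nonnegative forms vanishes exactly where both do, so the determinant of the sum
  detects a vector of \<open>span2 r s\<close> lying in both other planes. Each of these differs
  from \<open>span2 r s\<close> and shares at most one point with it, so such a vector means equal
  points. The points themselves are never computed.\<close>

lemma same_point_residual:
  assumes ind: "indep u w" "indep u' w'" "indep r s"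
    and van: "vanishes d u" "vanishes d w" "vanishes d u'" "vanishes d w'" "vanishes d r" "vanishes d s"
    and ne: "span2 u w \<noteq> span2 r s" "span2 u' w' \<noteq> span2 r s"
    and meets: "meets (span2 u w) (span2 r s)"
  shows "span2 u w \<inter> span2 r s = span2 u' w' \<inter> span2 r s \<longleftrightarrow>
    (residual (ip d) u w r r + residual (ip d) u' w' r r)
      * (residual (ip d) u w s s + residual (ip d) u' w' s s) =
    (residual (ip d) u w r s + residual (ip d) u' w' r s)
      * (residual (ip d) u w r s + residual (ip d) u' w' r s)" (is "?l \<longleftrightarrow> ?r")
proof -
  let ?R = "\<lambda>v. residual (ip d) u w v v + residual (ip d) u' w' v v"
  have form: "x * x * (residual (ip d) u w r r + residual (ip d) u' w' r r)
    + 2 * x * y * (residual (ip d) u w r s + residual (ip d) u' w' r s)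
    + y * y * (residual (ip d) u w s s + residual (ip d) u' w' s s) = ?R (lc x r y s)" for x y
    by (simp add: residual_lc algebra_simps)
  have R: "0 \<le> ?R (lc x r y s)"
    "?R (lc x r y s) = 0 \<longleftrightarrow> lc x r y s \<in> span2 u w \<and> lc x r y s \<in> span2 u' w'" for x y
    using residual_self[OF ind(1) van(1,2) vanishes_lc[OF van(5,6)], of x y]
      residual_self[OF ind(2) van(3,4) vanishes_lc[OF van(5,6)], of x y]
    by (auto simp: add_nonneg_eq_0_iff)
  have "?r \<longleftrightarrow> (\<exists>x y. (x \<noteq> 0 \<or> y \<noteq> 0) \<and> ?R (lc x r y s) = 0)"
    unfolding form[symmetric] by (rule semidefinite_form(2)) (simp add: form R)
  also have "\<dots> \<longleftrightarrow> (\<exists>v. v \<in> span2 r s \<and> v \<in> span2 u w \<and> v \<in> span2 u' w' \<and> v \<noteq> (\<lambda>_. 0))"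
  proof
    assume "\<exists>x y. (x \<noteq> 0 \<or> y \<noteq> 0) \<and> ?R (lc x r y s) = 0"
    then obtain x y where "x \<noteq> 0 \<or> y \<noteq> 0" "lc x r y s \<in> span2 u w" "lc x r y s \<in> span2 u' w'"
      using R by blast
    moreover from this have "lc x r y s \<noteq> (\<lambda>_. 0)" using ind(3) by (auto simp: indep_def)
    ultimately show "\<exists>v. v \<in> span2 r s \<and> v \<in> span2 u w \<and> v \<in> span2 u' w' \<and> v \<noteq> (\<lambda>_. 0)"
      by (auto simp: span2_def[of r s])
  next
    assume "\<exists>v. v \<in> span2 r s \<and> v \<in> span2 u w \<and> v \<in> span2 u' w' \<and> v \<noteq> (\<lambda>_. 0)"
    then obtain x y where "lc x r y s \<in> span2 u w" "lc x r y s \<in> span2 u' w'" "lc x r y s \<noteq> (\<lambda>_. 0)"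
      by (auto simp: span2_def[of r s])
    moreover from this have "x \<noteq> 0 \<or> y \<noteq> 0" by (auto simp: lc_def)
    ultimately show "\<exists>x y. (x \<noteq> 0 \<or> y \<noteq> 0) \<and> ?R (lc x r y s) = 0" using R by blast
  qed
  also have "\<dots> \<longleftrightarrow> ?l"
  proof
    assume "\<exists>v. v \<in> span2 r s \<and> v \<in> span2 u w \<and> v \<in> span2 u' w' \<and> v \<noteq> (\<lambda>_. 0)"
    then show ?l
      using distinct_planes_Int_eq[OF plane_span2[OF ind(3)] plane_span2[OF ind(1)]
          plane_span2[OF ind(2)] ne] by blast
  next
    assume ?l
    then show "\<exists>v. v \<in> span2 r s \<and> v \<in> span2 u w \<and> v \<in> span2 u' w' \<and> v \<noteq> (\<lambda>_. 0)"
      using meets unfolding meets_def by blast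
  qed
  finally show ?thesis by blast
qed

text \<open>The equality case of the Cauchy-Schwarz inequality; it serves as the test for parallel
  directions.\<close>

lemma dep_ip:
  assumes "vanishes d r" "vanishes d s"
  shows "ip d r r * ip d s s = ip d r s * ip d r s \<longleftrightarrow> \<not> indep r s"
proof -
  have form: "x * x * ip d r r + 2 * x * y * ip d r s + y * y * ip d s s =
      ip d (lc x r y s) (lc x r y s)" for x y
    unfolding ip_lc ip_commute[of d s r] by (simp add: algebra_simps)
  show ?thesis
    using semidefinite_form(2)[of "ip d r r" "ip d r s" "ip d s s"]
    unfolding form by (auto simp: ip_self_nonneg ip_self_eq_0 assms vanishes_lc indep_def)
qed

section \<open>Elementary programs\<close>

lemma upd2_apply: "upd2 A i j x i' j' = (if i' = i \<and> j' = j then x else A i' j')"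
  by (simp add: upd2_def)

lemma upd2_upd2: "upd2 (upd2 A i j x) i j y = upd2 A i j y"
  by (simp add: upd2_def)

lemma upd2_same: "upd2 A i j (A i j) = A"
  by (simp add: upd2_def)

definition BEq :: "nexp \<Rightarrow> nexp \<Rightarrow> bexp" where
  "BEq a b = BAnd (BNot (NLess a b)) (BNot (NLess b a))"

definition BREq :: "rexp \<Rightarrow> rexp \<Rightarrow> bexp" where
  "BREq a b = BAnd (BNot (RLess a b)) (BNot (RLess b a))"

definition BOr :: "bexp \<Rightarrow> bexp \<Rightarrow> bexp" where
  "BOr b c = BNot (BAnd (BNot b) (BNot c))"

definition BNonzero :: "nexp \<Rightarrow> bexp" where
  "BNonzero a = NLess (NConst 0) a"

lemma bval_derived [simp]:
  "bval (BEq a b) s \<longleftrightarrow> nval a s = nval b s"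
  "bval (BREq x y) s \<longleftrightarrow> rval x s = rval y s"
  "bval (BOr c d) s \<longleftrightarrow> bval c s \<or> bval d s"
  "bval (BNonzero a) s \<longleftrightarrow> nval a s \<noteq> 0"
  by (auto simp: BEq_def BREq_def BOr_def BNonzero_def)

text \<open>The machine has two-dimensional arrays only; sequences indexed by lines live in column
  0.\<close>

definition NCol :: "name \<Rightarrow> nexp \<Rightarrow> nexp" where
  "NCol x i = NArr x i (NConst 0)"

lemma nval_NCol [simp]: "nval (NCol x i) s = narr s x (nval i s) 0"
  by (simp add: NCol_def)

text \<open>Products are added to the entries already present. A preset entry can thus account for
  the homogenizing coordinate of affine points, and the input vectors need not be extended.\<close>

definition gram_prog :: "name \<Rightarrow> name \<Rightarrow> name \<Rightarrow> prog" where
  "gram_prog X u v =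
    PFor ''i'' ''n'' 0 (PFor ''j'' ''n'' 0 (PFor ''k'' ''m'' 0
      (PRArrSet X (NReg ''i'') (NReg ''j'')
        (RAdd (RArr X (NReg ''i'') (NReg ''j''))
          (RMul (RArr u (NReg ''i'') (NReg ''k'')) (RArr v (NReg ''j'') (NReg ''k'')))))))"

lemma writes_gram_prog: "writes (gram_prog X u v) = {''i'', ''j'', ''k'', X}"
  by (auto simp: gram_prog_def)

lemma rarr_gram_prog:
  assumes "u \<notin> {''i'', ''j'', ''k'', X}" "v \<notin> {''i'', ''j'', ''k'', X}" "X \<notin> {''i'', ''j'', ''k'', ''n'', ''m''}"
  shows "rarr (run (gram_prog X u v) s) X i j = rarr s X i j +
    (if i < nreg s ''n'' \<and> j < nreg s ''n'' then \<Sum>k<nreg s ''m''. rarr s u i k * rarr s v j k else 0)"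
proof -
  define n m where "n = nreg s ''n''" and "m = nreg s ''m''"
  define S where "S i j l = (\<Sum>k<l. rarr s u i k * rarr s v j k)" for i j and l :: nat
  let ?W = "{''i'', ''j'', ''k'', X}"
  let ?c = "PRArrSet X (NReg ''i'') (NReg ''j'')
        (RAdd (RArr X (NReg ''i'') (NReg ''j''))
          (RMul (RArr u (NReg ''i'') (NReg ''k'')) (RArr v (NReg ''j'') (NReg ''k''))))"
  \<comment> \<open>Nested loops are treated from the inside out, each for an arbitrary state that
    differs from \<open>s\<close> only on \<open>?W\<close>.\<close>
  have inner: "rarr (run (PFor ''k'' ''m'' 0 ?c) t) X =
      upd2 (rarr t X) (nreg t ''i'') (nreg t ''j'')
        (rarr t X (nreg t ''i'') (nreg t ''j'') + S (nreg t ''i'') (nreg t ''j'') m)"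
    if ag: "agree ?W s t" for t
  proof (rule run_PForI[where N = m and I = "\<lambda>l t'. rarr t' X =
      upd2 (rarr t X) (nreg t ''i'') (nreg t ''j'')
        (rarr t X (nreg t ''i'') (nreg t ''j'') + S (nreg t ''i'') (nreg t ''j'') l)"])
    show "m = nreg t ''m'' + 0" using agreeD(1)[OF ag, of "''m''"] assms by (auto simp: m_def)
  next
    fix l t' assume ag': "agree (insert ''k'' (writes ?c)) t t'"
      and I: "rarr t' X =
      upd2 (rarr t X) (nreg t ''i'') (nreg t ''j'')
        (rarr t X (nreg t ''i'') (nreg t ''j'') + S (nreg t ''i'') (nreg t ''j'') l)"
    have "rarr t' u = rarr s u" "rarr t' v = rarr s v"
      "nreg t' ''i'' = nreg t ''i''" "nreg t' ''j'' = nreg t ''j''"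
      using agreeD(3)[OF ag', of u] agreeD(3)[OF ag', of v] agreeD(3)[OF ag, of u] agreeD(3)[OF ag, of v]
        agreeD(1)[OF ag', of "''i''"] agreeD(1)[OF ag', of "''j''"] assms by auto
    then show "rarr (run ?c (set_nreg ''k'' l t')) X =
      upd2 (rarr t X) (nreg t ''i'') (nreg t ''j'')
        (rarr t X (nreg t ''i'') (nreg t ''j'') + S (nreg t ''i'') (nreg t ''j'') (Suc l))"
      by (simp add: I upd2_upd2 upd2_apply S_def add.assoc)
  qed (simp_all add: S_def upd2_same)
  have mid: "rarr (run (PFor ''j'' ''n'' 0 (PFor ''k'' ''m'' 0 ?c)) t) X i' j' =
      rarr t X i' j' + (if i' = nreg t ''i'' \<and> j' < n then S i' j' m else 0)"
    if ag: "agree ?W s t" for t i' j'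
  proof (rule run_PForI[where N = n and I = "\<lambda>l t'. \<forall>i' j'. rarr t' X i' j' =
      rarr t X i' j' + (if i' = nreg t ''i'' \<and> j' < l then S i' j' m else 0)"])
    show "n = nreg t ''n'' + 0" using agreeD(1)[OF ag, of "''n''"] assms by (auto simp: n_def)
  next
    fix l t' assume ag': "agree (insert ''j'' (writes (PFor ''k'' ''m'' 0 ?c))) t t'"
      and I: "\<forall>i' j'. rarr t' X i' j' =
      rarr t X i' j' + (if i' = nreg t ''i'' \<and> j' < l then S i' j' m else 0)"
    have "agree ?W s (set_nreg ''j'' l t')"
      using agree_trans[OF ag agree_mono[OF ag', of ?W]] by (auto intro: agree_set_nreg)
    moreover have "nreg t' ''i'' = nreg t ''i''"
      using agreeD(1)[OF ag', of "''i''"] assms by auto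
    ultimately show "\<forall>i' j'. rarr (run (PFor ''k'' ''m'' 0 ?c) (set_nreg ''j'' l t')) X i' j' =
      rarr t X i' j' + (if i' = nreg t ''i'' \<and> j' < Suc l then S i' j' m else 0)"
      using I by (simp add: inner upd2_apply less_Suc_eq del: run.simps)
  qed simp_all
  have "rarr (run (gram_prog X u v) s) X i j =
      rarr s X i j + (if i < n \<and> j < n then S i j m else 0)"
    unfolding gram_prog_def
  proof (rule run_PForI[where N = n and I = "\<lambda>l t'. \<forall>i' j'. rarr t' X i' j' =
      rarr s X i' j' + (if i' < l \<and> j' < n then S i' j' m else 0)"])
    show "n = nreg s ''n'' + 0" by (simp add: n_def)
  next
    fix l t' assume ag': "agree (insert ''i'' (writes (PFor ''j'' ''n'' 0 (PFor ''k'' ''m'' 0 ?c)))) s t'"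
      and I: "\<forall>i' j'. rarr t' X i' j' =
      rarr s X i' j' + (if i' < l \<and> j' < n then S i' j' m else 0)"
    have "agree ?W s (set_nreg ''i'' l t')"
      using agree_mono[OF ag', of ?W] by (auto intro: agree_set_nreg)
    then show "\<forall>i' j'. rarr (run (PFor ''j'' ''n'' 0 (PFor ''k'' ''m'' 0 ?c)) (set_nreg ''i'' l t')) X i' j' =
      rarr s X i' j' + (if i' < Suc l \<and> j' < n then S i' j' m else 0)"
      using I by (simp add: mid less_Suc_eq del: run.simps)
  qed simp_all
  then show ?thesis by (simp add: n_def m_def S_def)
qed

definition ones_prog :: "name \<Rightarrow> prog" where
  "ones_prog X = PFor ''i'' ''n'' 0 (PFor ''j'' ''n'' 0
    (PRArrSet X (NReg ''i'') (NReg ''j'') (RConst 1)))"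

lemma writes_ones_prog: "writes (ones_prog X) = {''i'', ''j'', X}"
  by (auto simp: ones_prog_def)

lemma rarr_ones_prog:
  assumes "X \<notin> {''i'', ''j'', ''n''}"
  shows "rarr (run (ones_prog X) s) X i j =
    (if i < nreg s ''n'' \<and> j < nreg s ''n'' then 1 else rarr s X i j)"
proof -
  define n where "n = nreg s ''n''"
  let ?c = "PRArrSet X (NReg ''i'') (NReg ''j'') (RConst 1)"
  have inner: "rarr (run (PFor ''j'' ''n'' 0 ?c) t) X i' j' =
      (if i' = nreg t ''i'' \<and> j' < n then 1 else rarr t X i' j')"
    if n: "nreg t ''n'' = n" for t i' j'
  proof (rule run_PForI[where N = n and I = "\<lambda>l t'. \<forall>i' j'. rarr t' X i' j' =
      (if i' = nreg t ''i'' \<and> j' < l then 1 else rarr t X i' j')"])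
    fix l t' assume ag': "agree (insert ''j'' (writes ?c)) t t'"
      and I: "\<forall>i' j'. rarr t' X i' j' =
      (if i' = nreg t ''i'' \<and> j' < l then 1 else rarr t X i' j')"
    have "nreg t' ''i'' = nreg t ''i''"
      using agreeD(1)[OF ag', of "''i''"] assms by auto
    then show "\<forall>i' j'. rarr (run ?c (set_nreg ''j'' l t')) X i' j' =
      (if i' = nreg t ''i'' \<and> j' < Suc l then 1 else rarr t X i' j')"
      using I by (simp add: upd2_apply less_Suc_eq)
  qed (simp_all add: n)
  have "rarr (run (ones_prog X) s) X i j = (if i < n \<and> j < n then 1 else rarr s X i j)"
    unfolding ones_prog_def
  proof (rule run_PForI[where N = n and I = "\<lambda>l t'. \<forall>i' j'. rarr t' X i' j' =
      (if i' < l \<and> j' < n then 1 else rarr s X i' j')"])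
    show "n = nreg s ''n'' + 0" by (simp add: n_def)
  next
    fix l t' assume ag': "agree (insert ''i'' (writes (PFor ''j'' ''n'' 0 ?c))) s t'"
      and I: "\<forall>i' j'. rarr t' X i' j' = (if i' < l \<and> j' < n then 1 else rarr s X i' j')"
    have "nreg t' ''n'' = n"
      using agreeD(1)[OF ag', of "''n''"] assms by (auto simp: n_def)
    then show "\<forall>i' j'. rarr (run (PFor ''j'' ''n'' 0 ?c) (set_nreg ''i'' l t')) X i' j' =
      (if i' < Suc l \<and> j' < n then 1 else rarr s X i' j')"
      using I by (simp add: inner less_Suc_eq del: run.simps)
  qed simp_all
  then show ?thesis by (simp add: n_def)
qed

definition fill_prog :: "name \<Rightarrow> bexp \<Rightarrow> prog" where
  "fill_prog X c = PFor ''i'' ''n'' 0 (PFor ''j'' ''n'' 0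
    (PIf c (PNArrSet X (NReg ''i'') (NReg ''j'') (NConst (Suc 0)))))"

lemma writes_fill_prog: "writes (fill_prog X c) = {''i'', ''j'', X}"
  by (auto simp: fill_prog_def)

text \<open>The test has to be understood only in states agreeing with \<open>s\<close> outside the
  counters and \<open>X\<close>, to which the geometric facts known for \<open>s\<close> carry
  over.\<close>

lemma narr_fill_prog:
  assumes X: "X \<notin> {''i'', ''j'', ''n''}"
    and zero: "\<And>i j. narr s X i j = 0"
    and c: "\<And>t. agree {''i'', ''j'', X} s t \<Longrightarrow> nreg t ''i'' < nreg s ''n'' \<Longrightarrow> nreg t ''j'' < nreg s ''n'' \<Longrightarrow>
      bval c t \<longleftrightarrow> R (nreg t ''i'') (nreg t ''j'')"
  shows "narr (run (fill_prog X c) s) X i j = of_bool (i < nreg s ''n'' \<and> j < nreg s ''n'' \<and> R i j)"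
proof -
  define n where "n = nreg s ''n''"
  let ?c = "PIf c (PNArrSet X (NReg ''i'') (NReg ''j'') (NConst (Suc 0)))"
  let ?W = "{''i'', ''j'', X}"
  have inner: "narr (run (PFor ''j'' ''n'' 0 ?c) t) X i' j' =
      (if i' = nreg t ''i'' \<and> j' < n \<and> R i' j' then 1 else narr t X i' j')"
    if ag: "agree ?W s t" and i: "nreg t ''i'' < n" for t i' j'
  proof (rule run_PForI[where N = n and I = "\<lambda>l t'. \<forall>i' j'. narr t' X i' j' =
      (if i' = nreg t ''i'' \<and> j' < l \<and> R i' j' then 1 else narr t X i' j')"])
    show "n = nreg t ''n'' + 0" using agreeD(1)[OF ag, of "''n''"] X by (auto simp: n_def)
  next
    fix l t' assume ag': "agree (insert ''j'' (writes ?c)) t t'" and l: "l < n"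
      and I: "\<forall>i' j'. narr t' X i' j' =
      (if i' = nreg t ''i'' \<and> j' < l \<and> R i' j' then 1 else narr t X i' j')"
    have i': "nreg t' ''i'' = nreg t ''i''"
      using agreeD(1)[OF ag', of "''i''"] X by auto
    have "agree ?W s (set_nreg ''j'' l t')"
      using agree_trans[OF ag agree_mono[OF ag', of ?W]] by (auto intro: agree_set_nreg)
    from c[OF this] have "bval c (set_nreg ''j'' l t') \<longleftrightarrow> R (nreg t ''i'') l"
      using i i' l by (simp add: n_def)
    then show "\<forall>i' j'. narr (run ?c (set_nreg ''j'' l t')) X i' j' =
      (if i' = nreg t ''i'' \<and> j' < Suc l \<and> R i' j' then 1 else narr t X i' j')"
      using I i' by (auto simp add: upd2_apply less_Suc_eq)
  qed simp_all
  have "narr (run (fill_prog X c) s) X i j = of_bool (i < n \<and> j < n \<and> R i j)"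
    unfolding fill_prog_def
  proof (rule run_PForI[where N = n and I = "\<lambda>l t'. \<forall>i' j'. narr t' X i' j' =
      of_bool (i' < l \<and> j' < n \<and> R i' j')"])
    show "n = nreg s ''n'' + 0" by (simp add: n_def)
  next
    fix l t' assume ag': "agree (insert ''i'' (writes (PFor ''j'' ''n'' 0 ?c))) s t'" and l: "l < n"
      and I: "\<forall>i' j'. narr t' X i' j' = of_bool (i' < l \<and> j' < n \<and> R i' j')"
    have "agree ?W s (set_nreg ''i'' l t')"
      using agree_mono[OF ag', of ?W] by (auto intro: agree_set_nreg)
    then show "\<forall>i' j'. narr (run (PFor ''j'' ''n'' 0 ?c) (set_nreg ''i'' l t')) X i' j' =
      of_bool (i' < Suc l \<and> j' < n \<and> R i' j')"
      using I l by (simp add: inner less_Suc_eq del: run.simps)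
  qed (simp_all add: zero)
  then show ?thesis by (simp add: n_def)
qed

text \<open>Counting the earlier parallel lines gives the rank within the parallel class; lines of
  equal rank are then never parallel.\<close>

definition layer_prog :: prog where
  "layer_prog = PFor ''i'' ''n'' 0 (PFor ''j'' ''n'' 0
    (PIf (BAnd (NLess (NReg ''j'') (NReg ''i'')) (BNonzero (NArr ''par'' (NReg ''i'') (NReg ''j''))))
      (PNArrSet ''lay'' (NReg ''i'') (NConst 0) (NAdd (NCol ''lay'' (NReg ''i'')) (NConst (Suc 0))))))"

lemma writes_layer_prog: "writes layer_prog = {''i'', ''j'', ''lay''}"
  by (auto simp: layer_prog_def)

lemma narr_layer_prog:
  assumes "\<And>i j. narr s ''lay'' i j = 0" "i < nreg s ''n''"
  shows "narr (run layer_prog s) ''lay'' i 0 = card {j. j < i \<and> narr s ''par'' i j \<noteq> 0}"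
proof -
  define n where "n = nreg s ''n''"
  let ?b = "BAnd (NLess (NReg ''j'') (NReg ''i'')) (BNonzero (NArr ''par'' (NReg ''i'') (NReg ''j'')))"
  let ?c = "PIf ?b (PNArrSet ''lay'' (NReg ''i'') (NConst 0) (NAdd (NCol ''lay'' (NReg ''i'')) (NConst (Suc 0))))"
  let ?W = "{''i'', ''j'', ''lay''}"
  let ?S = "\<lambda>i l. {j. j < i \<and> j < l \<and> narr s ''par'' i j \<noteq> 0}"
  have S: "?S i (Suc l) = (if l < i \<and> narr s ''par'' i l \<noteq> 0 then insert l (?S i l) else ?S i l)" for i l
    by (auto simp: less_Suc_eq)
  have inner: "narr (run (PFor ''j'' ''n'' 0 ?c) t) ''lay'' =
      upd2 (narr t ''lay'') (nreg t ''i'') 0 (narr t ''lay'' (nreg t ''i'') 0 + card (?S (nreg t ''i'') n))"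
    if ag: "agree ?W s t" for t
  proof (rule run_PForI[where N = n and I = "\<lambda>l t'. narr t' ''lay'' =
      upd2 (narr t ''lay'') (nreg t ''i'') 0 (narr t ''lay'' (nreg t ''i'') 0 + card (?S (nreg t ''i'') l))"])
    show "n = nreg t ''n'' + 0" using agreeD(1)[OF ag, of "''n''"] by (simp add: n_def)
  next
    fix l t' assume ag': "agree (insert ''j'' (writes ?c)) t t'"
      and I: "narr t' ''lay'' =
      upd2 (narr t ''lay'') (nreg t ''i'') 0 (narr t ''lay'' (nreg t ''i'') 0 + card (?S (nreg t ''i'') l))"
    have "nreg t' ''i'' = nreg t ''i''" "narr t' ''par'' = narr s ''par''"
      using agreeD[OF ag'] agreeD[OF ag] by auto
    then show "narr (run ?c (set_nreg ''j'' l t')) ''lay'' =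
      upd2 (narr t ''lay'') (nreg t ''i'') 0 (narr t ''lay'' (nreg t ''i'') 0 + card (?S (nreg t ''i'') (Suc l)))"
      unfolding S by (simp add: I upd2_upd2 upd2_apply)
  qed (simp_all add: upd2_same)
  have "narr (run layer_prog s) ''lay'' i 0 = card (?S i n)"
    unfolding layer_prog_def
  proof (rule run_PForI[where N = n and I = "\<lambda>l t'. \<forall>i'. narr t' ''lay'' i' 0 =
      (if i' < l then card (?S i' n) else 0)"])
    show "n = nreg s ''n'' + 0" by (simp add: n_def)
  next
    fix l t' assume ag': "agree (insert ''i'' (writes (PFor ''j'' ''n'' 0 ?c))) s t'"
      and I: "\<forall>i'. narr t' ''lay'' i' 0 = (if i' < l then card (?S i' n) else 0)"
    have "agree ?W s (set_nreg ''i'' l t')"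
      using agree_mono[OF ag', of ?W] by (auto intro: agree_set_nreg)
    then show "\<forall>i'. narr (run (PFor ''j'' ''n'' 0 ?c) (set_nreg ''i'' l t')) ''lay'' i' 0 =
      (if i' < Suc l then card (?S i' n) else 0)"
      using I by (simp add: inner upd2_apply less_Suc_eq del: run.simps)
  qed (use assms in \<open>simp_all add: n_def\<close>)
  moreover have "?S i n = {j. j < i \<and> narr s ''par'' i j \<noteq> 0}"
    using assms(2) by (auto simp: n_def)
  ultimately show ?thesis by simp
qed

text \<open>\<open>own\<close> assigns each line to itself if the greedy clique of its layer contains it, and otherwise
  to a line of that clique which it meets.\<close>

definition own_prog :: prog where
  "own_prog = PFor ''i'' ''n'' 0
    (PNArrSet ''own'' (NReg ''i'') (NConst 0) (NReg ''i'') ;;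
     PFor ''j'' ''n'' 0
      (PIf (BAnd (NLess (NReg ''j'') (NReg ''i''))
            (BAnd (BEq (NCol ''own'' (NReg ''j'')) (NReg ''j''))
            (BAnd (BEq (NCol ''lay'' (NReg ''j'')) (NCol ''lay'' (NReg ''i'')))
              (BNonzero (NArr ''meet'' (NReg ''i'') (NReg ''j''))))))
        (PNArrSet ''own'' (NReg ''i'') (NConst 0) (NReg ''j''))))"

lemma writes_own_prog: "writes own_prog = {''i'', ''j'', ''own''}"
  by (auto simp: own_prog_def)

text \<open>The parameter \<open>l\<close> counts the candidates already inspected, which makes this
  the invariant of the inner loop; the result is the case \<open>l = n\<close>.\<close>

definition own_spec :: "(nat \<Rightarrow> nat) \<Rightarrow> (nat \<Rightarrow> nat \<Rightarrow> bool) \<Rightarrow> nat \<Rightarrow> (nat \<Rightarrow> nat) \<Rightarrow> nat \<Rightarrow> bool" where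
  "own_spec lay adj l own i \<longleftrightarrow>
    (own i = i \<and> (\<forall>j<i. j < l \<longrightarrow> own j = j \<longrightarrow> lay j = lay i \<longrightarrow> \<not> adj i j)) \<or>
    (own i < i \<and> own (own i) = own i \<and> lay (own i) = lay i \<and> adj i (own i))"

lemma narr_own_prog:
  assumes "i < nreg s ''n''"
  shows "own_spec (\<lambda>i. narr s ''lay'' i 0) (\<lambda>i j. narr s ''meet'' i j \<noteq> 0) (nreg s ''n'')
    (\<lambda>i. narr (run own_prog s) ''own'' i 0) i"
proof -
  define n where "n = nreg s ''n''"
  let ?b = "BAnd (NLess (NReg ''j'') (NReg ''i''))
            (BAnd (BEq (NCol ''own'' (NReg ''j'')) (NReg ''j''))
            (BAnd (BEq (NCol ''lay'' (NReg ''j'')) (NCol ''lay'' (NReg ''i'')))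
              (BNonzero (NArr ''meet'' (NReg ''i'') (NReg ''j'')))))"
  let ?c = "PIf ?b (PNArrSet ''own'' (NReg ''i'') (NConst 0) (NReg ''j''))"
  let ?W = "{''i'', ''j'', ''own''}"
  let ?spec = "own_spec (\<lambda>i. narr s ''lay'' i 0) (\<lambda>i j. narr s ''meet'' i j \<noteq> 0)"
  have inner: "\<exists>x. narr (run (PFor ''j'' ''n'' 0 ?c) t) ''own'' = upd2 (narr t ''own'') (nreg t ''i'') 0 x \<and>
      ?spec n (\<lambda>i. upd2 (narr t ''own'') (nreg t ''i'') 0 x i 0) (nreg t ''i'')"
    if ag: "agree ?W s t" and i: "narr t ''own'' (nreg t ''i'') 0 = nreg t ''i''" for t
  proof (rule run_PForI[where N = n and I = "\<lambda>l t'. \<exists>x. narr t' ''own'' = upd2 (narr t ''own'') (nreg t ''i'') 0 x \<and>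
      ?spec l (\<lambda>i. upd2 (narr t ''own'') (nreg t ''i'') 0 x i 0) (nreg t ''i'')"])
    show "n = nreg t ''n'' + 0" using agreeD(1)[OF ag, of "''n''"] by (simp add: n_def)
    show "\<exists>x. narr t ''own'' = upd2 (narr t ''own'') (nreg t ''i'') 0 x \<and>
      ?spec 0 (\<lambda>i. upd2 (narr t ''own'') (nreg t ''i'') 0 x i 0) (nreg t ''i'')"
      using i by (intro exI[of _ "nreg t ''i''"]) (auto simp: own_spec_def fun_eq_iff upd2_apply)
  next
    fix l t' assume ag': "agree (insert ''j'' (writes ?c)) t t'"
      and I: "\<exists>x. narr t' ''own'' = upd2 (narr t ''own'') (nreg t ''i'') 0 x \<and>
      ?spec l (\<lambda>i. upd2 (narr t ''own'') (nreg t ''i'') 0 x i 0) (nreg t ''i'')"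
    from I obtain x where x: "narr t' ''own'' = upd2 (narr t ''own'') (nreg t ''i'') 0 x"
      "?spec l (\<lambda>i. upd2 (narr t ''own'') (nreg t ''i'') 0 x i 0) (nreg t ''i'')" by blast
    have eq: "nreg t' ''i'' = nreg t ''i''" "narr t' ''lay'' = narr s ''lay''" "narr t' ''meet'' = narr s ''meet''"
      using agreeD[OF ag'] agreeD[OF ag] by auto
    show "\<exists>x. narr (run ?c (set_nreg ''j'' l t')) ''own'' = upd2 (narr t ''own'') (nreg t ''i'') 0 x \<and>
      ?spec (Suc l) (\<lambda>i. upd2 (narr t ''own'') (nreg t ''i'') 0 x i 0) (nreg t ''i'')"
    proof (cases "bval ?b (set_nreg ''j'' l t')")
      case True
      then have "narr (run ?c (set_nreg ''j'' l t')) ''own'' = upd2 (narr t ''own'') (nreg t ''i'') 0 l"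
        using eq x(1) by (simp add: upd2_upd2)
      moreover have "?spec (Suc l) (\<lambda>i. upd2 (narr t ''own'') (nreg t ''i'') 0 l i 0) (nreg t ''i'')"
        using True eq x(1) by (auto simp: own_spec_def upd2_apply)
      ultimately show ?thesis by blast
    next
      case False
      then have "run ?c (set_nreg ''j'' l t') = set_nreg ''j'' l t'"
        by (simp only: run.simps if_False)
      then have "narr (run ?c (set_nreg ''j'' l t')) ''own'' = upd2 (narr t ''own'') (nreg t ''i'') 0 x"
        using x(1) by simp
      moreover have "?spec (Suc l) (\<lambda>i. upd2 (narr t ''own'') (nreg t ''i'') 0 x i 0) (nreg t ''i'')"
        using False eq x by (auto simp: own_spec_def upd2_apply less_Suc_eq)
      ultimately show ?thesis by blast
    qed
  qed simp_all
  have "\<forall>i<n. ?spec n (\<lambda>i. narr (run own_prog s) ''own'' i 0) i"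
    unfolding own_prog_def
  proof (rule run_PForI[where N = n and I = "\<lambda>l t'. \<forall>i<l. ?spec n (\<lambda>i. narr t' ''own'' i 0) i"])
    show "n = nreg s ''n'' + 0" by (simp add: n_def)
  next
    let ?init = "PNArrSet ''own'' (NReg ''i'') (NConst 0) (NReg ''i'')"
    fix l t' assume ag': "agree (insert ''i'' (writes (?init ;; PFor ''j'' ''n'' 0 ?c))) s t'"
      and I: "\<forall>i<l. ?spec n (\<lambda>i. narr t' ''own'' i 0) i"
    define t where "t = run ?init (set_nreg ''i'' l t')"
    have "agree ?W s (set_nreg ''i'' l t')"
      using agree_mono[OF ag', of ?W] by (auto intro: agree_set_nreg)
    moreover have "agree ?W (set_nreg ''i'' l t') t"
      unfolding t_def by (rule agree_mono[OF agree_run]) simp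
    ultimately have "agree ?W s t" by (rule agree_trans)
    moreover have l: "nreg t ''i'' = l" "narr t ''own'' = upd2 (narr t' ''own'') l 0 l"
      by (simp_all add: t_def)
    ultimately obtain x where x: "narr (run (PFor ''j'' ''n'' 0 ?c) t) ''own'' = upd2 (narr t' ''own'') l 0 x"
      "?spec n (\<lambda>i. upd2 (narr t' ''own'') l 0 x i 0) l"
      using inner[of t] by (auto simp: upd2_apply upd2_upd2)
    \<comment> \<open>The specification at \<open>i\<close> reads only entries up to
      \<open>i\<close>, so it survives the write at \<open>l > i\<close>.\<close>
    have "?spec n (\<lambda>i. upd2 (narr t' ''own'') l 0 x i 0) i" if "i < l" for i
      using I that unfolding own_spec_def upd2_apply by (auto split: if_splits)
    then show "\<forall>i<Suc l. ?spec n (\<lambda>i. narr (run (?init ;; PFor ''j'' ''n'' 0 ?c) (set_nreg ''i'' l t')) ''own'' i 0) i"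
      using x unfolding run.simps(4) t_def[symmetric] by (auto simp: less_Suc_eq simp del: run.simps)
  qed simp_all
  then show ?thesis using assms by (simp add: n_def)
qed

section \<open>The auction as a program\<close>

text \<open>The program raises only prices of lines in \<open>E\<close>, whereas the abstract step
  raises every price with the same label; the invariant sees no difference.\<close>

lemma auction_inv_cong:
  assumes "\<And>x. x \<in> E \<Longrightarrow> pr' x = pr x" "auction_inv n p q E M pr"
  shows "auction_inv n p q E M pr'"
proof -
  have M: "M \<subseteq> E" "inj_on p M" "inj_on q M"
    and const: "\<And>x y. x \<in> E \<Longrightarrow> y \<in> E \<Longrightarrow> q x = q y \<Longrightarrow> pr x = pr y"
    and unowned: "\<And>x. x \<in> E \<Longrightarrow> q x \<notin> q ` M \<Longrightarrow> pr x = 0"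
    and cheap: "\<And>m y. m \<in> M \<Longrightarrow> y \<in> E \<Longrightarrow> p m = p y \<Longrightarrow> pr m \<le> Suc (pr y)"
    and bound: "\<And>x. x \<in> E \<Longrightarrow> pr x \<le> Suc n"
    using assms(2) unfolding auction_inv_def by blast+
  show ?thesis
    unfolding auction_inv_def
  proof (intro conjI ballI impI M)
    fix x y assume "x \<in> E" "y \<in> E" "q x = q y"
    then show "pr' x = pr' y" using const[of x y] assms(1)[of x] assms(1)[of y] by metis
  next
    fix x assume "x \<in> E" "q x \<notin> q ` M"
    then show "pr' x = 0" using unowned[of x] assms(1)[of x] by metis
  next
    fix m y assume my: "m \<in> M" "y \<in> E" "p m = p y"
    then have "m \<in> E" using M(1) by blast
    then show "pr' m \<le> Suc (pr' y)" using cheap[OF my] assms(1)[of m] assms(1)[OF my(2)] by metis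
  next
    fix x assume "x \<in> E"
    then show "pr' x \<le> Suc n" using bound[of x] assms(1)[of x] by metis
  qed
qed

text \<open>Invariant of the search for a bidder. The pair \<open>b = n\<close>,
  \<open>v = Suc n\<close> stands for no candidate; starting there, a strict comparison admits only
  prices up to \<open>n\<close>.\<close>

definition cheapest :: "nat \<Rightarrow> (nat \<Rightarrow> bool) \<Rightarrow> (nat \<Rightarrow> nat) \<Rightarrow> nat \<Rightarrow> nat \<Rightarrow> nat \<Rightarrow> bool" where
  "cheapest n U c l b v \<longleftrightarrow> (\<forall>i<l. U i \<longrightarrow> v \<le> c i) \<and>
    ((b = n \<and> v = Suc n) \<or> (b < n \<and> U b \<and> v = c b \<and> v \<le> n))"

lemma cheapest_Suc:
  assumes "cheapest n U c l b v" "l < n"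
  shows "U l \<Longrightarrow> c l < v \<Longrightarrow> cheapest n U c (Suc l) l (c l)"
    and "\<not> (U l \<and> c l < v) \<Longrightarrow> cheapest n U c (Suc l) b v"
proof -
  assume "U l" "c l < v"
  moreover from this have "c l \<le> n" using assms(1) by (auto simp: cheapest_def)
  moreover have "\<forall>i<Suc l. U i \<longrightarrow> c l \<le> c i"
    using assms(1) \<open>c l < v\<close> unfolding cheapest_def less_Suc_eq
    by (metis less_imp_le_nat order_refl le_trans)
  ultimately show "cheapest n U c (Suc l) l (c l)"
    using assms(2) by (simp add: cheapest_def)
next
  assume "\<not> (U l \<and> c l < v)"
  then show "cheapest n U c (Suc l) b v"
    using assms(1) unfolding cheapest_def less_Suc_eq by (metis not_le)
qed

text \<open>The diagonal of \<open>pt\<close> marks the lines taking part in the auction, so it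
  initializes the flag \<open>fr\<close>, which is cleared when a matched line has the same
  point.\<close>

definition best_prog :: prog where
  "best_prog =
    PNSet ''bst'' (NReg ''n'') ;; PNSet ''bp'' (NAdd (NReg ''n'') (NConst (Suc 0))) ;;
    PFor ''i'' ''n'' 0
      (PNSet ''fr'' (NArr ''pt'' (NReg ''i'') (NReg ''i'')) ;;
       PFor ''j'' ''n'' 0
        (PIf (BAnd (BNonzero (NCol ''M'' (NReg ''j''))) (BNonzero (NArr ''pt'' (NReg ''i'') (NReg ''j''))))
          (PNSet ''fr'' (NConst 0))) ;;
       PIf (BAnd (BNonzero (NReg ''fr'')) (NLess (NCol ''pr'' (NReg ''i'')) (NReg ''bp'')))
        (PNSet ''bst'' (NReg ''i'') ;; PNSet ''bp'' (NCol ''pr'' (NReg ''i''))))"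

lemma writes_best_prog: "writes best_prog = {''bst'', ''bp'', ''i'', ''fr'', ''j''}"
  by (auto simp: best_prog_def)

definition unmatched :: "state \<Rightarrow> nat \<Rightarrow> bool" where
  "unmatched s i \<longleftrightarrow> narr s ''pt'' i i \<noteq> 0 \<and>
    (\<forall>j<nreg s ''n''. narr s ''M'' j 0 \<noteq> 0 \<longrightarrow> narr s ''pt'' i j = 0)"

lemma best_prog_spec:
  fixes s :: state
  defines "n \<equiv> nreg s ''n''"
  defines "price \<equiv> \<lambda>i. narr s ''pr'' i 0"
  defines "b \<equiv> nreg (run best_prog s) ''bst''"
  shows "(b = n \<and> (\<forall>i<n. unmatched s i \<longrightarrow> n < price i)) \<or>
    (b < n \<and> unmatched s b \<and> price b \<le> n \<and> (\<forall>i<n. unmatched s i \<longrightarrow> price b \<le> price i))"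
proof -
  let ?j = "PFor ''j'' ''n'' 0
        (PIf (BAnd (BNonzero (NCol ''M'' (NReg ''j''))) (BNonzero (NArr ''pt'' (NReg ''i'') (NReg ''j''))))
          (PNSet ''fr'' (NConst 0)))"
  let ?u = "PIf (BAnd (BNonzero (NReg ''fr'')) (NLess (NCol ''pr'' (NReg ''i'')) (NReg ''bp'')))
        (PNSet ''bst'' (NReg ''i'') ;; PNSet ''bp'' (NCol ''pr'' (NReg ''i'')))"
  let ?f = "PNSet ''fr'' (NArr ''pt'' (NReg ''i'') (NReg ''i''))"
  let ?c = "?f ;; ?j ;; ?u"
  let ?W = "{''bst'', ''bp'', ''i'', ''fr'', ''j''}"
  have inner: "nreg (run ?j t) ''fr'' \<noteq> 0 \<longleftrightarrow> unmatched s (nreg t ''i'')"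
    if ag: "agree ?W s t" and fr: "nreg t ''fr'' = narr s ''pt'' (nreg t ''i'') (nreg t ''i'')" for t
  proof (rule run_PForI[where N = n and I = "\<lambda>l t'. nreg t' ''fr'' \<noteq> 0 \<longleftrightarrow>
      narr s ''pt'' (nreg t ''i'') (nreg t ''i'') \<noteq> 0 \<and>
      (\<forall>j<l. narr s ''M'' j 0 \<noteq> 0 \<longrightarrow> narr s ''pt'' (nreg t ''i'') j = 0)"])
    show "n = nreg t ''n'' + 0" using agreeD(1)[OF ag, of "''n''"] by (simp add: n_def)
  next
    fix l t' assume ag': "agree (insert ''j'' (writes (PIf (BAnd (BNonzero (NCol ''M'' (NReg ''j''))) (BNonzero (NArr ''pt'' (NReg ''i'') (NReg ''j''))))
          (PNSet ''fr'' (NConst 0))))) t t'"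
      and I: "nreg t' ''fr'' \<noteq> 0 \<longleftrightarrow> narr s ''pt'' (nreg t ''i'') (nreg t ''i'') \<noteq> 0 \<and>
      (\<forall>j<l. narr s ''M'' j 0 \<noteq> 0 \<longrightarrow> narr s ''pt'' (nreg t ''i'') j = 0)"
    have "nreg t' ''i'' = nreg t ''i''" "narr t' ''M'' = narr s ''M''" "narr t' ''pt'' = narr s ''pt''"
      using agreeD[OF ag'] agreeD[OF ag] by simp_all
    then show "nreg (run (PIf (BAnd (BNonzero (NCol ''M'' (NReg ''j''))) (BNonzero (NArr ''pt'' (NReg ''i'') (NReg ''j''))))
          (PNSet ''fr'' (NConst 0))) (set_nreg ''j'' l t')) ''fr'' \<noteq> 0 \<longleftrightarrow>
      narr s ''pt'' (nreg t ''i'') (nreg t ''i'') \<noteq> 0 \<and>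
      (\<forall>j<Suc l. narr s ''M'' j 0 \<noteq> 0 \<longrightarrow> narr s ''pt'' (nreg t ''i'') j = 0)"
      using I by (auto simp: less_Suc_eq)
  qed (simp_all add: fr unmatched_def n_def)
  define s' where "s' = run (PNSet ''bp'' (NAdd (NReg ''n'') (NConst (Suc 0)))) (run (PNSet ''bst'' (NReg ''n'')) s)"
  have ag0: "agree ?W s s'" by (auto simp: s'_def agree_def)
  let ?Q = "cheapest n (unmatched s) price"
  have "?Q n (nreg (run (PFor ''i'' ''n'' 0 ?c) s') ''bst'') (nreg (run (PFor ''i'' ''n'' 0 ?c) s') ''bp'')"
  proof (rule run_PForI[where N = n and I = "\<lambda>l t. ?Q l (nreg t ''bst'') (nreg t ''bp'')"])
    show "n = nreg s' ''n'' + 0" by (simp add: s'_def n_def)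
    show "?Q 0 (nreg s' ''bst'') (nreg s' ''bp'')" by (simp add: s'_def n_def cheapest_def)
  next
    fix l t assume l: "l < n" and ag': "agree (insert ''i'' (writes ?c)) s' t" and I: "?Q l (nreg t ''bst'') (nreg t ''bp'')"
    have agt: "agree ?W s t" using agree_trans[OF ag0 agree_mono[OF ag', of ?W]] by auto
    define t1 where "t1 = run ?f (set_nreg ''i'' l t)"
    define t2 where "t2 = run ?j t1"
    have "agree ?W s t1"
      using agt by (auto simp: t1_def agree_def)
    moreover have i1: "nreg t1 ''i'' = l" and "nreg t1 ''fr'' = narr s ''pt'' l l"
      using agreeD(2)[OF agt, of "''pt''"] by (simp_all add: t1_def)
    ultimately have fr: "nreg t2 ''fr'' \<noteq> 0 \<longleftrightarrow> unmatched s l"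
      using inner[of t1] by (simp add: t2_def del: run.simps)
    have ag12: "agree {''j'', ''fr''} t1 t2"
      unfolding t2_def by (rule agree_mono[OF agree_run]) simp
    have t2: "nreg t2 ''i'' = l" "nreg t2 ''bst'' = nreg t ''bst''" "nreg t2 ''bp'' = nreg t ''bp''"
      "narr t2 ''pr'' l 0 = price l"
      using agreeD[OF ag12] i1 agreeD(2)[OF agt, of "''pr''"] by (simp_all add: t1_def price_def)
    have "?Q (Suc l) (nreg (run ?u t2) ''bst'') (nreg (run ?u t2) ''bp'')"
    proof (cases "unmatched s l \<and> price l < nreg t ''bp''")
      case True
      then have "nreg (run ?u t2) ''bst'' = l" "nreg (run ?u t2) ''bp'' = price l"
        using fr t2 by simp_all
      then show ?thesis using cheapest_Suc(1)[OF I l] True by simp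
    next
      case False
      then have "\<not> (nreg t2 ''fr'' \<noteq> 0 \<and> price l < nreg t ''bp'')"
        using fr by blast
      then have "\<not> bval (BAnd (BNonzero (NReg ''fr'')) (NLess (NCol ''pr'' (NReg ''i'')) (NReg ''bp''))) t2"
        using t2 by simp
      then have "run ?u t2 = t2"
        by (simp only: run.simps if_False)
      then have "nreg (run ?u t2) ''bst'' = nreg t ''bst''" "nreg (run ?u t2) ''bp'' = nreg t ''bp''"
        using t2 by simp_all
      then show ?thesis using cheapest_Suc(2)[OF I l False] by simp
    qed
    then show "?Q (Suc l) (nreg (run ?c (set_nreg ''i'' l t)) ''bst'') (nreg (run ?c (set_nreg ''i'' l t)) ''bp'')"
      by (simp only: run.simps(4) t1_def t2_def)
  qed simp
  moreover have "run best_prog s = run (PFor ''i'' ''n'' 0 ?c) s'"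
    by (simp only: best_prog_def run.simps(4) s'_def)
  ultimately show ?thesis
    unfolding b_def cheapest_def by (metis Suc_le_eq)
qed

text \<open>The loop runs over all lines in the plane of the bidder, evicting the holder and raising
  their common price. The bidder is among them, so its mark is set afterwards.\<close>

definition bid_prog :: prog where
  "bid_prog = PIf (NLess (NReg ''bst'') (NReg ''n''))
    (PFor ''j'' ''n'' 0
      (PIf (BNonzero (NArr ''pl'' (NReg ''bst'') (NReg ''j'')))
        (PNArrSet ''M'' (NReg ''j'') (NConst 0) (NConst 0) ;;
         PNArrSet ''pr'' (NReg ''j'') (NConst 0) (NAdd (NCol ''pr'' (NReg ''j'')) (NConst (Suc 0))))) ;;
     PNArrSet ''M'' (NReg ''bst'') (NConst 0) (NConst (Suc 0)))"

lemma writes_bid_prog: "writes bid_prog = {''j'', ''M'', ''pr''}"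
  by (auto simp: bid_prog_def)

lemma bid_prog_spec:
  fixes s :: state
  defines "n \<equiv> nreg s ''n''"
  defines "b \<equiv> nreg s ''bst''"
  assumes "b < n" "j < n"
  shows "narr (run bid_prog s) ''M'' j 0 = (if j = b then 1 else if narr s ''pl'' b j \<noteq> 0 then 0 else narr s ''M'' j 0)"
    and "narr (run bid_prog s) ''pr'' j 0 = narr s ''pr'' j 0 + of_bool (narr s ''pl'' b j \<noteq> 0)"
proof -
  let ?c = "PIf (BNonzero (NArr ''pl'' (NReg ''bst'') (NReg ''j'')))
        (PNArrSet ''M'' (NReg ''j'') (NConst 0) (NConst 0) ;;
         PNArrSet ''pr'' (NReg ''j'') (NConst 0) (NAdd (NCol ''pr'' (NReg ''j'')) (NConst (Suc 0))))"
  have "nreg (run (PFor ''j'' ''n'' 0 ?c) s) ''bst'' = b \<and>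
    (\<forall>j. narr (run (PFor ''j'' ''n'' 0 ?c) s) ''M'' j 0 =
      (if j < n \<and> narr s ''pl'' b j \<noteq> 0 then 0 else narr s ''M'' j 0)) \<and>
    (\<forall>j. narr (run (PFor ''j'' ''n'' 0 ?c) s) ''pr'' j 0 =
      narr s ''pr'' j 0 + of_bool (j < n \<and> narr s ''pl'' b j \<noteq> 0))"
  proof (rule run_PForI[where N = n and I = "\<lambda>l t. nreg t ''bst'' = b \<and>
      (\<forall>j. narr t ''M'' j 0 = (if j < l \<and> narr s ''pl'' b j \<noteq> 0 then 0 else narr s ''M'' j 0)) \<and>
      (\<forall>j. narr t ''pr'' j 0 = narr s ''pr'' j 0 + of_bool (j < l \<and> narr s ''pl'' b j \<noteq> 0))"])
    fix l t assume ag: "agree (insert ''j'' (writes ?c)) s t"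
      and I: "nreg t ''bst'' = b \<and>
      (\<forall>j. narr t ''M'' j 0 = (if j < l \<and> narr s ''pl'' b j \<noteq> 0 then 0 else narr s ''M'' j 0)) \<and>
      (\<forall>j. narr t ''pr'' j 0 = narr s ''pr'' j 0 + of_bool (j < l \<and> narr s ''pl'' b j \<noteq> 0))"
    have "narr t ''pl'' = narr s ''pl''" using agreeD(2)[OF ag] by simp
    then show "nreg (run ?c (set_nreg ''j'' l t)) ''bst'' = b \<and>
      (\<forall>j. narr (run ?c (set_nreg ''j'' l t)) ''M'' j 0 =
        (if j < Suc l \<and> narr s ''pl'' b j \<noteq> 0 then 0 else narr s ''M'' j 0)) \<and>
      (\<forall>j. narr (run ?c (set_nreg ''j'' l t)) ''pr'' j 0 =
        narr s ''pr'' j 0 + of_bool (j < Suc l \<and> narr s ''pl'' b j \<noteq> 0))"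
      using I by (auto simp: upd2_apply less_Suc_eq)
  qed (simp_all add: n_def b_def)
  then show "narr (run bid_prog s) ''M'' j 0 = (if j = b then 1 else if narr s ''pl'' b j \<noteq> 0 then 0 else narr s ''M'' j 0)"
    and "narr (run bid_prog s) ''pr'' j 0 = narr s ''pr'' j 0 + of_bool (narr s ''pl'' b j \<noteq> 0)"
    using assms(3,4) unfolding bid_prog_def
    by (simp_all add: upd2_apply n_def b_def del: run.simps(6))
qed

definition round_prog :: prog where
  "round_prog = best_prog ;; bid_prog"

text \<open>
  Each round before the last one raises the sum of the prices, which stays below \<open>(n + 1)\<^sup>2\<close>; hence so many
  rounds suffice.
\<close>

definition auction_prog :: prog where
  "auction_prog = PFor ''u'' ''n'' (Suc 0) (PFor ''v'' ''n'' (Suc 0) round_prog)"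

lemma writes_auction_prog:
  "writes auction_prog = {''u'', ''v'', ''bst'', ''bp'', ''i'', ''fr'', ''j'', ''M'', ''pr''}"
  by (auto simp: auction_prog_def round_prog_def writes_best_prog writes_bid_prog)

definition matched :: "state \<Rightarrow> nat set" where
  "matched s = {j. j < nreg s ''n'' \<and> narr s ''M'' j 0 \<noteq> 0}"

abbreviation price :: "state \<Rightarrow> nat \<Rightarrow> nat" where
  "price s \<equiv> \<lambda>j. narr s ''pr'' j 0"

context
  fixes s :: state and n :: nat and p :: "nat \<Rightarrow> 'p" and q :: "nat \<Rightarrow> 'q" and E :: "nat set"
  assumes n: "nreg s ''n'' = n"
    and E: "E \<subseteq> {..<n}"
    and pt: "\<And>i j. i < n \<Longrightarrow> j < n \<Longrightarrow> narr s ''pt'' i j \<noteq> 0 \<longleftrightarrow> i \<in> E \<and> j \<in> E \<and> p i = p j"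
    and pl: "\<And>i j. i < n \<Longrightarrow> j < n \<Longrightarrow> narr s ''pl'' i j \<noteq> 0 \<longleftrightarrow> i \<in> E \<and> j \<in> E \<and> q i = q j"
begin

definition auction_finished :: "state \<Rightarrow> bool" where
  "auction_finished t \<longleftrightarrow> (\<forall>x\<in>E. p x \<notin> p ` matched t \<longrightarrow> n < price t x)"

text \<open>Replaces a termination test: after \<open>c\<close> rounds either all bidders are priced
  out, or every round has raised the total price, which is then at least \<open>c\<close>.\<close>

definition auction_progress :: "nat \<Rightarrow> state \<Rightarrow> bool" where
  "auction_progress c t \<longleftrightarrow> auction_inv n p q E (matched t) (price t) \<and>
    (auction_finished t \<or> c \<le> (\<Sum>x\<in>E. price t x))"

lemma finite_E: "finite E" "card E \<le> n"
  using E finite_subset card_mono[of "{..<n}" E] by auto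

lemma auction_round:
  assumes ag: "agree (writes auction_prog) s t" and prog: "auction_progress c t"
  shows "auction_progress (Suc c) (run round_prog t)"
proof -
  define t1 where "t1 = run best_prog t"
  define t2 where "t2 = run bid_prog t1"
  define b where "b = nreg t1 ''bst''"
  have t: "nreg t ''n'' = n" "narr t ''pt'' = narr s ''pt''" "narr t ''pl'' = narr s ''pl''"
    using agreeD[OF ag, unfolded writes_auction_prog] n by simp_all
  have t1: "nreg t1 ''n'' = n" "narr t1 ''pl'' = narr s ''pl''" "narr t1 ''M'' = narr t ''M''" "narr t1 ''pr'' = narr t ''pr''"
    unfolding t1_def using t by (simp_all add: run_unchanged writes_best_prog)
  have inv: "auction_inv n p q E (matched t) (price t)" using prog by (simp add: auction_progress_def)
  then have sub: "matched t \<subseteq> E" by (simp add: auction_inv_def)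
  have unm: "unmatched t i \<longleftrightarrow> i \<in> E \<and> p i \<notin> p ` matched t" if "i < n" for i
  proof -
    have "narr s ''pt'' i j = 0 \<longleftrightarrow> \<not> (i \<in> E \<and> j \<in> E \<and> p i = p j)" if "j < n" for j
      using pt[OF \<open>i < n\<close> that] by blast
    then have "unmatched t i \<longleftrightarrow> i \<in> E \<and> (\<forall>j\<in>matched t. \<not> (i \<in> E \<and> j \<in> E \<and> p i = p j))"
      unfolding unmatched_def matched_def t using that by (simp del: neq0_conv) blast
    then show ?thesis using sub by blast
  qed
  have best: "(b = n \<and> (\<forall>i<n. unmatched t i \<longrightarrow> n < price t i)) \<or>
    (b < n \<and> unmatched t b \<and> price t b \<le> n \<and> (\<forall>i<n. unmatched t i \<longrightarrow> price t b \<le> price t i))"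
    using best_prog_spec[of t] unfolding b_def t1_def t .
  have "auction_progress (Suc c) t2"
  proof (cases "b < n")
    case False
    \<comment> \<open>No admissible bidder is left, and the round changes neither matching nor
      prices.\<close>
    then have "auction_finished t"
      using best unm E by (auto simp: auction_finished_def)
    moreover have "t2 = t1" using False t1(1) by (simp add: t2_def bid_prog_def b_def)
    then have "matched t2 = matched t" "price t2 = price t"
      using t1 t(1) by (simp_all add: matched_def)
    ultimately show ?thesis
      using inv unfolding auction_progress_def auction_finished_def by metis
  next
    case True
    then have b: "b \<in> E" "p b \<notin> p ` matched t" "price t b \<le> n"
      using best unm by auto
    have least: "price t b \<le> price t y" if "y \<in> E" "p y \<notin> p ` matched t" for y
      using best unm[of y] that E True by auto
    have bid: "narr t2 ''M'' j 0 = (if j = b then 1 else if j \<in> E \<and> q b = q j then 0 else narr t ''M'' j 0)"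
      "price t2 j = price t j + of_bool (j \<in> E \<and> q b = q j)" if "j < n" for j
      using bid_prog_spec[of t1 j] that True t1 b(1) pl[OF True that] by (simp_all add: t2_def b_def[symmetric])
    have "nreg t2 ''n'' = n"
      using t1 by (simp add: t2_def run_unchanged writes_bid_prog)
    then have M2: "matched t2 = insert b {m \<in> matched t. q m \<noteq> q b}"
      using True sub t(1) by (auto simp: matched_def bid split: if_splits)
    have pr2: "price t2 y = (if q y = q b then Suc (price t y) else price t y)" if "y \<in> E" for y
      using that E bid(2)[of y] by auto
    have "auction_inv n p q E (matched t2) (price t2)"
      unfolding M2 by (rule auction_inv_cong[OF pr2 auction_inv_step[OF inv b]]) (auto intro: least)
    moreover have "auction_finished t \<Longrightarrow> False"
      using b by (auto simp: auction_finished_def)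
    then have "c \<le> (\<Sum>x\<in>E. price t x)" using prog by (auto simp: auction_progress_def)
    moreover have "(\<Sum>y\<in>E. price t2 y) = (\<Sum>y\<in>E. if q y = q b then Suc (price t y) else price t y)"
      by (rule sum.cong) (simp_all add: pr2)
    ultimately show ?thesis
      using auction_step_progress[OF finite_E(1) b(1), of "price t" q]
      by (simp add: auction_progress_def)
  qed
  then show ?thesis by (simp add: round_prog_def t1_def t2_def)
qed

lemma auction_prog_spec:
  assumes "\<And>j. narr s ''M'' j 0 = 0" "\<And>j. narr s ''pr'' j 0 = 0"
  shows "auction_inv n p q E (matched (run auction_prog s)) (price (run auction_prog s))"
    and "\<And>x. x \<in> E \<Longrightarrow> p x \<notin> p ` matched (run auction_prog s) \<Longrightarrow> n < price (run auction_prog s) x"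
proof -
  let ?W = "writes auction_prog"
  have skip: "auction_progress c (set_nreg x v t) \<longleftrightarrow> auction_progress c t" if "x \<noteq> ''n''" for x v t c
    using that by (simp add: auction_progress_def auction_finished_def matched_def)
  have W: "''u'' \<in> ?W" "''v'' \<in> ?W" "writes round_prog \<subseteq> ?W"
    by (auto simp: auction_prog_def)
  have inner: "auction_progress (c + Suc n) (run (PFor ''v'' ''n'' (Suc 0) round_prog) t)"
    if ag: "agree ?W s t" and prog: "auction_progress c t" for t c
  proof (rule run_PForI[where N = "Suc n" and I = "\<lambda>l t'. auction_progress (c + l) t'"])
    show "Suc n = nreg t ''n'' + Suc 0"
      using agreeD(1)[OF ag[unfolded writes_auction_prog], of "''n''"] n by simp
  next
    fix l t' assume ag': "agree (insert ''v'' (writes round_prog)) t t'" and I: "auction_progress (c + l) t'"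
    have "agree ?W s (set_nreg ''v'' l t')"
      using agree_trans[OF ag agree_mono[OF ag']] W by (intro agree_set_nreg) auto
    then show "auction_progress (c + Suc l) (run round_prog (set_nreg ''v'' l t'))"
      using auction_round[of "set_nreg ''v'' l t'" "c + l"] I skip by simp
  qed (use prog in \<open>simp_all add: skip\<close>)
  have "matched s = {}" by (simp add: matched_def assms)
  then have init: "auction_progress 0 s"
    using auction_inv_init by (simp add: auction_progress_def assms)
  have "auction_progress (Suc n * Suc n) (run auction_prog s)"
    unfolding auction_prog_def
  proof (rule run_PForI[where N = "Suc n" and I = "\<lambda>l t'. auction_progress (l * Suc n) t'"])
    show "Suc n = nreg s ''n'' + Suc 0" using n by simp
  next
    fix l t' assume ag': "agree (insert ''u'' (writes (PFor ''v'' ''n'' (Suc 0) round_prog))) s t'" and I: "auction_progress (l * Suc n) t'"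
    have "agree ?W s (set_nreg ''u'' l t')"
      using agree_mono[OF ag'] W by (intro agree_set_nreg) auto
    moreover have "auction_progress (l * Suc n) (set_nreg ''u'' l t')" using I skip by simp
    ultimately have "auction_progress (l * Suc n + Suc n) (run (PFor ''v'' ''n'' (Suc 0) round_prog) (set_nreg ''u'' l t'))"
      by (rule inner)
    then show "auction_progress (Suc l * Suc n) (run (PFor ''v'' ''n'' (Suc 0) round_prog) (set_nreg ''u'' l t'))"
      by (simp only: mult_Suc add.commute)
  qed (use init in \<open>simp_all add: skip del: mult_Suc mult_Suc_right\<close>)
  then have inv: "auction_inv n p q E (matched (run auction_prog s)) (price (run auction_prog s))"
    and disj: "auction_finished (run auction_prog s) \<or> Suc n * Suc n \<le> (\<Sum>x\<in>E. price (run auction_prog s) x)"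
    unfolding auction_progress_def by blast+
  show "auction_inv n p q E (matched (run auction_prog s)) (price (run auction_prog s))"
    by (rule inv)
  have "auction_finished (run auction_prog s)"
    using disj auction_total_price[OF inv finite_E] by linarith
  then show "n < price (run auction_prog s) x" if "x \<in> E" "p x \<notin> p ` matched (run auction_prog s)" for x
    using that unfolding auction_finished_def by blast
qed

end

text \<open>\<open>H\<close> is indexed by prices and marks the levels in use. Lines outside the
  auction are entered too; there are still at most \<open>n\<close> marks, so one of the levels from
  1 to \<open>n + 1\<close> stays free.\<close>

definition gap_prog :: prog where
  "gap_prog =
    PFor ''i'' ''n'' 0 (PNArrSet ''H'' (NCol ''pr'' (NReg ''i'')) (NConst 0) (NConst (Suc 0))) ;;
    PFor ''i'' ''n'' (Suc 0)
      (PIf (BEq (NCol ''H'' (NAdd (NReg ''i'') (NConst (Suc 0)))) (NConst 0))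
        (PNSet ''gap'' (NAdd (NReg ''i'') (NConst (Suc 0)))))"

lemma writes_gap_prog: "writes gap_prog = {''i'', ''H'', ''gap''}"
  by (auto simp: gap_prog_def)

lemma gap_prog_spec:
  fixes s :: state
  defines "n \<equiv> nreg s ''n''"
  assumes zero: "\<And>j. narr s ''H'' j 0 = 0"
  shows "nreg (run gap_prog s) ''gap'' \<le> Suc n \<and> (\<forall>i<n. price s i \<noteq> nreg (run gap_prog s) ''gap'')"
proof -
  let ?c = "PNArrSet ''H'' (NCol ''pr'' (NReg ''i'')) (NConst 0) (NConst (Suc 0))"
  let ?d = "PIf (BEq (NCol ''H'' (NAdd (NReg ''i'') (NConst (Suc 0)))) (NConst 0))
        (PNSet ''gap'' (NAdd (NReg ''i'') (NConst (Suc 0))))"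
  define t where "t = run (PFor ''i'' ''n'' 0 ?c) s"
  have H: "\<forall>v. narr t ''H'' v 0 = 0 \<longleftrightarrow> (\<forall>i<n. price s i \<noteq> v)"
    unfolding t_def
  proof (rule run_PForI[where N = n and I = "\<lambda>l t. \<forall>v. narr t ''H'' v 0 = 0 \<longleftrightarrow> (\<forall>i<l. price s i \<noteq> v)"])
    fix l t assume ag: "agree (insert ''i'' (writes ?c)) s t"
      and I: "\<forall>v. narr t ''H'' v 0 = 0 \<longleftrightarrow> (\<forall>i<l. price s i \<noteq> v)"
    have "narr t ''pr'' = narr s ''pr''" using agreeD(2)[OF ag] by simp
    then show "\<forall>v. narr (run ?c (set_nreg ''i'' l t)) ''H'' v 0 = 0 \<longleftrightarrow> (\<forall>i<Suc l. price s i \<noteq> v)"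
      using I by (auto simp: upd2_apply less_Suc_eq)
  qed (simp_all add: zero n_def)
  obtain g where g: "g \<le> n" "\<forall>i<n. price s i \<noteq> Suc g"
    using price_gap[of "{..<n}" n "price s"] by auto
  let ?Q = "\<lambda>v. v \<le> Suc n \<and> (\<forall>i<n. price s i \<noteq> v)"
  \<comment> \<open>The level \<open>Suc g\<close> is known to be free. From the round that inspects
    it onwards, the register holds some free level, possibly a later one.\<close>
  have "g < Suc n \<longrightarrow> ?Q (nreg (run (PFor ''i'' ''n'' (Suc 0) ?d) t) ''gap'')"
  proof (rule run_PForI[where N = "Suc n" and I = "\<lambda>l t'. g < l \<longrightarrow> ?Q (nreg t' ''gap'')"])
    show "Suc n = nreg t ''n'' + Suc 0" by (simp add: t_def run_unchanged n_def del: run.simps)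
  next
    fix l t' assume l: "l < Suc n" and ag: "agree (insert ''i'' (writes ?d)) t t'"
      and I: "g < l \<longrightarrow> ?Q (nreg t' ''gap'')"
    have eq: "narr t' ''H'' = narr t ''H''" using agreeD(2)[OF ag] by simp
    show "g < Suc l \<longrightarrow> ?Q (nreg (run ?d (set_nreg ''i'' l t')) ''gap'')"
    proof (cases "narr t ''H'' (Suc l) 0 = 0")
      case True
      then have "nreg (run ?d (set_nreg ''i'' l t')) ''gap'' = Suc l" using eq by simp
      then show ?thesis using True H l by simp
    next
      case False
      then have "run ?d (set_nreg ''i'' l t') = set_nreg ''i'' l t'" using eq by simp
      then have "nreg (run ?d (set_nreg ''i'' l t')) ''gap'' = nreg t' ''gap''" by simp
      moreover have "g \<noteq> l" using False H g by auto
      ultimately show ?thesis using I by simp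
    qed
  qed simp_all
  moreover have "run gap_prog s = run (PFor ''i'' ''n'' (Suc 0) ?d) t"
    by (simp only: gap_prog_def run.simps(4) t_def)
  ultimately have "g < Suc n \<longrightarrow> ?Q (nreg (run gap_prog s) ''gap'')"
    by (simp only:)
  then show ?thesis
    using le_imp_less_Suc[OF g(1)] by blast
qed

definition color_test :: bexp where
  "color_test = BAnd (BNonzero (NCol ''M'' (NReg ''j'')))
    (BAnd (BEq (NCol ''own'' (NReg ''j'')) (NCol ''own'' (NReg ''i'')))
      (BOr (BEq (NCol ''own'' (NReg ''i'')) (NReg ''i''))
        (BOr (BAnd (NLess (NReg ''gap'') (NCol ''pr'' (NReg ''i''))) (BNonzero (NArr ''pl'' (NReg ''i'') (NReg ''j''))))
          (BAnd (NLess (NCol ''pr'' (NReg ''i'')) (NReg ''gap'')) (BNonzero (NArr ''pt'' (NReg ''i'') (NReg ''j'')))))))"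

text \<open>Colors are indices of matched lines. A line outside the greedy clique takes a line to
  which it is charged; an owner meets all its lines and may take any matched one among them.\<close>

definition color_rel :: "state \<Rightarrow> nat \<Rightarrow> nat \<Rightarrow> bool" where
  "color_rel s i j \<longleftrightarrow> narr s ''M'' j 0 \<noteq> 0 \<and> narr s ''own'' j 0 = narr s ''own'' i 0 \<and>
    (narr s ''own'' i 0 = i \<or> (nreg s ''gap'' < price s i \<and> narr s ''pl'' i j \<noteq> 0) \<or>
      (price s i < nreg s ''gap'' \<and> narr s ''pt'' i j \<noteq> 0))"

text \<open>The default, the index of the line itself, will remain only for an owner without other
  lines: every other line is charged to some matched line.\<close>

definition color_prog :: prog where
  "color_prog = PFor ''i'' ''n'' 0
    (PNArrSet ''color'' (NReg ''i'') (NConst 0) (NReg ''i'') ;;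
     PFor ''j'' ''n'' 0 (PIf color_test (PNArrSet ''color'' (NReg ''i'') (NConst 0) (NReg ''j''))))"

lemma writes_color_prog: "writes color_prog = {''i'', ''j'', ''color''}"
  by (auto simp: color_prog_def)

lemma color_prog_spec:
  fixes s :: state
  defines "n \<equiv> nreg s ''n''"
  defines "clr \<equiv> \<lambda>i. narr (run color_prog s) ''color'' i 0"
  assumes "i < n"
  shows "(clr i = i \<and> (\<forall>j<n. \<not> color_rel s i j)) \<or> (clr i < n \<and> color_rel s i (clr i))"
proof -
  let ?c = "PIf color_test (PNArrSet ''color'' (NReg ''i'') (NConst 0) (NReg ''j''))"
  let ?init = "PNArrSet ''color'' (NReg ''i'') (NConst 0) (NReg ''i'')"
  let ?W = "{''i'', ''j'', ''color''}"
  let ?spec = "\<lambda>l i c. (c = i \<and> (\<forall>j<l. \<not> color_rel s i j)) \<or> (c < n \<and> color_rel s i c)"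
  have test: "bval color_test t \<longleftrightarrow> color_rel s (nreg t ''i'') (nreg t ''j'')" if "agree ?W s t" for t
    using agreeD[OF that] by (simp add: color_test_def color_rel_def)
  have inner: "\<exists>x. narr (run (PFor ''j'' ''n'' 0 ?c) t) ''color'' = upd2 (narr t ''color'') (nreg t ''i'') 0 x \<and>
      ?spec n (nreg t ''i'') x"
    if ag: "agree ?W s t" and i: "narr t ''color'' (nreg t ''i'') 0 = nreg t ''i''" for t
  proof (rule run_PForI[where N = n and I = "\<lambda>l t'. \<exists>x. narr t' ''color'' = upd2 (narr t ''color'') (nreg t ''i'') 0 x \<and>
      ?spec l (nreg t ''i'') x"])
    show "n = nreg t ''n'' + 0" using agreeD(1)[OF ag, of "''n''"] by (simp add: n_def)
    show "\<exists>x. narr t ''color'' = upd2 (narr t ''color'') (nreg t ''i'') 0 x \<and> ?spec 0 (nreg t ''i'') x"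
      using i by (intro exI[of _ "nreg t ''i''"]) (auto simp: fun_eq_iff upd2_apply)
  next
    fix l t' assume l: "l < n" and ag': "agree (insert ''j'' (writes ?c)) t t'"
      and I: "\<exists>x. narr t' ''color'' = upd2 (narr t ''color'') (nreg t ''i'') 0 x \<and> ?spec l (nreg t ''i'') x"
    then obtain x where x: "narr t' ''color'' = upd2 (narr t ''color'') (nreg t ''i'') 0 x"
      "?spec l (nreg t ''i'') x" by blast
    have eq: "nreg t' ''i'' = nreg t ''i''"
      using agreeD(1)[OF ag'] by simp
    have "agree ?W s (set_nreg ''j'' l t')"
      using agree_trans[OF ag agree_mono[OF ag', of ?W]] by (auto intro: agree_set_nreg)
    then have test': "bval color_test (set_nreg ''j'' l t') \<longleftrightarrow> color_rel s (nreg t ''i'') l"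
      using test eq by simp
    show "\<exists>x. narr (run ?c (set_nreg ''j'' l t')) ''color'' = upd2 (narr t ''color'') (nreg t ''i'') 0 x \<and>
      ?spec (Suc l) (nreg t ''i'') x"
    proof (cases "color_rel s (nreg t ''i'') l")
      case True
      then have "narr (run ?c (set_nreg ''j'' l t')) ''color'' = upd2 (narr t ''color'') (nreg t ''i'') 0 l"
        using test' eq x(1) by (simp add: upd2_upd2)
      then show ?thesis using True l by blast
    next
      case False
      then have "run ?c (set_nreg ''j'' l t') = set_nreg ''j'' l t'" using test' by simp
      then have "narr (run ?c (set_nreg ''j'' l t')) ''color'' = upd2 (narr t ''color'') (nreg t ''i'') 0 x"
        using x(1) by simp
      moreover have "?spec (Suc l) (nreg t ''i'') x" using x(2) False by (auto simp: less_Suc_eq)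
      ultimately show ?thesis by blast
    qed
  qed simp_all
  have "\<forall>i<n. ?spec n i (narr (run color_prog s) ''color'' i 0)"
    unfolding color_prog_def
  proof (rule run_PForI[where N = n and I = "\<lambda>l t'. \<forall>i<l. ?spec n i (narr t' ''color'' i 0)"])
    show "n = nreg s ''n'' + 0" by (simp add: n_def)
  next
    fix l t' assume ag': "agree (insert ''i'' (writes (?init ;; PFor ''j'' ''n'' 0 ?c))) s t'"
      and I: "\<forall>i<l. ?spec n i (narr t' ''color'' i 0)"
    define t where "t = run ?init (set_nreg ''i'' l t')"
    have "agree ?W s (set_nreg ''i'' l t')"
      using agree_mono[OF ag', of ?W] by (auto intro: agree_set_nreg)
    moreover have "agree ?W (set_nreg ''i'' l t') t"
      unfolding t_def by (rule agree_mono[OF agree_run]) simp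
    ultimately have "agree ?W s t" by (rule agree_trans)
    moreover have l: "nreg t ''i'' = l" "narr t ''color'' = upd2 (narr t' ''color'') l 0 l"
      by (simp_all add: t_def)
    ultimately obtain x where x: "narr (run (PFor ''j'' ''n'' 0 ?c) t) ''color'' = upd2 (narr t' ''color'') l 0 x"
      "?spec n l x"
      using inner[of t] by (auto simp: upd2_apply upd2_upd2)
    show "\<forall>i<Suc l. ?spec n i (narr (run (?init ;; PFor ''j'' ''n'' 0 ?c) (set_nreg ''i'' l t')) ''color'' i 0)"
      unfolding run.simps(4) t_def[symmetric] x(1) using x(2) I by (simp add: upd2_apply less_Suc_eq)
  qed simp_all
  then show ?thesis using assms(3) by (simp add: clr_def)
qed

definition pick_prog :: "name \<Rightarrow> prog" where
  "pick_prog X = PFor ''i'' ''n'' 0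
    (PNSet ''cnt'' (NConst 0) ;;
     PFor ''j'' ''n'' 0 (PIf (BNonzero (NArr X (NReg ''i'') (NReg ''j'')))
       (PNSet ''cnt'' (NAdd (NReg ''cnt'') (NConst (Suc 0))))) ;;
     PIf (NLess (NReg ''best'') (NReg ''cnt''))
       (PNSet ''best'' (NReg ''cnt'') ;;
        PFor ''j'' ''n'' 0
         (PNArrSet ''clique'' (NReg ''j'') (NConst 0) (NArr X (NReg ''i'') (NReg ''j'')))))"

lemma writes_pick_prog: "writes (pick_prog X) = {''i'', ''cnt'', ''j'', ''best'', ''clique''}"
  by (auto simp: pick_prog_def)

definition row_set :: "state \<Rightarrow> name \<Rightarrow> nat \<Rightarrow> nat set" where
  "row_set s X i = {j. j < nreg s ''n'' \<and> narr s X i j \<noteq> 0}"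

definition picked :: "state \<Rightarrow> nat set" where
  "picked s = {j. j < nreg s ''n'' \<and> narr s ''clique'' j 0 \<noteq> 0}"

text \<open>\<open>Good\<close> will be the property of being a clique. Since the picked set never
  shrinks in size, consecutive calls yield a clique at least as large as every row of all the
  arrays.\<close>

lemma pick_prog_spec:
  fixes s :: state and Good :: "nat set \<Rightarrow> bool"
  assumes X: "X \<notin> writes (pick_prog X)"
    and init: "Good (picked s)" "nreg s ''best'' = card (picked s)"
    and rows: "\<And>i. i < nreg s ''n'' \<Longrightarrow> Good (row_set s X i)"
  shows "Good (picked (run (pick_prog X) s)) \<and>
    nreg (run (pick_prog X) s) ''best'' = card (picked (run (pick_prog X) s)) \<and>
    card (picked s) \<le> card (picked (run (pick_prog X) s)) \<and>
    (\<forall>i<nreg s ''n''. card (row_set s X i) \<le> card (picked (run (pick_prog X) s)))"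
proof -
  define n where "n = nreg s ''n''"
  let ?W = "{''i'', ''cnt'', ''j'', ''best'', ''clique''}"
  let ?z = "PNSet ''cnt'' (NConst 0)"
  let ?c = "PIf (BNonzero (NArr X (NReg ''i'') (NReg ''j''))) (PNSet ''cnt'' (NAdd (NReg ''cnt'') (NConst (Suc 0))))"
  let ?d = "PNArrSet ''clique'' (NReg ''j'') (NConst 0) (NArr X (NReg ''i'') (NReg ''j''))"
  let ?s = "PNSet ''best'' (NReg ''cnt'')"
  let ?u = "PIf (NLess (NReg ''best'') (NReg ''cnt'')) (?s ;; PFor ''j'' ''n'' 0 ?d)"
  let ?b = "?z ;; PFor ''j'' ''n'' 0 ?c ;; ?u"
  have X': "X \<notin> ?W" using X by (simp add: writes_pick_prog)
  have count: "nreg (run (PFor ''j'' ''n'' 0 ?c) t) ''cnt'' = card (row_set s X (nreg t ''i''))"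
    if ag: "agree ?W s t" and z: "nreg t ''cnt'' = 0" for t
  proof (rule run_PForI[where N = n and I = "\<lambda>l t'. nreg t' ''cnt'' = card {j. j < l \<and> narr s X (nreg t ''i'') j \<noteq> 0}"])
    show "n = nreg t ''n'' + 0" using agreeD(1)[OF ag, of "''n''"] by (simp add: n_def)
  next
    fix l t' assume ag': "agree (insert ''j'' (writes ?c)) t t'"
      and I: "nreg t' ''cnt'' = card {j. j < l \<and> narr s X (nreg t ''i'') j \<noteq> 0}"
    have "{j. j < Suc l \<and> narr s X (nreg t ''i'') j \<noteq> 0} =
      (if narr s X (nreg t ''i'') l \<noteq> 0 then insert l {j. j < l \<and> narr s X (nreg t ''i'') j \<noteq> 0}
       else {j. j < l \<and> narr s X (nreg t ''i'') j \<noteq> 0})"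
      by (auto simp: less_Suc_eq)
    moreover have "nreg t' ''i'' = nreg t ''i''" "narr t' X = narr s X"
      using agreeD(1)[OF ag', of "''i''"] agreeD(2)[OF ag', of X] agreeD(2)[OF ag X'] X' by auto
    ultimately show "nreg (run ?c (set_nreg ''j'' l t')) ''cnt'' = card {j. j < Suc l \<and> narr s X (nreg t ''i'') j \<noteq> 0}"
      using I by simp
  qed (simp_all add: z row_set_def n_def)
  have copy: "\<forall>j<n. narr (run (PFor ''j'' ''n'' 0 ?d) t) ''clique'' j 0 = narr s X (nreg t ''i'') j"
    if ag: "agree ?W s t" for t
  proof (rule run_PForI[where N = n and I = "\<lambda>l t'. \<forall>j<l. narr t' ''clique'' j 0 = narr s X (nreg t ''i'') j"])
    show "n = nreg t ''n'' + 0" using agreeD(1)[OF ag, of "''n''"] by (simp add: n_def)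
  next
    fix l t' assume ag': "agree (insert ''j'' (writes ?d)) t t'"
      and I: "\<forall>j<l. narr t' ''clique'' j 0 = narr s X (nreg t ''i'') j"
    have "nreg t' ''i'' = nreg t ''i''" "narr t' X = narr s X"
      using agreeD(1)[OF ag', of "''i''"] agreeD(2)[OF ag', of X] agreeD(2)[OF ag X'] X' by auto
    then show "\<forall>j<Suc l. narr (run ?d (set_nreg ''j'' l t')) ''clique'' j 0 = narr s X (nreg t ''i'') j"
      using I by (simp add: upd2_apply less_Suc_eq)
  qed simp_all
  let ?I = "\<lambda>l t. Good (picked t) \<and> nreg t ''best'' = card (picked t) \<and>
    card (picked s) \<le> card (picked t) \<and> (\<forall>i<l. card (row_set s X i) \<le> card (picked t))"
  have "?I n (run (pick_prog X) s)"
    unfolding pick_prog_def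
  proof (rule run_PForI[where N = n and I = ?I])
    show "n = nreg s ''n'' + 0" by (simp add: n_def)
    show "?I 0 s" using init by simp
  next
    fix t assume "?I n t"
    moreover have "picked (set_nreg ''i'' n t) = picked t" by (simp add: picked_def)
    ultimately show "?I n (set_nreg ''i'' n t)" by simp
  next
    fix l t assume l: "l < n" and ag: "agree (insert ''i'' (writes ?b)) s t" and I: "?I l t"
    define t1 where "t1 = run ?z (set_nreg ''i'' l t)"
    define t2 where "t2 = run (PFor ''j'' ''n'' 0 ?c) t1"
    have agt: "agree ?W s t" using agree_mono[OF ag, of ?W] by auto
    have ag1: "agree ?W s t1" using agt by (auto simp: t1_def agree_def)
    have ag12: "agree {''j'', ''cnt''} t1 t2" unfolding t2_def by (rule agree_mono[OF agree_run]) simp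
    have ag2: "agree ?W s t2" using agree_trans[OF ag1 agree_mono[OF ag12]] by auto
    have t2: "nreg t2 ''i'' = l" "nreg t2 ''best'' = nreg t ''best''" "narr t2 ''clique'' = narr t ''clique''" "nreg t2 ''n'' = n"
      "nreg t ''n'' = n"
      using agreeD[OF ag12] agreeD(1)[OF ag2, of "''n''"] agreeD(1)[OF agt, of "''n''"] by (simp_all add: t1_def n_def)
    have cnt: "nreg t2 ''cnt'' = card (row_set s X l)"
      using count[OF ag1] by (simp add: t2_def t1_def del: run.simps(6))
    have "?I (Suc l) (run ?u t2)"
    proof (cases "nreg t2 ''best'' < nreg t2 ''cnt''")
      case False
      then have "run ?u t2 = t2" by simp
      moreover have "picked t2 = picked t" using t2 by (simp add: picked_def)
      ultimately show ?thesis using I False t2 cnt by (auto simp: less_Suc_eq)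
    next
      case True
      define t3 where "t3 = run ?s t2"
      have "agree ?W s t3" using ag2 by (auto simp: t3_def agree_def)
      then have cp: "\<forall>j<n. narr (run (PFor ''j'' ''n'' 0 ?d) t3) ''clique'' j 0 = narr s X l j"
        using copy[of t3] t2 by (simp add: t3_def del: run.simps(6))
      have u: "run ?u t2 = run (PFor ''j'' ''n'' 0 ?d) t3"
        using True by (simp only: run.simps(4,5) bval.simps nval.simps if_True t3_def)
      have n3: "nreg (run (PFor ''j'' ''n'' 0 ?d) t3) ''n'' = n"
        using t2 by (simp add: run_unchanged t3_def del: run.simps(6))
      have b3: "nreg (run (PFor ''j'' ''n'' 0 ?d) t3) ''best'' = card (row_set s X l)"
        using cnt by (simp add: run_unchanged t3_def del: run.simps(6))
      have "picked (run ?u t2) = row_set s X l"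
        unfolding u picked_def row_set_def n3 using cp by (auto simp: n_def)
      moreover have "nreg (run ?u t2) ''best'' = card (row_set s X l)"
        unfolding u by (rule b3)
      ultimately show ?thesis
        using True I rows[of l] l cnt t2 by (auto simp: less_Suc_eq n_def)
    qed
    moreover have eq: "run ?b (set_nreg ''i'' l t) = run ?u t2"
      by (simp only: run.simps(4) t1_def t2_def)
    ultimately show "?I (Suc l) (run ?b (set_nreg ''i'' l t))"
      unfolding eq by blast
  qed
  then show ?thesis by (simp add: n_def)
qed

section \<open>The coloring program\<close>

text \<open>A pair names an input vector: \<open>False\<close> selects the first and
  \<open>True\<close> the second vector of a line. Mixed products are stored in one order only and
  looked up by symmetry.\<close>

definition gval :: "state \<Rightarrow> bool \<times> nat \<Rightarrow> bool \<times> nat \<Rightarrow> real" where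
  "gval s x y =
    (if fst x then (if fst y then rarr s ''BB'' (snd x) (snd y) else rarr s ''AB'' (snd y) (snd x))
     else (if fst y then rarr s ''AB'' (snd x) (snd y) else rarr s ''AA'' (snd x) (snd y)))"

definition gexp :: "bool \<times> nexp \<Rightarrow> bool \<times> nexp \<Rightarrow> rexp" where
  "gexp x y =
    (if fst x then (if fst y then RArr ''BB'' (snd x) (snd y) else RArr ''AB'' (snd y) (snd x))
     else (if fst y then RArr ''AB'' (snd x) (snd y) else RArr ''AA'' (snd x) (snd y)))"

definition vexp :: "bool \<times> nexp \<Rightarrow> state \<Rightarrow> bool \<times> nat" where
  "vexp x s = (fst x, nval (snd x) s)"

lemma rval_gexp: "rval (gexp x y) s = gval s (vexp x s) (vexp y s)"
  by (simp add: gexp_def gval_def vexp_def)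

definition residual_exp :: "bool \<times> nexp \<Rightarrow> bool \<times> nexp \<Rightarrow> bool \<times> nexp \<Rightarrow> bool \<times> nexp \<Rightarrow> rexp" where
  "residual_exp u w r s =
    RSub (RSub
      (RMul (RSub (RMul (gexp u u) (gexp w w)) (RMul (gexp u w) (gexp u w))) (gexp r s))
      (RMul (gexp r u) (RSub (RMul (gexp w w) (gexp u s)) (RMul (gexp u w) (gexp w s)))))
      (RMul (gexp r w) (RSub (RMul (gexp u u) (gexp w s)) (RMul (gexp u w) (gexp u s))))"

lemma rval_residual_exp:
  "rval (residual_exp u w r s) st = residual (gval st) (vexp u st) (vexp w st) (vexp r st) (vexp s st)"
  by (simp add: residual_exp_def residual_def rval_gexp)

definition det_zero_exp :: "rexp \<Rightarrow> rexp \<Rightarrow> rexp \<Rightarrow> bexp" where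
  "det_zero_exp a b c = BREq (RMul a c) (RMul b b)"

lemma bval_det_zero_exp [simp]:
  "bval (det_zero_exp a b c) s \<longleftrightarrow> rval a s * rval c s = rval b s * rval b s"
  by (simp add: det_zero_exp_def)

abbreviation avec :: "nexp \<Rightarrow> bool \<times> nexp" where "avec i \<equiv> (False, i)"
abbreviation bvec :: "nexp \<Rightarrow> bool \<times> nexp" where "bvec i \<equiv> (True, i)"

definition dep_test :: "nexp \<Rightarrow> bool \<times> nexp \<Rightarrow> bool \<times> nexp \<Rightarrow> bexp" where
  "dep_test l r s = (let h = residual_exp (avec l) (bvec l) in det_zero_exp (h r r) (h r s) (h s s))"

definition meet_test :: "nexp \<Rightarrow> nexp \<Rightarrow> bexp" where
  "meet_test i j = dep_test i (avec j) (bvec j)"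

definition point_test :: "nexp \<Rightarrow> nexp \<Rightarrow> nexp \<Rightarrow> bexp" where
  "point_test l i j =
    (let h = \<lambda>r s. RAdd (residual_exp (avec i) (bvec i) r s) (residual_exp (avec j) (bvec j) r s)
     in det_zero_exp (h (avec l) (avec l)) (h (avec l) (bvec l)) (h (bvec l) (bvec l)))"

definition plane_test :: "nexp \<Rightarrow> nexp \<Rightarrow> nexp \<Rightarrow> bexp" where
  "plane_test l i j =
    BAnd (BAnd (dep_test l (avec i) (avec j)) (dep_test l (avec i) (bvec j)))
      (BAnd (dep_test l (bvec i) (avec j)) (dep_test l (bvec i) (bvec j)))"

definition gram_ok :: "nat \<Rightarrow> nat \<Rightarrow> (nat \<Rightarrow> nat \<Rightarrow> real) \<Rightarrow> (nat \<Rightarrow> nat \<Rightarrow> real) \<Rightarrow> state \<Rightarrow> bool" where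
  "gram_ok n d A B s \<longleftrightarrow> (\<forall>i<n. \<forall>j<n. rarr s ''AA'' i j = ip d (A i) (A j) \<and>
    rarr s ''AB'' i j = ip d (A i) (B j) \<and> rarr s ''BB'' i j = ip d (B i) (B j))"

section \<open>Correctness of the geometric tests\<close>

locale vector_pairs =
  fixes n d :: nat and A B :: "nat \<Rightarrow> nat \<Rightarrow> real"
  assumes independent: "i < n \<Longrightarrow> indep (A i) (B i)"
    and supported: "i < n \<Longrightarrow> vanishes d (A i)" "i < n \<Longrightarrow> vanishes d (B i)"
begin

definition S :: "nat \<Rightarrow> (nat \<Rightarrow> real) set" where
  "S i = span2 (A i) (B i)"

definition vec_of :: "bool \<times> nat \<Rightarrow> nat \<Rightarrow> real" where
  "vec_of x = (if fst x then B (snd x) else A (snd x))"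

lemma vec_of_pair [simp]: "vec_of (False, i) = A i" "vec_of (True, i) = B i"
  by (simp_all add: vec_of_def)

lemma plane_S: "i < n \<Longrightarrow> plane (S i)"
  by (simp add: S_def plane_span2 independent)

lemma gval_eq_ip:
  assumes "gram_ok n d A B s" "snd x < n" "snd y < n"
  shows "gval s x y = ip d (vec_of x) (vec_of y)"
  using assms by (simp add: gram_ok_def gval_def vec_of_def ip_commute)

lemma residual_gval:
  assumes "gram_ok n d A B s" "snd u < n" "snd w < n" "snd x < n" "snd y < n"
  shows "residual (gval s) u w x y = residual (ip d) (vec_of u) (vec_of w) (vec_of x) (vec_of y)"
  using assms by (simp add: residual_def gval_eq_ip)

lemma vanishes_vec_of: "snd x < n \<Longrightarrow> vanishes d (vec_of x)"
  by (simp add: vec_of_def supported)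

lemma bval_dep_test:
  assumes "gram_ok n d A B s" "nval l s < n" "nval (snd x) s < n" "nval (snd y) s < n"
  shows "bval (dep_test l x y) s \<longleftrightarrow> dep_mod (S (nval l s)) (vec_of (vexp x s)) (vec_of (vexp y s))"
  using assms unfolding S_def
  by (subst dep_mod_residual[where d = d])
    (simp_all add: dep_test_def Let_def rval_residual_exp residual_gval vexp_def independent supported vanishes_vec_of)

lemma bval_meet_test:
  assumes "gram_ok n d A B s" "nval i s < n" "nval j s < n"
  shows "bval (meet_test i j) s \<longleftrightarrow> meets (S (nval i s)) (S (nval j s))"
  using assms unfolding S_def
  by (subst meets_residual[where d = d])
    (simp_all add: meet_test_def dep_test_def Let_def rval_residual_exp residual_gval vexp_def independent supported)

lemma bval_point_test:
  assumes "gram_ok n d A B s" "nval l s < n" "nval i s < n" "nval j s < n"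
    and "S (nval i s) \<noteq> S (nval l s)" "S (nval j s) \<noteq> S (nval l s)" "meets (S (nval i s)) (S (nval l s))"
  shows "bval (point_test l i j) s \<longleftrightarrow> S (nval i s) \<inter> S (nval l s) = S (nval j s) \<inter> S (nval l s)"
  using assms unfolding S_def
  by (subst same_point_residual[where d = d])
    (simp_all add: point_test_def Let_def rval_residual_exp residual_gval vexp_def independent supported)

lemma bval_plane_test:
  assumes "gram_ok n d A B s" "nval l s < n" "nval i s < n" "nval j s < n"
    and "S (nval i s) \<noteq> S (nval l s)" "meets (S (nval l s)) (S (nval i s))"
    and "S (nval j s) \<noteq> S (nval l s)" "meets (S (nval l s)) (S (nval j s))"
  shows "bval (plane_test l i j) s \<longleftrightarrow>
    sumset (S (nval l s)) (S (nval i s)) = sumset (S (nval l s)) (S (nval j s))"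
  using assms unfolding S_def[of "nval i s"] S_def[of "nval j s"]
  by (subst sumset_eq_iff_dep_mod)
    (simp_all add: plane_S independent plane_test_def bval_dep_test vexp_def)

end

text \<open>
  In \<open>pt\<close> and \<open>pl\<close> two lines are related if they have the same owner and pass through the same point of it,
  or lie in the same plane with it. The candidates for the clique are the rows of three arrays: parallel
  classes in \<open>par\<close> (empty in the projective case), greedy cliques of the layers in \<open>Y\<close>, and the parts of
  the matching with a common owner in \<open>Z\<close>.
\<close>

definition main_prog :: prog where
  "main_prog =
    fill_prog ''meet'' (meet_test (NReg ''i'') (NReg ''j'')) ;;
    own_prog ;;
    fill_prog ''pt'' (BAnd (BEq (NCol ''own'' (NReg ''i'')) (NCol ''own'' (NReg ''j'')))
      (BAnd (BAnd (BNot (BEq (NCol ''own'' (NReg ''i'')) (NReg ''i''))) (BNot (BEq (NCol ''own'' (NReg ''j'')) (NReg ''j''))))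
        (point_test (NCol ''own'' (NReg ''i'')) (NReg ''i'') (NReg ''j'')))) ;;
    fill_prog ''pl'' (BAnd (BEq (NCol ''own'' (NReg ''i'')) (NCol ''own'' (NReg ''j'')))
      (BAnd (BAnd (BNot (BEq (NCol ''own'' (NReg ''i'')) (NReg ''i''))) (BNot (BEq (NCol ''own'' (NReg ''j'')) (NReg ''j''))))
        (plane_test (NCol ''own'' (NReg ''i'')) (NReg ''i'') (NReg ''j'')))) ;;
    auction_prog ;;
    gap_prog ;;
    color_prog ;;
    fill_prog ''Y'' (BAnd (BEq (NCol ''own'' (NReg ''j'')) (NReg ''j'')) (BEq (NCol ''lay'' (NReg ''j'')) (NReg ''i''))) ;;
    fill_prog ''Z'' (BAnd (BEq (NCol ''own'' (NReg ''j'')) (NReg ''i'')) (BNonzero (NCol ''M'' (NReg ''j'')))) ;;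
    pick_prog ''par'' ;; pick_prog ''Y'' ;; pick_prog ''Z''"

lemma wf_main_prog: "wf_prog main_prog"
  by (simp add: main_prog_def fill_prog_def own_prog_def auction_prog_def round_prog_def best_prog_def
      bid_prog_def gap_prog_def color_prog_def pick_prog_def)

text \<open>The arrays \<open>par\<close> and \<open>lay\<close> are absent because they are inputs
  of \<open>main_prog\<close>, computed beforehand in the affine case.\<close>

definition main_ready :: "state \<Rightarrow> bool" where
  "main_ready s \<longleftrightarrow> (\<forall>X\<in>{''meet'', ''own'', ''pt'', ''pl'', ''M'', ''pr'', ''H'', ''Y'', ''Z'', ''clique''}.
     narr s X = (\<lambda>_ _. 0)) \<and> nreg s ''best'' = 0"

text \<open>Serves both geometries. Disjointness is tied to homogeneous coordinates only inside a
  layer, because parallel affine lines are disjoint although their planes meet.\<close>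

locale line_family = vector_pairs +
  fixes disj :: "nat \<Rightarrow> nat \<Rightarrow> bool" and lay :: "nat \<Rightarrow> nat"
  assumes distinct: "i < n \<Longrightarrow> j < n \<Longrightarrow> i \<noteq> j \<Longrightarrow> S i \<noteq> S j"
    and disj_iff: "i < n \<Longrightarrow> j < n \<Longrightarrow> i \<noteq> j \<Longrightarrow> lay i = lay j \<Longrightarrow> disj i j \<longleftrightarrow> \<not> meets (S i) (S j)"
    and lay_less: "i < n \<Longrightarrow> lay i < n"
begin

definition clique_set :: "nat set \<Rightarrow> bool" where
  "clique_set K \<longleftrightarrow> (\<forall>i\<in>K. \<forall>j\<in>K. i \<noteq> j \<longrightarrow> disj i j)"

end

locale owned_family = line_family +
  fixes own :: "nat \<Rightarrow> nat"
  assumes own: "i < n \<Longrightarrow> own_spec lay (\<lambda>i j. meets (S i) (S j)) n own i"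
begin

definition E :: "nat set" where "E = {i. i < n \<and> own i \<noteq> i}"

text \<open>The owner is part of the label, so edges with different owners never share an end and
  the matchings for all owners are found together.\<close>

definition point_label :: "nat \<Rightarrow> nat \<times> (nat \<Rightarrow> real) set" where
  "point_label i = (own i, S i \<inter> S (own i))"

definition plane_label :: "nat \<Rightarrow> nat \<times> (nat \<Rightarrow> real) set" where
  "plane_label i = (own i, sumset (S (own i)) (S i))"

lemma own_facts:
  assumes "i < n"
  shows "own i < n" "own (own i) = own i" "lay (own i) = lay i"
  using own[OF assms] assms by (auto simp: own_spec_def)

lemma E_facts:
  assumes "i \<in> E"
  shows "i < n" "S i \<noteq> S (own i)" "meets (S i) (S (own i))"
  using own[of i] assms distinct[of i "own i"] by (auto simp: E_def own_spec_def)

lemma same_own_meets_iff: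
  assumes "i \<in> E" "j \<in> E" "own i = own j"
  shows "meets (S i) (S j) \<longleftrightarrow> point_label i = point_label j \<or> plane_label i = plane_label j"
  using meets_iff_same_point_or_plane[of "S (own i)" "S i" "S j"] assms
    E_facts[OF assms(1)] E_facts[OF assms(2)] own_facts
  by (simp add: point_label_def plane_label_def plane_S meets_sym)

lemma same_own_disj_iff:
  assumes "i \<in> E" "j \<in> E" "own i = own j" "i \<noteq> j"
  shows "disj i j \<longleftrightarrow> point_label i \<noteq> point_label j \<and> plane_label i \<noteq> plane_label j"
proof -
  have "i < n" "j < n" using assms E_facts by blast+
  moreover from this have "lay i = lay j" using own_facts(3) assms(3) by metis
  ultimately show ?thesis using disj_iff same_own_meets_iff assms by simp
qed

text \<open>Of two members in the same layer, the later one has been compared with the earlier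
  one.\<close>

lemma greedy_clique: "clique_set {j. j < n \<and> own j = j \<and> lay j = v}"
  unfolding clique_set_def
proof (intro ballI impI)
  fix i j assume ij: "i \<in> {j. j < n \<and> own j = j \<and> lay j = v}" "j \<in> {j. j < n \<and> own j = j \<and> lay j = v}" "i \<noteq> j"
  then consider "i < j" | "j < i" by linarith
  then have "\<not> meets (S i) (S j)"
  proof cases
    case 1
    then have "\<not> meets (S j) (S i)" using own[of j] ij by (auto simp: own_spec_def)
    then show ?thesis using meets_sym by blast
  next
    case 2
    then show ?thesis using own[of i] ij by (auto simp: own_spec_def)
  qed
  then show "disj i j" using ij disj_iff by simp
qed

lemma matching_clique:
  assumes "M \<subseteq> E" "inj_on point_label M" "inj_on plane_label M"
  shows "clique_set {j \<in> M. own j = v}"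
  unfolding clique_set_def
proof (intro ballI impI)
  fix i j assume ij: "i \<in> {j \<in> M. own j = v}" "j \<in> {j \<in> M. own j = v}" "i \<noteq> j"
  then have "point_label i \<noteq> point_label j" "plane_label i \<noteq> plane_label j"
    using assms(2,3) by (auto dest: inj_onD)
  moreover have "i \<in> E" "j \<in> E" "own i = own j" using ij assms(1) by auto
  ultimately show "disj i j" using same_own_disj_iff ij(3) by blast
qed

context
  fixes M :: "nat set" and clr :: "nat \<Rightarrow> nat"
  assumes M: "M \<subseteq> E"
    and clr_own: "\<And>i. i < n \<Longrightarrow> own i = i \<Longrightarrow>
      (clr i = i \<and> (\<forall>m\<in>M. own m \<noteq> i)) \<or> (clr i \<in> M \<and> own (clr i) = i)"
    and clr_E: "\<And>i. i \<in> E \<Longrightarrow> clr i \<in> M \<and> own (clr i) = own i"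
    and clr_eq: "\<And>i j. i \<in> E \<Longrightarrow> j \<in> E \<Longrightarrow> own i = own j \<Longrightarrow> clr i = clr j \<Longrightarrow>
      point_label i = point_label j \<or> plane_label i = plane_label j"
begin

lemma own_clr: "i < n \<Longrightarrow> own (clr i) = own i"
  using clr_own[of i] clr_E[of i] by (cases "own i = i") (auto simp: E_def)

text \<open>Equal colors force equal owners, hence equal layers, where meeting is the opposite of
  disjointness. Two owned lines of one color share a point or plane label, and an owner meets each
  of its lines.\<close>

lemma clr_proper:
  assumes "i < n" "j < n" "i \<noteq> j" "clr i = clr j"
  shows "\<not> disj i j"
proof -
  have own: "own i = own j" using own_clr assms by metis
  then have lay: "lay i = lay j" using own_facts(3) assms by metis
  consider "i \<in> E" "j \<in> E" | "own i = i" "j \<in> E" | "own j = j" "i \<in> E"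
    using own assms by (auto simp: E_def)
  then have "meets (S i) (S j)"
  proof cases
    case 1
    then show ?thesis using same_own_meets_iff clr_eq own assms by blast
  next
    case 2
    then show ?thesis using E_facts(3) own meets_sym by metis
  next
    case 3
    then show ?thesis using E_facts(3) own by metis
  qed
  then show ?thesis using disj_iff assms lay by blast
qed

text \<open>The lines of one owner use only indices of matched lines with this owner, at most
  \<open>k\<close> of them, and a layer has at most \<open>k\<close> owners.\<close>

lemma card_colors:
  assumes Y: "\<And>v. v < n \<Longrightarrow> card {j. j < n \<and> own j = j \<and> lay j = v} \<le> k"
    and Z: "\<And>v. v < n \<Longrightarrow> card {j \<in> M. own j = v} \<le> k"
  shows "card (clr ` {..<n}) \<le> card (lay ` {..<n}) * (k * k)"
proof -
  let ?C = "\<lambda>v. {j. j < n \<and> own j = j \<and> lay j = v}"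
  let ?G = "\<lambda>l. clr ` {i. i < n \<and> own i = l}"
  have "card (?G l) \<le> k" if l: "l < n" "own l = l" for l
  proof (cases "\<exists>m\<in>M. own m = l")
    case True
    have "clr i \<in> M \<and> own (clr i) = l" if "i < n" "own i = l" for i
    proof (cases "i = l")
      case True
      then show ?thesis using clr_own[OF l] \<open>\<exists>m\<in>M. own m = l\<close> by blast
    next
      case False
      then show ?thesis using clr_E[of i] that by (auto simp: E_def)
    qed
    then have "?G l \<subseteq> {j \<in> M. own j = l}" by blast
    moreover have "finite M" using M finite_subset[of M "{..<n}"] by (auto simp: E_def)
    ultimately show ?thesis using Z[OF l(1)] card_mono[of "{j \<in> M. own j = l}" "?G l"] by simp
  next
    case False
    have only_l: "i = l" if "i < n" "own i = l" for i
    proof (rule ccontr)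
      assume "i \<noteq> l"
      then have "i \<in> E" using that by (simp add: E_def)
      then have "clr i \<in> M" "own (clr i) = l" using clr_E[of i] that(2) by simp_all
      then show False using False by blast
    qed
    have "clr i \<in> {clr l}" if "i \<in> {i. i < n \<and> own i = l}" for i
      using only_l[of i] that by simp
    then have "?G l \<subseteq> {clr l}" by (rule image_subsetI)
    then have "card (?G l) \<le> 1" using card_mono[of "{clr l}"] by simp
    \<comment> \<open>An owner without matched lines uses one color of its own; its membership in a
      greedy clique shows \<open>1 \<le> k\<close>.\<close>
    moreover have "card {l} \<le> card (?C (lay l))" using l by (intro card_mono) auto
    then have "1 \<le> k" using Y[OF lay_less[OF l(1)]] by simp
    ultimately show ?thesis by simp
  qed
  then have G: "card (\<Union>l\<in>?C v. ?G l) \<le> k * k" if "v < n" for v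
  proof -
    have "card (\<Union>l\<in>?C v. ?G l) \<le> (\<Sum>l\<in>?C v. card (?G l))"
      by (rule card_UN_le) simp
    also have "\<dots> \<le> (\<Sum>l\<in>?C v. k)"
      by (rule sum_mono) (use \<open>\<And>l. l < n \<Longrightarrow> own l = l \<Longrightarrow> card (?G l) \<le> k\<close> in auto)
    also have "\<dots> \<le> k * k" using Y[OF that] by simp
    finally show ?thesis .
  qed
  have "clr ` {..<n} \<subseteq> (\<Union>v\<in>lay ` {..<n}. \<Union>l\<in>?C v. ?G l)"
    using own_facts by fastforce
  then have "card (clr ` {..<n}) \<le> card (\<Union>v\<in>lay ` {..<n}. \<Union>l\<in>?C v. ?G l)"
    by (intro card_mono) auto
  also have "\<dots> \<le> (\<Sum>v\<in>lay ` {..<n}. card (\<Union>l\<in>?C v. ?G l))"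
    by (rule card_UN_le) simp
  also have "\<dots> \<le> (\<Sum>v\<in>lay ` {..<n}. k * k)"
    by (rule sum_mono) (use G lay_less in auto)
  finally show ?thesis by simp
qed

end

end


lemma gram_ok_agree:
  assumes "agree W s t" "gram_ok n d A B s" "''AA'' \<notin> W" "''AB'' \<notin> W" "''BB'' \<notin> W"
  shows "gram_ok n d A B t"
  using assms agreeD(3)[OF assms(1)] by (simp add: gram_ok_def)

lemmas prog_writes = writes_fill_prog writes_own_prog writes_auction_prog writes_gap_prog
  writes_color_prog writes_pick_prog writes_gram_prog writes_ones_prog writes_layer_prog

lemma run_unchanged':
  assumes "x \<notin> writes p"
  shows "nreg (run p s) x = nreg s x \<and> narr (run p s) x = narr s x \<and> rarr (run p s) x = rarr s x"
  using run_unchanged[OF assms] by blast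

context line_family
begin

lemma main_prog_spec:
  fixes s :: state
  assumes n: "nreg s ''n'' = n" and gram: "gram_ok n d A B s"
    and lay: "\<forall>i<n. narr s ''lay'' i 0 = lay i"
    and ready: "main_ready s"
    and par: "\<forall>i<n. clique_set (row_set s ''par'' i)"
  defines "t \<equiv> run main_prog s"
  defines "clr \<equiv> \<lambda>i. narr t ''color'' i 0"
  shows "clique_set (picked t)"
    and "\<And>i j. i < n \<Longrightarrow> j < n \<Longrightarrow> i \<noteq> j \<Longrightarrow> clr i = clr j \<Longrightarrow> \<not> disj i j"
    and "card (clr ` {..<n}) \<le> card (lay ` {..<n}) * (card (picked t) * card (picked t))"
    and "\<And>i. i < n \<Longrightarrow> card (row_set s ''par'' i) \<le> card (picked t)"
proof -
  let ?i = "NReg ''i''" and ?j = "NReg ''j''"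
  let ?oi = "NCol ''own'' (NReg ''i'')" and ?oj = "NCol ''own'' (NReg ''j'')"
  let ?lab = "BAnd (BNot (BEq ?oi ?i)) (BNot (BEq ?oj ?j))"
  let ?pt = "BAnd (BEq ?oi ?oj) (BAnd ?lab (point_test ?oi ?i ?j))"
  let ?pl = "BAnd (BEq ?oi ?oj) (BAnd ?lab (plane_test ?oi ?i ?j))"
  let ?Y = "BAnd (BEq ?oj ?j) (BEq (NCol ''lay'' ?j) ?i)"
  let ?Z = "BAnd (BEq ?oj ?i) (BNonzero (NCol ''M'' ?j))"
  define s1 where "s1 = run (fill_prog ''meet'' (meet_test ?i ?j)) s"
  define s2 where "s2 = run own_prog s1"
  define s3 where "s3 = run (fill_prog ''pt'' ?pt) s2"
  define s4 where "s4 = run (fill_prog ''pl'' ?pl) s3"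
  define s5 where "s5 = run auction_prog s4"
  define s6 where "s6 = run gap_prog s5"
  define s7 where "s7 = run color_prog s6"
  define s8 where "s8 = run (fill_prog ''Y'' ?Y) s7"
  define s9 where "s9 = run (fill_prog ''Z'' ?Z) s8"
  define s10 where "s10 = run (pick_prog ''par'') s9"
  define s11 where "s11 = run (pick_prog ''Y'') s10"
  have t: "t = run (pick_prog ''Z'') s11"
    unfolding t_def main_prog_def s1_def s2_def s3_def s4_def s5_def s6_def s7_def s8_def s9_def
      s10_def s11_def by (simp only: run.simps(4))
  \<comment> \<open>One frame fact per step of the program; rewriting with them traces a value back
    to the step that computed it.\<close>
  note u1 = run_unchanged'[of _ "fill_prog ''meet'' (meet_test ?i ?j)" s, folded s1_def, unfolded prog_writes]
  note u2 = run_unchanged'[of _ own_prog s1, folded s2_def, unfolded prog_writes]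
  note u3 = run_unchanged'[of _ "fill_prog ''pt'' ?pt" s2, folded s3_def, unfolded prog_writes]
  note u4 = run_unchanged'[of _ "fill_prog ''pl'' ?pl" s3, folded s4_def, unfolded prog_writes]
  note u5 = run_unchanged'[of _ auction_prog s4, folded s5_def, unfolded prog_writes]
  note u6 = run_unchanged'[of _ gap_prog s5, folded s6_def, unfolded prog_writes]
  note u7 = run_unchanged'[of _ color_prog s6, folded s7_def, unfolded prog_writes]
  note u8 = run_unchanged'[of _ "fill_prog ''Y'' ?Y" s7, folded s8_def, unfolded prog_writes]
  note u9 = run_unchanged'[of _ "fill_prog ''Z'' ?Z" s8, folded s9_def, unfolded prog_writes]
  note u10 = run_unchanged'[of _ "pick_prog ''par''" s9, folded s10_def, unfolded prog_writes]
  note u11 = run_unchanged'[of _ "pick_prog ''Y''" s10, folded s11_def, unfolded prog_writes]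
  note u12 = run_unchanged'[of _ "pick_prog ''Z''" s11, folded t, unfolded prog_writes]
  have zero: "narr s ''meet'' = (\<lambda>_ _. 0)" "narr s ''pt'' = (\<lambda>_ _. 0)" "narr s ''pl'' = (\<lambda>_ _. 0)"
    "narr s ''M'' = (\<lambda>_ _. 0)" "narr s ''pr'' = (\<lambda>_ _. 0)" "narr s ''H'' = (\<lambda>_ _. 0)"
    "narr s ''Y'' = (\<lambda>_ _. 0)" "narr s ''Z'' = (\<lambda>_ _. 0)" "narr s ''clique'' = (\<lambda>_ _. 0)"
    "nreg s ''best'' = 0"
    using ready by (simp_all add: main_ready_def)

  have meet: "narr s1 ''meet'' i j = of_bool (i < nreg s ''n'' \<and> j < nreg s ''n'' \<and> meets (S i) (S j))" for i j
    unfolding s1_def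
  proof (rule narr_fill_prog)
    fix t assume "agree {''i'', ''j'', ''meet''} s t"
    then have "gram_ok n d A B t" using gram by (rule gram_ok_agree) simp_all
    then show "nreg t ''i'' < nreg s ''n'' \<Longrightarrow> nreg t ''j'' < nreg s ''n'' \<Longrightarrow>
      bval (meet_test ?i ?j) t \<longleftrightarrow> meets (S (nreg t ''i'')) (S (nreg t ''j''))"
      using bval_meet_test[of t ?i ?j] n by simp
  qed (simp_all add: zero)
  define own where "own i = narr s2 ''own'' i 0" for i
  have "own_spec lay (\<lambda>i j. meets (S i) (S j)) n own i" if "i < n" for i
  proof -
    have "own_spec (\<lambda>i. narr s1 ''lay'' i 0) (\<lambda>i j. narr s1 ''meet'' i j \<noteq> 0) n own i"
      using narr_own_prog[of i s1] that n by (simp add: u1 s2_def[symmetric] own_def[abs_def])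
    then show ?thesis
      using that lay n unfolding own_spec_def by (auto simp: u1 meet)
  qed
  then interpret owned_family n d A B disj lay own
    by unfold_locales

  have agree2: "gram_ok n d A B u \<and> narr u ''own'' = narr s2 ''own''"
    if "agree W s2 u" "W \<subseteq> {''i'', ''j'', ''pt'', ''pl''}" for u W
  proof -
    let ?W = "{''i'', ''j'', ''pt'', ''pl'', ''meet'', ''own''}"
    have "agree ?W s s1" "agree ?W s1 s2"
      unfolding s1_def s2_def by (rule agree_mono[OF agree_run]; simp add: prog_writes)+
    moreover have "agree ?W s2 u"
      using that by (elim agree_mono) auto
    ultimately have "agree ?W s u"
      using agree_trans by blast
    then have "gram_ok n d A B u" using gram by (rule gram_ok_agree) simp_all
    moreover have "narr u ''own'' = narr s2 ''own''"
      using agreeD(2)[OF agree_mono[OF that]] by simp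
    ultimately show ?thesis by blast
  qed
  have pt: "narr s3 ''pt'' i j = of_bool (i < nreg s2 ''n'' \<and> j < nreg s2 ''n'' \<and> i \<in> E \<and> j \<in> E \<and> point_label i = point_label j)" for i j
    unfolding s3_def
  proof (rule narr_fill_prog)
    fix t assume ag: "agree {''i'', ''j'', ''pt''} s2 t"
      and "nreg t ''i'' < nreg s2 ''n''" "nreg t ''j'' < nreg s2 ''n''"
    then have ij: "nreg t ''i'' < n" "nreg t ''j'' < n" by (simp_all add: u1 u2 n)
    have g: "gram_ok n d A B t" "narr t ''own'' (nreg t ''i'') 0 = own (nreg t ''i'')"
      "narr t ''own'' (nreg t ''j'') 0 = own (nreg t ''j'')"
      using agree2[OF ag] by (simp_all add: own_def)
    show "bval ?pt t \<longleftrightarrow> nreg t ''i'' \<in> E \<and> nreg t ''j'' \<in> E \<and> point_label (nreg t ''i'') = point_label (nreg t ''j'')"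
    \<comment> \<open>The determinant test is meaningful only for two lines that meet a common owner
      and differ from it; in all other cases the guards in front of it give the answer.\<close>
    proof (cases "own (nreg t ''i'') = own (nreg t ''j'') \<and> nreg t ''i'' \<in> E \<and> nreg t ''j'' \<in> E")
      case True
      then show ?thesis
        using bval_point_test[of t ?oi ?i ?j] g ij own_facts[OF ij(1)]
          E_facts[of "nreg t ''i''"] E_facts[of "nreg t ''j''"]
        by (auto simp: point_label_def E_def)
    next
      case False
      then show ?thesis using ij g by (auto simp: E_def point_label_def)
    qed
  qed (simp_all add: u1 u2 zero)
  have pl: "narr s4 ''pl'' i j = of_bool (i < nreg s3 ''n'' \<and> j < nreg s3 ''n'' \<and> i \<in> E \<and> j \<in> E \<and> plane_label i = plane_label j)" for i j
    unfolding s4_def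
  proof (rule narr_fill_prog)
    fix t assume ag3: "agree {''i'', ''j'', ''pl''} s3 t"
      and "nreg t ''i'' < nreg s3 ''n''" "nreg t ''j'' < nreg s3 ''n''"
    then have ij: "nreg t ''i'' < n" "nreg t ''j'' < n" by (simp_all add: u1 u2 u3 n)
    have "agree {''i'', ''j'', ''pt'', ''pl''} s2 s3"
      unfolding s3_def by (rule agree_mono[OF agree_run]) (simp add: prog_writes)
    moreover have "agree {''i'', ''j'', ''pt'', ''pl''} s3 t"
      using ag3 by (rule agree_mono) simp
    ultimately have ag: "agree {''i'', ''j'', ''pt'', ''pl''} s2 t" by (rule agree_trans)
    have g: "gram_ok n d A B t" "narr t ''own'' (nreg t ''i'') 0 = own (nreg t ''i'')"
      "narr t ''own'' (nreg t ''j'') 0 = own (nreg t ''j'')"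
      using agree2[OF ag] by (simp_all add: own_def)
    show "bval ?pl t \<longleftrightarrow> nreg t ''i'' \<in> E \<and> nreg t ''j'' \<in> E \<and> plane_label (nreg t ''i'') = plane_label (nreg t ''j'')"
    proof (cases "own (nreg t ''i'') = own (nreg t ''j'') \<and> nreg t ''i'' \<in> E \<and> nreg t ''j'' \<in> E")
      case True
      then show ?thesis
        using bval_plane_test[of t ?oi ?i ?j] g ij own_facts[OF ij(1)]
          E_facts[of "nreg t ''i''"] E_facts[of "nreg t ''j''"] meets_sym
        by (auto simp: plane_label_def E_def)
    next
      case False
      then show ?thesis using ij g by (auto simp: E_def plane_label_def)
    qed
  qed (simp_all add: u1 u2 u3 zero)

  have n4: "nreg s4 ''n'' = n" and n5: "nreg s5 ''n'' = n" by (simp_all add: u1 u2 u3 u4 u5 n)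
  have pt4: "narr s4 ''pt'' i j \<noteq> 0 \<longleftrightarrow> i \<in> E \<and> j \<in> E \<and> point_label i = point_label j"
    and pl4: "narr s4 ''pl'' i j \<noteq> 0 \<longleftrightarrow> i \<in> E \<and> j \<in> E \<and> plane_label i = plane_label j"
    if "i < n" "j < n" for i j
    using that by (auto simp: u4 pt pl u1 u2 u3 n)
  have E: "E \<subseteq> {..<n}" by (auto simp: E_def)
  define M where "M = matched s5"
  define pr where "pr = price s5"
  have zero4: "narr s4 ''M'' j 0 = 0" "narr s4 ''pr'' j 0 = 0" for j
    by (simp_all add: u1 u2 u3 u4 zero)
  have inv: "auction_inv n point_label plane_label E M pr"
    unfolding M_def pr_def s5_def by (rule auction_prog_spec(1)[OF n4 E pt4 pl4 zero4])
  have fin: "n < pr x" if "x \<in> E" "point_label x \<notin> point_label ` M" for x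
    using auction_prog_spec(2)[OF n4 E pt4 pl4 zero4] that unfolding M_def pr_def s5_def by blast
  have M: "M \<subseteq> E" "inj_on point_label M" "inj_on plane_label M"
    using inv by (simp_all only: auction_inv_def simp_thms)
  define g where "g = nreg s6 ''gap''"
  have g: "g \<le> Suc n" "\<And>i. i \<in> E \<Longrightarrow> pr i \<noteq> g"
    using gap_prog_spec[of s5] E unfolding n5 g_def s6_def pr_def
    by (auto simp: u1 u2 u3 u4 u5 zero)
  have charge_ex: "\<exists>m\<in>M. charged point_label plane_label pr g x m" if "x \<in> E" for x
    by (rule charged_exists[OF inv]) (fact fin g that)+
  have charge_same: "point_label x = point_label y \<or> plane_label x = plane_label y"
    if "x \<in> E" "y \<in> E" "m \<in> M" "charged point_label plane_label pr g x m" "charged point_label plane_label pr g y m"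
    for x y m
    by (rule charged_same[OF inv]) (fact fin g that)+
  have M_iff: "narr s6 ''M'' j 0 \<noteq> 0 \<longleftrightarrow> j \<in> M" if "j < n" for j
    using that n5 by (simp add: u6 M_def matched_def)
  have own6: "narr s6 ''own'' i 0 = own i" for i
    by (simp add: u3 u4 u5 u6 own_def)
  have rel: "color_rel s6 i j \<longleftrightarrow> j \<in> M \<and> own j = own i \<and>
      (own i = i \<or> (g < pr i \<and> j \<in> E \<and> i \<in> E \<and> plane_label i = plane_label j)
        \<or> (pr i < g \<and> i \<in> E \<and> j \<in> E \<and> point_label i = point_label j))" if "i < n" "j < n" for i j
    unfolding color_rel_def own6 M_iff[OF that(2)]
    using pt4[OF that] pl4[OF that] by (auto simp: g_def pr_def u5 u6)
  have clr7: "clr i = narr (run color_prog s6) ''color'' i 0" for i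
    by (simp add: clr_def u8 u9 u10 u11 u12 s7_def[symmetric])
  have n6: "nreg s6 ''n'' = n" by (simp add: u6 n5)
  have clr: "(clr i = i \<and> (\<forall>j<n. \<not> color_rel s6 i j)) \<or> (clr i < n \<and> color_rel s6 i (clr i))" if "i < n" for i
    using color_prog_spec[of i s6] that unfolding n6 clr7 by blast
  have clr_own: "(clr i = i \<and> (\<forall>m\<in>M. own m \<noteq> i)) \<or> (clr i \<in> M \<and> own (clr i) = i)" if "i < n" "own i = i" for i
    using clr[OF that(1)] rel[OF that(1)] that(2) M(1) E by auto
  \<comment> \<open>The vertex cover reaches every line of \<open>E\<close>, so some matched line
    qualifies and the default color is not taken.\<close>
  have clr_E: "clr i \<in> M \<and> own (clr i) = own i \<and> charged point_label plane_label pr g i (clr i)" if iE: "i \<in> E" for i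
  proof -
    have i: "i < n" "own i \<noteq> i" using iE by (auto simp: E_def)
    obtain m where m: "m \<in> M" "charged point_label plane_label pr g i m"
      using charge_ex[OF iE] by blast
    then have "m \<in> E" "m < n" using M(1) E by auto
    moreover have "own m = own i" using m(2) by (auto simp: charged_def point_label_def plane_label_def)
    ultimately have "color_rel s6 i m"
      using m iE i rel by (auto simp: charged_def)
    then have "clr i < n" "color_rel s6 i (clr i)" using clr[OF i(1)] \<open>m < n\<close> by auto
    then show ?thesis using rel[OF i(1)] i(2) by (auto simp: charged_def)
  qed
  have clr_eq: "point_label i = point_label j \<or> plane_label i = plane_label j"
    if "i \<in> E" "j \<in> E" "clr i = clr j" for i j
    using charge_same[OF that(1,2)] clr_E[OF that(1)] clr_E[OF that(2)] that(3) by metis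
  show "\<not> disj i j" if "i < n" "j < n" "i \<noteq> j" "clr i = clr j" for i j
    using clr_proper[OF M(1) clr_own _ _ that] clr_E clr_eq by blast

  have Y8: "narr s8 ''Y'' i j = of_bool (i < nreg s7 ''n'' \<and> j < nreg s7 ''n'' \<and> own j = j \<and> lay j = i)" for i j
    unfolding s8_def
  proof (rule narr_fill_prog)
    fix t assume ag: "agree {''i'', ''j'', ''Y''} s7 t" and "nreg t ''j'' < nreg s7 ''n''"
    then have "nreg t ''j'' < n" by (simp add: u7 n6)
    moreover have "narr t ''own'' = narr s6 ''own''" "narr t ''lay'' = narr s ''lay''"
      using agreeD(2)[OF ag] by (simp_all add: u1 u2 u3 u4 u5 u6 u7)
    ultimately show "bval ?Y t \<longleftrightarrow> own (nreg t ''j'') = nreg t ''j'' \<and> lay (nreg t ''j'') = nreg t ''i''"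
      using own6 lay by simp
  qed (simp_all add: u1 u2 u3 u4 u5 u6 u7 zero)
  have Z9: "narr s9 ''Z'' i j = of_bool (i < nreg s8 ''n'' \<and> j < nreg s8 ''n'' \<and> j \<in> M \<and> own j = i)" for i j
    unfolding s9_def
  proof (rule narr_fill_prog)
    fix t assume ag: "agree {''i'', ''j'', ''Z''} s8 t" and "nreg t ''j'' < nreg s8 ''n''"
    then have "nreg t ''j'' < n" by (simp add: u7 u8 n6)
    moreover have "narr t ''own'' = narr s6 ''own''" "narr t ''M'' = narr s6 ''M''"
      using agreeD(2)[OF ag] by (simp_all add: u7 u8)
    ultimately show "bval ?Z t \<longleftrightarrow> nreg t ''j'' \<in> M \<and> own (nreg t ''j'') = nreg t ''i''"
      using own6 M_iff by auto
  qed (simp_all add: u1 u2 u3 u4 u5 u6 u7 u8 zero)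
  have n9: "nreg s9 ''n'' = n" "nreg s10 ''n'' = n" "nreg s11 ''n'' = n"
    by (simp_all add: u7 u8 u9 u10 u11 n6)
  have rows: "row_set s9 ''par'' i = row_set s ''par'' i"
    "i < n \<Longrightarrow> row_set s10 ''Y'' i = {j. j < n \<and> own j = j \<and> lay j = i}"
    "i < n \<Longrightarrow> row_set s11 ''Z'' i = {j \<in> M. own j = i}" for i
    using M(1) E unfolding row_set_def n9 n
    by (auto simp: u1 u2 u3 u4 u5 u6 u7 u8 u9 u10 u11 Y8 Z9 n5)
  have p9: "picked s9 = {}" "nreg s9 ''best'' = 0"
    by (simp_all add: picked_def u1 u2 u3 u4 u5 u6 u7 u8 u9 zero)
  have pick1: "clique_set (picked s10) \<and> nreg s10 ''best'' = card (picked s10) \<and>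
      (\<forall>i<n. card (row_set s ''par'' i) \<le> card (picked s10))"
    using pick_prog_spec[of "''par''" clique_set s9] par
    unfolding n9 rows s10_def[symmetric] by (simp add: p9 writes_pick_prog clique_set_def)
  have pick2: "clique_set (picked s11) \<and> nreg s11 ''best'' = card (picked s11) \<and>
      card (picked s10) \<le> card (picked s11) \<and>
      (\<forall>i<n. card {j. j < n \<and> own j = j \<and> lay j = i} \<le> card (picked s11))"
    using pick_prog_spec[of "''Y''" clique_set s10] pick1 greedy_clique
    unfolding n9 s11_def[symmetric] by (simp add: rows writes_pick_prog)
  have pick3: "clique_set (picked t) \<and> card (picked s11) \<le> card (picked t) \<and>
      (\<forall>i<n. card {j \<in> M. own j = i} \<le> card (picked t))"
    using pick_prog_spec[of "''Z''" clique_set s11] pick2 matching_clique[OF M]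
    unfolding n9 t[symmetric] by (simp add: rows writes_pick_prog)
  show "clique_set (picked t)" using pick3 by blast
  show "card (row_set s ''par'' i) \<le> card (picked t)" if "i < n" for i
    using pick1 pick2 pick3 that by (meson le_trans)
  show "card (clr ` {..<n}) \<le> card (lay ` {..<n}) * (card (picked t) * card (picked t))"
  proof (rule card_colors[OF M(1) clr_own])
    show "card {j. j < n \<and> own j = j \<and> lay j = v} \<le> card (picked t)" if "v < n" for v
      using pick2 pick3 that by (meson le_trans)
  qed (use pick3 clr_E clr_eq in blast)+
qed

end

section \<open>Lines in affine and projective space\<close>

lemma edge_disjointness_graph:
  "{x, y} \<in> edges (disjointness_graph F) \<longleftrightarrow> x \<in> F \<and> y \<in> F \<and> x \<noteq> y \<and> x \<inter> y = {}"
  by (auto simp: disjointness_graph_def doubleton_eq_iff)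

lemma verts_disjointness_graph: "verts (disjointness_graph F) = F"
  by (simp add: disjointness_graph_def)

lemma poly_nat_mono:
  fixes p :: "nat poly"
  assumes "x \<le> y"
  shows "poly p x \<le> poly p y"
  using assms by (induction p) (auto intro: mult_le_mono)

text \<open>The program works with indices. As the lines are pairwise distinct, the color array
  defines a function on lines, and clique sizes are preserved.\<close>

lemma outputs_clique_coloringI:
  fixes L :: "nat \<Rightarrow> 'a set"
  assumes n: "nreg t ''n'' = n" and inj: "inj_on L {..<n}"
    and clique: "\<And>i j. i \<in> picked t \<Longrightarrow> j \<in> picked t \<Longrightarrow> i \<noteq> j \<Longrightarrow> L i \<inter> L j = {}"
    and proper: "\<And>i j. i < n \<Longrightarrow> j < n \<Longrightarrow> i \<noteq> j \<Longrightarrow> narr t ''color'' i 0 = narr t ''color'' j 0 \<Longrightarrow>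
      L i \<inter> L j \<noteq> {}"
    and card: "card ((\<lambda>i. narr t ''color'' i 0) ` {..<n}) \<le> card (picked t) ^ e"
  shows "\<exists>K f. outputs_clique_coloring t n L K f \<and>
    (let G = disjointness_graph (L ` {..<n}) in
      is_clique G K \<and> proper_coloring G f \<and> card (f ` verts G) \<le> card K ^ e)"
proof -
  define f where "f l = narr t ''color'' (the_inv_into {..<n} L l) 0" for l
  have f: "f (L i) = narr t ''color'' i 0" if "i < n" for i
    using that inj by (simp add: f_def the_inv_into_f_f)
  let ?K = "L ` picked t"
  have sub: "picked t \<subseteq> {..<n}" using n by (auto simp: picked_def)
  have "outputs_clique_coloring t n L ?K f"
    using n f by (auto simp: outputs_clique_coloring_def picked_def)
  moreover have "is_clique (disjointness_graph (L ` {..<n})) ?K"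
    unfolding is_clique_def verts_disjointness_graph edge_disjointness_graph
    using sub clique by blast
  moreover have "proper_coloring (disjointness_graph (L ` {..<n})) f"
    unfolding proper_coloring_def verts_disjointness_graph edge_disjointness_graph
  proof (intro ballI impI notI)
    fix x y assume "x \<in> L ` {..<n}" "y \<in> L ` {..<n}" "f x = f y"
      and xy: "x \<in> L ` {..<n} \<and> y \<in> L ` {..<n} \<and> x \<noteq> y \<and> x \<inter> y = {}"
    then obtain i j where ij: "i < n" "j < n" "x = L i" "y = L j" by auto
    then have "i \<noteq> j" using xy by blast
    then show False using proper[OF ij(1,2)] ij xy f \<open>f x = f y\<close> by auto
  qed
  moreover have "card ?K = card (picked t)"
    using card_image inj_on_subset[OF inj sub] by blast
  moreover have "f ` (L ` {..<n}) = (\<lambda>i. narr t ''color'' i 0) ` {..<n}"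
    unfolding image_image by (rule image_cong) (simp_all add: f)
  ultimately show ?thesis
    using card by (intro exI[of _ ?K] exI[of _ f]) (simp add: Let_def verts_disjointness_graph)
qed

text \<open>The guard is needed since the running time may depend on \<open>m\<close>, but the input has size \<open>0\<close> if \<open>n = 0\<close>.\<close>

definition guarded :: "prog \<Rightarrow> com" where
  "guarded p = Cond (NLess (NConst 0) (NReg ''n'')) (cmd p) Skip"

lemma poly_time_guarded:
  fixes L :: "real vec \<Rightarrow> real vec \<Rightarrow> 'a set"
  assumes wf: "wf_prog p" and D: "\<And>m. m \<in> D \<Longrightarrow> 1 \<le> m"
    and spec: "\<And>m n a b t. m \<in> D \<Longrightarrow> 0 < n \<Longrightarrow> (\<And>i. i < n \<Longrightarrow> valid m (a i) (b i)) \<Longrightarrow>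
      inj_on (\<lambda>i. L (a i) (b i)) {..<n} \<Longrightarrow> t = run p (input_state n m a b) \<Longrightarrow>
      (\<forall>i\<in>picked t. \<forall>j\<in>picked t. i \<noteq> j \<longrightarrow> L (a i) (b i) \<inter> L (a j) (b j) = {}) \<and>
      (\<forall>i<n. \<forall>j<n. i \<noteq> j \<longrightarrow> narr t ''color'' i 0 = narr t ''color'' j 0 \<longrightarrow> L (a i) (b i) \<inter> L (a j) (b j) \<noteq> {}) \<and>
      card ((\<lambda>i. narr t ''color'' i 0) ` {..<n}) \<le> card (picked t) ^ e"
  shows "poly_time_clique_coloring (guarded p) e D valid L"
  unfolding poly_time_clique_coloring_def
proof (intro exI[of _ "time p + 2"] ballI allI impI)
  fix m n and a b :: "nat \<Rightarrow> real vec"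
  assume m: "m \<in> D" and valid: "\<forall>i<n. valid m (a i) (b i)" and inj: "inj_on (\<lambda>i. L (a i) (b i)) {..<n}"
  let ?s = "input_state n m a b"
  let ?L = "\<lambda>i. L (a i) (b i)"
  have s: "nreg ?s ''n'' = n" "nreg ?s ''m'' = m" by (simp_all add: input_state_def)
  have "\<exists>k t. exec (guarded p) ?s k t \<and> k \<le> poly (time p + 2) (2 * n * m) \<and> nreg t ''n'' = n \<and>
      (\<forall>i\<in>picked t. \<forall>j\<in>picked t. i \<noteq> j \<longrightarrow> ?L i \<inter> ?L j = {}) \<and>
      (\<forall>i<n. \<forall>j<n. i \<noteq> j \<longrightarrow> narr t ''color'' i 0 = narr t ''color'' j 0 \<longrightarrow> ?L i \<inter> ?L j \<noteq> {}) \<and>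
      card ((\<lambda>i. narr t ''color'' i 0) ` {..<n}) \<le> card (picked t) ^ e"
  proof (cases "n = 0")
    case True
    then have "\<not> bval (NLess (NConst 0) (NReg ''n'')) ?s" using s by simp
    then have "exec (guarded p) ?s (1 + 1) ?s"
      unfolding guarded_def by (rule exec.CondFalse[OF _ exec.Skip])
    moreover have "1 + 1 \<le> poly (time p + 2) (2 * n * m)" by simp
    moreover have "picked ?s = {}" using True s by (simp add: picked_def)
    ultimately show ?thesis using True s by (intro exI[of _ "1 + 1"] exI[of _ ?s]) simp
  next
    case False
    define t where "t = run p ?s"
    obtain k where k: "k \<le> poly (time p) (n + m)" "exec (cmd p) ?s k t"
      using exec_cmd[OF wf, of ?s] s by (auto simp: t_def)
    have "exec (guarded p) ?s (k + 1) t"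
      unfolding guarded_def using False s k(2) by (intro exec.CondTrue) simp_all
    \<comment> \<open>Since \<open>n\<close> and \<open>m\<close> are positive, \<open>n + m\<close>
      is at most the input size \<open>2 * n * m\<close>, so a polynomial in the former is bounded
      by the same one in the latter.\<close>
    moreover have "n * 1 \<le> n * m" "1 * m \<le> n * m"
      using False D[OF m] by (intro mult_le_mono; simp)+
    then have "n + m \<le> 2 * n * m" unfolding mult.assoc by linarith
    then have "k + 1 \<le> poly (time p + 2) (2 * n * m)"
      using k(1) poly_nat_mono[of "n + m" "2 * n * m" "time p"] by simp
    moreover have "nreg t ''n'' = n"
      using run_unchanged(1) wf_prog_writes[OF wf] s by (auto simp: t_def)
    ultimately show ?thesis
      using spec[OF m _ _ inj t_def] valid False by blast
  qed
  then obtain k t where kt: "exec (guarded p) ?s k t" "k \<le> poly (time p + 2) (2 * n * m)" and n: "nreg t ''n'' = n"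
    and clique: "\<forall>i\<in>picked t. \<forall>j\<in>picked t. i \<noteq> j \<longrightarrow> ?L i \<inter> ?L j = {}"
    and proper: "\<forall>i<n. \<forall>j<n. i \<noteq> j \<longrightarrow> narr t ''color'' i 0 = narr t ''color'' j 0 \<longrightarrow> ?L i \<inter> ?L j \<noteq> {}"
    and card: "card ((\<lambda>i. narr t ''color'' i 0) ` {..<n}) \<le> card (picked t) ^ e"
    by blast
  have "\<exists>K f. outputs_clique_coloring t n ?L K f \<and>
    (let G = disjointness_graph (?L ` {..<n}) in
      is_clique G K \<and> proper_coloring G f \<and> card (f ` verts G) \<le> card K ^ e)"
    by (rule outputs_clique_coloringI[OF n inj _ _ card]) (use clique proper in blast)+
  then show "\<exists>k t K f. exec (guarded p) ?s k t \<and> k \<le> poly (time p + 2) (2 * n * m) \<and>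
      outputs_clique_coloring t n ?L K f \<and>
      (let G = disjointness_graph (?L ` {..<n}) in
        is_clique G K \<and> proper_coloring G f \<and> card (f ` verts G) \<le> card K ^ e)"
    using kt by blast
qed

text \<open>The chromatic number asks for colors from an initial segment, so the colors in use are
  renumbered.\<close>

lemma chromatic_number_le:
  assumes fin: "finite (f ` verts G)" and f: "proper_coloring G f"
  shows "chromatic_number G \<le> card (f ` verts G)"
proof -
  obtain h where h: "bij_betw h (f ` verts G) {0..<card (f ` verts G)}"
    using ex_bij_betw_finite_nat[OF fin] by blast
  have "proper_coloring G (h \<circ> f)"
    using f h unfolding proper_coloring_def bij_betw_def inj_on_def by auto
  moreover have "(h \<circ> f) ` verts G \<subseteq> {..<card (f ` verts G)}"
    using h by (auto simp: bij_betw_def)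
  ultimately show ?thesis
    unfolding chromatic_number_def by (intro Least_le) blast
qed

lemma card_le_clique_number:
  assumes "finite (verts G)" "is_clique G K"
  shows "card K \<le> clique_number G"
proof -
  have "{card K | K. is_clique G K} \<subseteq> card ` Pow (verts G)"
    by (auto simp: is_clique_def)
  then have "finite {card K | K. is_clique G K}"
    using assms(1) finite_subset by blast
  then show ?thesis
    unfolding clique_number_def using assms(2) by (intro Max_ge) auto
qed

text \<open>The purely combinatorial bound: enumerate \<open>F\<close>, run the algorithm, and
  compare the clique it finds with a largest one.\<close>

lemma poly_time_chromatic_bound:
  fixes L :: "real vec \<Rightarrow> real vec \<Rightarrow> 'a set"
  assumes alg: "poly_time_clique_coloring c e D valid L" and m: "m \<in> D"
    and fin: "finite F" and F: "F \<subseteq> {L u v | u v. valid m u v}"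
  shows "chromatic_number (disjointness_graph F) \<le> clique_number (disjointness_graph F) ^ e"
proof -
  define n where "n = card F"
  obtain h where h: "bij_betw h {0..<n} F"
    using ex_bij_betw_nat_finite[OF fin] n_def by blast
  have "h i \<in> F" if "i < n" for i
    using that h by (auto simp: bij_betw_def)
  then have "\<exists>u v. valid m u v \<and> h i = L u v" if "i < n" for i
    using that F by blast
  then obtain a b where ab: "\<And>i. i < n \<Longrightarrow> valid m (a i) (b i) \<and> h i = L (a i) (b i)"
    by metis
  let ?L = "\<lambda>i. L (a i) (b i)"
  have inj: "inj_on ?L {..<n}"
    using h ab unfolding bij_betw_def inj_on_def by (metis atLeast0LessThan lessThan_iff)
  have im: "?L ` {..<n} = F"
    using h ab unfolding bij_betw_def atLeast0LessThan by force
  obtain K f where "is_clique (disjointness_graph F) K" "proper_coloring (disjointness_graph F) f"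
    "card (f ` verts (disjointness_graph F)) \<le> card K ^ e"
    using alg m ab inj unfolding poly_time_clique_coloring_def Let_def im[symmetric] by blast
  moreover have "finite (verts (disjointness_graph F))"
    by (simp add: verts_disjointness_graph fin)
  ultimately show ?thesis
    using chromatic_number_le[of f "disjointness_graph F"] card_le_clique_number[of "disjointness_graph F" K]
    by (meson finite_imageI le_trans power_mono zero_le)
qed

section \<open>Homogeneous coordinates\<close>

definition vec_fun :: "nat \<Rightarrow> real vec \<Rightarrow> nat \<Rightarrow> real" where
  "vec_fun m x = (\<lambda>j. if j < m then x $ j else 0)"

text \<open>Points get the extra coordinate 1 at index \<open>m\<close>, where directions, encoded
  by \<open>vec_fun\<close>, have 0: they are the points at infinity.\<close>

definition hom_fun :: "nat \<Rightarrow> real vec \<Rightarrow> nat \<Rightarrow> real" where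
  "hom_fun m x = (\<lambda>j. if j < m then x $ j else if j = m then 1 else 0)"

lemma vec_fun_comb:
  "u \<in> carrier_vec m \<Longrightarrow> w \<in> carrier_vec m \<Longrightarrow>
    vec_fun m (a \<cdot>\<^sub>v u + b \<cdot>\<^sub>v w) = lc a (vec_fun m u) b (vec_fun m w)"
  by (auto simp: vec_fun_def lc_def)

lemma vec_fun_smult: "u \<in> carrier_vec m \<Longrightarrow> vec_fun m (c \<cdot>\<^sub>v u) = lc c (vec_fun m u) 0 (vec_fun m u)"
  by (auto simp: vec_fun_def lc_def)

lemma hom_fun_comb:
  "p \<in> carrier_vec m \<Longrightarrow> v \<in> carrier_vec m \<Longrightarrow>
    hom_fun m (p + t \<cdot>\<^sub>v v) = lc 1 (hom_fun m p) t (vec_fun m v)"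
  by (auto simp: vec_fun_def hom_fun_def lc_def)

lemma vec_fun_inject: "x \<in> carrier_vec m \<Longrightarrow> y \<in> carrier_vec m \<Longrightarrow> vec_fun m x = vec_fun m y \<longleftrightarrow> x = y"
  by (auto simp: vec_fun_def fun_eq_iff intro!: eq_vecI)

lemma hom_fun_inject: "x \<in> carrier_vec m \<Longrightarrow> y \<in> carrier_vec m \<Longrightarrow> hom_fun m x = hom_fun m y \<longleftrightarrow> x = y"
  by (auto simp: hom_fun_def fun_eq_iff intro!: eq_vecI)

lemma vec_fun_eq_0: "x \<in> carrier_vec m \<Longrightarrow> vec_fun m x = (\<lambda>_. 0) \<longleftrightarrow> x = 0\<^sub>v m"
proof -
  assume x: "x \<in> carrier_vec m"
  have "vec_fun m (0\<^sub>v m) = (\<lambda>_. 0)" by (auto simp: vec_fun_def)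
  then show ?thesis using vec_fun_inject[OF x zero_carrier_vec] by simp
qed

lemma indep_vec_fun: "independent_pair m u w \<Longrightarrow> indep (vec_fun m u) (vec_fun m w)"
  by (auto simp: independent_pair_def indep_def vec_fun_comb[symmetric] vec_fun_eq_0)

lemma lc_span2: "lc a u b w \<in> span2 u w"
  unfolding span2_def by blast

lemma proj_line_eq:
  assumes "u \<in> carrier_vec m" "w \<in> carrier_vec m"
  shows "proj_line u w =
    {proj_point x | x. x \<in> carrier_vec m \<and> x \<noteq> 0\<^sub>v m \<and> vec_fun m x \<in> span2 (vec_fun m u) (vec_fun m w)}"
proof (intro equalityI subsetI)
  fix y assume "y \<in> proj_line u w"
  then obtain a b where "y = proj_point (a \<cdot>\<^sub>v u + b \<cdot>\<^sub>v w)" "a \<cdot>\<^sub>v u + b \<cdot>\<^sub>v w \<noteq> 0\<^sub>v m"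
    using assms by (auto simp: proj_line_def)
  then show "y \<in> {proj_point x | x. x \<in> carrier_vec m \<and> x \<noteq> 0\<^sub>v m \<and> vec_fun m x \<in> span2 (vec_fun m u) (vec_fun m w)}"
    using assms by (auto simp: vec_fun_comb lc_span2 intro!: exI[of _ "a \<cdot>\<^sub>v u + b \<cdot>\<^sub>v w"])
next
  fix y assume "y \<in> {proj_point x | x. x \<in> carrier_vec m \<and> x \<noteq> 0\<^sub>v m \<and> vec_fun m x \<in> span2 (vec_fun m u) (vec_fun m w)}"
  then obtain x a b where x: "x \<in> carrier_vec m" "x \<noteq> 0\<^sub>v m" "y = proj_point x"
    "vec_fun m x = lc a (vec_fun m u) b (vec_fun m w)"
    by (auto simp: span2_def)
  then have "x = a \<cdot>\<^sub>v u + b \<cdot>\<^sub>v w"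
    using vec_fun_inject[of x m "a \<cdot>\<^sub>v u + b \<cdot>\<^sub>v w"] assms by (simp add: vec_fun_comb)
  then show "y \<in> proj_line u w" using x assms by (auto simp: proj_line_def)
qed

text \<open>Representatives of one projective point are proportional and planes are closed under
  scaling, so common points correspond to common nonzero vectors.\<close>

lemma proj_lines_disjoint_iff:
  assumes "u \<in> carrier_vec m" "w \<in> carrier_vec m" "u' \<in> carrier_vec m" "w' \<in> carrier_vec m"
  shows "proj_line u w \<inter> proj_line u' w' = {} \<longleftrightarrow>
    \<not> meets (span2 (vec_fun m u) (vec_fun m w)) (span2 (vec_fun m u') (vec_fun m w'))"
proof
  assume disj: "proj_line u w \<inter> proj_line u' w' = {}"
  show "\<not> meets (span2 (vec_fun m u) (vec_fun m w)) (span2 (vec_fun m u') (vec_fun m w'))"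
  proof
    assume "meets (span2 (vec_fun m u) (vec_fun m w)) (span2 (vec_fun m u') (vec_fun m w'))"
    then obtain v where v: "v \<in> span2 (vec_fun m u) (vec_fun m w)"
      "v \<in> span2 (vec_fun m u') (vec_fun m w')" "v \<noteq> (\<lambda>_. 0)"
      by (auto simp: meets_def)
    then obtain a b where ab: "v = lc a (vec_fun m u) b (vec_fun m w)"
      by (auto simp: span2_def[of "vec_fun m u"])
    define x where "x = a \<cdot>\<^sub>v u + b \<cdot>\<^sub>v w"
    have "x \<in> carrier_vec m" "vec_fun m x = v"
      using assms ab by (simp_all add: x_def vec_fun_comb)
    moreover from this have "x \<noteq> 0\<^sub>v m" using v(3) vec_fun_eq_0 by blast
    ultimately have "proj_point x \<in> proj_line u w \<inter> proj_line u' w'"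
      using v(1,2) assms by (auto simp: proj_line_eq)
    then show False using disj by blast
  qed
next
  assume not_meets: "\<not> meets (span2 (vec_fun m u) (vec_fun m w)) (span2 (vec_fun m u') (vec_fun m w'))"
  show "proj_line u w \<inter> proj_line u' w' = {}"
  proof (rule ccontr)
    assume "proj_line u w \<inter> proj_line u' w' \<noteq> {}"
    then obtain x x' where x: "x \<in> carrier_vec m" "x \<noteq> 0\<^sub>v m" "vec_fun m x \<in> span2 (vec_fun m u) (vec_fun m w)"
      and x': "x' \<in> carrier_vec m" "vec_fun m x' \<in> span2 (vec_fun m u') (vec_fun m w')"
      and eq: "proj_point x = proj_point x'"
      using assms by (auto simp: proj_line_eq)
    have "x = 1 \<cdot>\<^sub>v x" by simp
    then have "x \<in> proj_point x" unfolding proj_point_def by blast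
    then obtain c where "x = c \<cdot>\<^sub>v x'" unfolding eq by (auto simp: proj_point_def)
    then have "vec_fun m x = lc c (vec_fun m x') 0 (vec_fun m x')"
      using x' by (simp add: vec_fun_smult)
    then have "vec_fun m x \<in> span2 (vec_fun m u') (vec_fun m w')"
      using lc_mem_span2[OF x'(2) x'(2)] by metis
    then show False using not_meets x vec_fun_eq_0[OF x(1)] by (auto simp: meets_def)
  qed
qed

lemma affine_line_eq:
  assumes "p \<in> carrier_vec m" "v \<in> carrier_vec m"
  shows "affine_line p v = {x. x \<in> carrier_vec m \<and> hom_fun m x \<in> span2 (hom_fun m p) (vec_fun m v)}"
proof (intro equalityI subsetI)
  fix x assume "x \<in> affine_line p v"
  then obtain t where x: "x = p + t \<cdot>\<^sub>v v" by (auto simp: affine_line_def)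
  then have "hom_fun m x \<in> span2 (hom_fun m p) (vec_fun m v)"
    using assms by (auto simp: hom_fun_comb span2_def)
  then show "x \<in> {x. x \<in> carrier_vec m \<and> hom_fun m x \<in> span2 (hom_fun m p) (vec_fun m v)}"
    using x assms by simp
next
  fix x assume "x \<in> {x. x \<in> carrier_vec m \<and> hom_fun m x \<in> span2 (hom_fun m p) (vec_fun m v)}"
  then obtain a t where x: "x \<in> carrier_vec m" "hom_fun m x = lc a (hom_fun m p) t (vec_fun m v)"
    by (auto simp: span2_def)
  \<comment> \<open>Compare the homogenizing coordinate at index \<open>m\<close>.\<close>
  have "a = 1" using fun_cong[OF x(2), of m] by (simp add: hom_fun_def vec_fun_def lc_def)
  then have "x = p + t \<cdot>\<^sub>v v"
    using x hom_fun_inject[of x m "p + t \<cdot>\<^sub>v v"] assms by (simp add: hom_fun_comb)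
  then show "x \<in> affine_line p v" by (auto simp: affine_line_def)
qed

lemma indep_hom_vec:
  assumes "v \<in> carrier_vec m" "v \<noteq> 0\<^sub>v m"
  shows "indep (hom_fun m p) (vec_fun m v)"
  unfolding indep_def
proof (intro allI impI)
  fix a b assume eq: "lc a (hom_fun m p) b (vec_fun m v) = (\<lambda>_. 0)"
  have a: "a = 0" using fun_cong[OF eq, of m] by (simp add: hom_fun_def vec_fun_def lc_def)
  obtain j where "vec_fun m v j \<noteq> 0" using vec_fun_eq_0[OF assms(1)] assms(2) by (metis ext)
  then have "b = 0" using fun_cong[OF eq, of j] a by (simp add: lc_def)
  then show "a = 0 \<and> b = 0" using a by blast
qed

text \<open>A common vector with nonzero last coordinate rescales to a common affine point. One with
  last coordinate 0 would be a common direction, which the independence of the directions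
  excludes.\<close>

lemma affine_lines_disjoint_iff:
  assumes p: "p \<in> carrier_vec m" "v \<in> carrier_vec m" and q: "q \<in> carrier_vec m" "w \<in> carrier_vec m"
    and indep: "indep (vec_fun m v) (vec_fun m w)"
  shows "affine_line p v \<inter> affine_line q w = {} \<longleftrightarrow>
    \<not> meets (span2 (hom_fun m p) (vec_fun m v)) (span2 (hom_fun m q) (vec_fun m w))"
proof
  assume disj: "affine_line p v \<inter> affine_line q w = {}"
  show "\<not> meets (span2 (hom_fun m p) (vec_fun m v)) (span2 (hom_fun m q) (vec_fun m w))"
  proof
    assume "meets (span2 (hom_fun m p) (vec_fun m v)) (span2 (hom_fun m q) (vec_fun m w))"
    then obtain z where z: "z \<in> span2 (hom_fun m p) (vec_fun m v)"
      "z \<in> span2 (hom_fun m q) (vec_fun m w)" "z \<noteq> (\<lambda>_. 0)"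
      by (auto simp: meets_def)
    then obtain a b a' b' where ab: "z = lc a (hom_fun m p) b (vec_fun m v)" "z = lc a' (hom_fun m q) b' (vec_fun m w)"
      unfolding span2_def by blast
    have a: "a = z m" "a' = z m"
      using fun_cong[OF ab(1), of m] fun_cong[OF ab(2), of m] by (simp_all add: hom_fun_def vec_fun_def lc_def)
    show False
    proof (cases "z m = 0")
      case True
      then have ab': "z j = b * vec_fun m v j" "z j = b' * vec_fun m w j" for j
        using fun_cong[OF ab(1), of j] fun_cong[OF ab(2), of j] a by (simp_all add: lc_def)
      have "lc b (vec_fun m v) (- b') (vec_fun m w) j = 0" for j
        using ab'[of j] by (simp add: lc_def)
      then have "lc b (vec_fun m v) (- b') (vec_fun m w) = (\<lambda>_. 0)" by blast
      then have "b = 0" using indep unfolding indep_def by blast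
      then have "z j = 0" for j using ab'(1)[of j] by simp
      then show False using z(3) by blast
    next
      case False
      define x where "x = p + (b / z m) \<cdot>\<^sub>v v"
      have x: "x \<in> carrier_vec m" using p by (simp add: x_def)
      have zj: "z j = z m * hom_fun m p j + b * vec_fun m v j" for j
        using fun_cong[OF ab(1), of j] a(1) by (simp add: lc_def)
      have "lc 1 (hom_fun m p) (b / z m) (vec_fun m v) j = lc (1 / z m) z 0 z j" for j
        using False by (simp add: lc_def zj[of j] field_simps)
      then have "hom_fun m x = lc (1 / z m) z 0 z"
        unfolding x_def hom_fun_comb[OF p] by blast
      then have "x \<in> affine_line p v" "x \<in> affine_line q w"
        using x p q lc_mem_span2[OF z(1) z(1)] lc_mem_span2[OF z(2) z(2)] by (simp_all add: affine_line_eq)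
      then show False using disj by blast
    qed
  qed
next
  assume not_meets: "\<not> meets (span2 (hom_fun m p) (vec_fun m v)) (span2 (hom_fun m q) (vec_fun m w))"
  show "affine_line p v \<inter> affine_line q w = {}"
  proof (rule ccontr)
    assume "affine_line p v \<inter> affine_line q w \<noteq> {}"
    then obtain x where "hom_fun m x \<in> span2 (hom_fun m p) (vec_fun m v)"
      "hom_fun m x \<in> span2 (hom_fun m q) (vec_fun m w)"
      using p q by (auto simp: affine_line_eq)
    moreover have "hom_fun m x m \<noteq> 0" by (simp add: hom_fun_def)
    then have "hom_fun m x \<noteq> (\<lambda>_. 0)" by metis
    ultimately show False using not_meets by (auto simp: meets_def)
  qed
qed

text \<open>A common point together with the common direction spans the plane of either line, so the
  lines would coincide.\<close>

lemma parallel_affine_lines: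
  assumes p: "p \<in> carrier_vec m" "v \<in> carrier_vec m" "v \<noteq> 0\<^sub>v m"
    and q: "q \<in> carrier_vec m" "w \<in> carrier_vec m" "w \<noteq> 0\<^sub>v m"
    and dep: "\<not> indep (vec_fun m v) (vec_fun m w)" and ne: "affine_line p v \<noteq> affine_line q w"
  shows "affine_line p v \<inter> affine_line q w = {}"
proof (rule ccontr)
  assume "affine_line p v \<inter> affine_line q w \<noteq> {}"
  then obtain x where x: "hom_fun m x \<in> span2 (hom_fun m p) (vec_fun m v)"
    "hom_fun m x \<in> span2 (hom_fun m q) (vec_fun m w)"
    using p q by (auto simp: affine_line_eq)
  obtain c where "vec_fun m w = (\<lambda>j. c * vec_fun m v j)"
    using not_indep_multiple[OF dep] vec_fun_eq_0 p by blast
  then have "vec_fun m w = lc c (vec_fun m v) 0 (vec_fun m v)" by (simp add: lc_units)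
  then have w: "vec_fun m w \<in> span2 (hom_fun m p) (vec_fun m v)"
    using lc_mem_span2[OF span2_self(2) span2_self(2)] by metis
  have "span2 (hom_fun m p) (vec_fun m v) = span2 (hom_fun m x) (vec_fun m w)"
    by (rule plane_eq_span2[OF plane_span2[OF indep_hom_vec[OF p(2,3)]] x(1) w indep_hom_vec[OF q(2,3)]])
  moreover have "span2 (hom_fun m q) (vec_fun m w) = span2 (hom_fun m x) (vec_fun m w)"
    by (rule plane_eq_span2[OF plane_span2[OF indep_hom_vec[OF q(2,3)]] x(2) span2_self(2) indep_hom_vec[OF q(2,3)]])
  ultimately have "affine_line p v = affine_line q w"
    using p q by (simp add: affine_line_eq)
  then show False using ne by blast
qed

lemma dep_sym: "\<not> indep u w \<Longrightarrow> \<not> indep w u"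
  unfolding indep_def lc_def by (metis add.commute)

text \<open>With symmetry and reflexivity, this makes parallelism an equivalence relation on nonzero
  directions.\<close>

lemma dep_trans:
  assumes "\<not> indep u w" "\<not> indep w z" "u \<noteq> (\<lambda>_. 0)" "w \<noteq> (\<lambda>_. 0)"
  shows "\<not> indep u z"
proof -
  obtain c where "w = (\<lambda>j. c * u j)" using not_indep_multiple assms(1,3) by blast
  moreover obtain d where "z = (\<lambda>j. d * w j)" using not_indep_multiple assms(2,4) by blast
  ultimately have "lc (- d * c) u 1 z = (\<lambda>_. 0)" by (auto simp: lc_def)
  then show ?thesis unfolding indep_def by (metis zero_neq_one)
qed

lemma dep_refl: "\<not> indep u u"
proof -
  have "lc 1 u (- 1) u = (\<lambda>_. 0)" by (auto simp: lc_def)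
  then show ?thesis unfolding indep_def by (metis zero_neq_one)
qed

section \<open>The projective and the affine algorithm\<close>

definition gram_matrix_prog :: prog where
  "gram_matrix_prog = gram_prog ''AA'' ''a'' ''a'' ;; gram_prog ''AB'' ''a'' ''b'' ;; gram_prog ''BB'' ''b'' ''b''"

lemma writes_gram_matrix_prog: "writes gram_matrix_prog = {''i'', ''j'', ''k'', ''AA'', ''AB'', ''BB''}"
  by (auto simp: gram_matrix_prog_def writes_gram_prog)

lemma rarr_gram_matrix_prog:
  assumes "i < nreg s ''n''" "j < nreg s ''n''"
  shows "rarr (run gram_matrix_prog s) ''AA'' i j = rarr s ''AA'' i j + (\<Sum>k<nreg s ''m''. rarr s ''a'' i k * rarr s ''a'' j k)"
    and "rarr (run gram_matrix_prog s) ''AB'' i j = rarr s ''AB'' i j + (\<Sum>k<nreg s ''m''. rarr s ''a'' i k * rarr s ''b'' j k)"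
    and "rarr (run gram_matrix_prog s) ''BB'' i j = rarr s ''BB'' i j + (\<Sum>k<nreg s ''m''. rarr s ''b'' i k * rarr s ''b'' j k)"
  using assms
  by (simp_all add: gram_matrix_prog_def rarr_gram_prog run_unchanged' writes_gram_prog)

text \<open>The arrays \<open>lay\<close> and \<open>par\<close> keep their initial value 0: there
  is one layer and every parallel class is empty.\<close>

definition proj_prog :: prog where
  "proj_prog = gram_matrix_prog ;; main_prog"

lemma wf_gram_matrix_prog: "wf_prog gram_matrix_prog"
  by (simp add: gram_matrix_prog_def gram_prog_def)

lemma wf_proj_prog: "wf_prog proj_prog"
  by (simp add: proj_prog_def wf_gram_matrix_prog wf_main_prog)

lemma poly_time_proj:
  assumes "\<And>m. m \<in> D \<Longrightarrow> 1 \<le> m"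
  shows "poly_time_clique_coloring (guarded proj_prog) 2 D independent_pair proj_line"
proof (rule poly_time_guarded[OF wf_proj_prog assms])
  fix m n :: nat and a b :: "nat \<Rightarrow> real vec" and t
  assume n: "0 < n" and valid: "\<And>i. i < n \<Longrightarrow> independent_pair m (a i) (b i)"
    and inj: "inj_on (\<lambda>i. proj_line (a i) (b i)) {..<n}"
    and t: "t = run proj_prog (input_state n m a b)"
  let ?L = "\<lambda>i. proj_line (a i) (b i)"
  let ?s = "input_state n m a b"
  define A where "A i = vec_fun m (a i)" for i
  define B where "B i = vec_fun m (b i)" for i
  have carrier: "a i \<in> carrier_vec m" "b i \<in> carrier_vec m" if "i < n" for i
    using valid[OF that] by (auto simp: independent_pair_def)
  interpret vector_pairs n m A B
    by unfold_locales (auto simp: A_def B_def vanishes_def vec_fun_def intro: valid indep_vec_fun[unfolded vec_fun_def])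
  interpret line_family n m A B "\<lambda>i j. ?L i \<inter> ?L j = {}" "\<lambda>_. 0"
  proof unfold_locales
    fix i j assume ij: "i < n" "j < n" "i \<noteq> j"
    have "?L i \<noteq> ?L j" using inj ij by (auto simp: inj_on_def)
    then show "S i \<noteq> S j"
      using proj_line_eq[OF carrier[OF ij(1)]] proj_line_eq[OF carrier[OF ij(2)]]
      unfolding S_def A_def B_def by metis
  next
    fix i j assume "i < n" "j < n"
    then show "?L i \<inter> ?L j = {} \<longleftrightarrow> \<not> meets (S i) (S j)"
      unfolding S_def A_def B_def using carrier by (intro proj_lines_disjoint_iff)
  qed (rule n)
  define s where "s = run gram_matrix_prog ?s"
  have u: "nreg s x = nreg ?s x \<and> narr s x = narr ?s x" if "x \<notin> {''i'', ''j'', ''k'', ''AA'', ''AB'', ''BB''}" for x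
    using run_unchanged'[of x gram_matrix_prog ?s] that by (simp add: s_def writes_gram_matrix_prog)
  have in_s: "rarr ?s ''a'' i k = A i k" "rarr ?s ''b'' i k = B i k" if "i < n" "k < m" for i k
    using that by (simp_all add: input_state_def A_def B_def vec_fun_def)
  have init: "nreg ?s ''n'' = n" "nreg ?s ''m'' = m"
    "rarr ?s ''AA'' = (\<lambda>_ _. 0)" "rarr ?s ''AB'' = (\<lambda>_ _. 0)" "rarr ?s ''BB'' = (\<lambda>_ _. 0)"
    by (simp_all add: input_state_def)
  have gram: "gram_ok n m A B s"
    unfolding gram_ok_def s_def
    by (auto simp: rarr_gram_matrix_prog init in_s ip_def)
  have ready: "main_ready s" by (simp add: main_ready_def u) (simp add: input_state_def)
  have n_s: "nreg s ''n'' = n" by (simp add: u init)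
  have lay_s: "\<forall>i<n. narr s ''lay'' i 0 = 0"
    by (simp add: u) (simp add: input_state_def)
  have par_s: "\<forall>i<n. clique_set (row_set s ''par'' i)"
    by (simp add: row_set_def u clique_set_def) (simp add: input_state_def)
  have t': "t = run main_prog s"
    by (simp only: t proj_prog_def run.simps(4) s_def)
  note spec = main_prog_spec[OF n_s gram lay_s ready par_s, folded t']
  \<comment> \<open>The single layer contributes the factor 1.\<close>
  have "card ((\<lambda>_. 0 :: nat) ` {..<n}) \<le> 1"
    using card_mono[of "{0 :: nat}" "(\<lambda>_. 0) ` {..<n}"] by auto
  then have "card ((\<lambda>i. narr t ''color'' i 0) ` {..<n}) \<le> card (picked t) ^ 2"
    using spec(3) mult_le_mono1[of "card ((\<lambda>_. 0 :: nat) ` {..<n})" 1 "card (picked t) * card (picked t)"]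
    unfolding power2_eq_square by linarith
  then show "(\<forall>i\<in>picked t. \<forall>j\<in>picked t. i \<noteq> j \<longrightarrow> ?L i \<inter> ?L j = {}) \<and>
      (\<forall>i<n. \<forall>j<n. i \<noteq> j \<longrightarrow> narr t ''color'' i 0 = narr t ''color'' j 0 \<longrightarrow> ?L i \<inter> ?L j \<noteq> {}) \<and>
      card ((\<lambda>i. narr t ''color'' i 0) ` {..<n}) \<le> card (picked t) ^ 2"
    using spec(1,2) unfolding clique_set_def by simp
qed

text \<open>Only products of two points receive a contribution from the homogenizing coordinate,
  namely \<open>1 * 1\<close>; therefore \<open>AA\<close> is preset to 1, while \<open>AB\<close>
  and \<open>BB\<close> start at 0.\<close>

definition affine_prog :: prog where
  "affine_prog = ones_prog ''AA'' ;; gram_matrix_prog ;;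
    fill_prog ''par'' (det_zero_exp
      (gexp (bvec (NReg ''i'')) (bvec (NReg ''i''))) (gexp (bvec (NReg ''i'')) (bvec (NReg ''j'')))
      (gexp (bvec (NReg ''j'')) (bvec (NReg ''j'')))) ;;
    layer_prog ;; main_prog"

lemma wf_affine_prog: "wf_prog affine_prog"
  by (simp add: affine_prog_def wf_gram_matrix_prog wf_main_prog ones_prog_def fill_prog_def layer_prog_def)

lemma poly_time_affine:
  assumes "\<And>m. m \<in> D \<Longrightarrow> 1 \<le> m"
  shows "poly_time_clique_coloring (guarded affine_prog) 3 D
    (\<lambda>m p v. p \<in> carrier_vec m \<and> v \<in> carrier_vec m \<and> v \<noteq> 0\<^sub>v m) affine_line"
proof (rule poly_time_guarded[OF wf_affine_prog assms])
  fix m n :: nat and a b :: "nat \<Rightarrow> real vec" and t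
  assume n: "0 < n" and valid: "\<And>i. i < n \<Longrightarrow> a i \<in> carrier_vec m \<and> b i \<in> carrier_vec m \<and> b i \<noteq> 0\<^sub>v m"
    and inj: "inj_on (\<lambda>i. affine_line (a i) (b i)) {..<n}"
    and t: "t = run affine_prog (input_state n m a b)"
  let ?L = "\<lambda>i. affine_line (a i) (b i)"
  let ?s = "input_state n m a b"
  define A where "A i = hom_fun m (a i)" for i
  define B where "B i = vec_fun m (b i)" for i
  define par where "par i j \<longleftrightarrow> \<not> indep (B i) (B j)" for i j
  define lay where "lay i = card {j. j < i \<and> par i j}" for i
  have B0: "B i \<noteq> (\<lambda>_. 0)" if "i < n" for i
    using valid[OF that] vec_fun_eq_0 by (auto simp: B_def)
  have par_trans: "par i k" if "par i j" "par j k" "i < n" "j < n" for i j k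
    using dep_trans that B0 unfolding par_def by blast
  have par_sym: "par i j \<Longrightarrow> par j i" for i j
    unfolding par_def by (rule dep_sym)
  have par_refl: "par i i" for i by (simp add: par_def dep_refl)
  \<comment> \<open>All lines counted for \<open>i\<close> are also counted for the later parallel
    line \<open>j\<close>, and so is \<open>i\<close> itself.\<close>
  have lay_mono: "lay i < lay j" if "i < j" "j < n" "par i j" for i j
  proof -
    have ji: "par j i" "i < n" using that par_sym by auto
    have "k < j \<and> par j k" if "k \<in> insert i {k. k < i \<and> par i k}" for k
      using that ji \<open>i < j\<close> par_trans[OF ji(1) _ \<open>j < n\<close> ji(2), of k] by (auto intro: less_trans)
    then have "insert i {k. k < i \<and> par i k} \<subseteq> {k. k < j \<and> par j k}"
      by blast
    then have "card (insert i {k. k < i \<and> par i k}) \<le> lay j"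
      unfolding lay_def by (intro card_mono) auto
    then show ?thesis by (simp add: lay_def)
  qed
  have ne: "?L i \<noteq> ?L j" if "i < n" "j < n" "i \<noteq> j" for i j
    using inj that by (auto simp: inj_on_def)
  interpret vector_pairs n "Suc m" A B
    by unfold_locales
      (use valid indep_hom_vec in \<open>auto simp: A_def B_def vanishes_def\<close>,
       auto simp: hom_fun_def vec_fun_def)
  interpret line_family n "Suc m" A B "\<lambda>i j. ?L i \<inter> ?L j = {}" lay
  proof unfold_locales
    fix i j assume ij: "i < n" "j < n" "i \<noteq> j"
    then show "S i \<noteq> S j"
      using ne[OF ij] affine_line_eq[of "a i" m "b i"] affine_line_eq[of "a j" m "b j"] valid[OF ij(1)] valid[OF ij(2)]
      unfolding S_def A_def B_def by metis
    assume "lay i = lay j"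
    then have "\<not> par i j" using lay_mono[of i j] lay_mono[of j i] par_sym ij by (metis less_irrefl nat_neq_iff)
    then show "?L i \<inter> ?L j = {} \<longleftrightarrow> \<not> meets (S i) (S j)"
      unfolding S_def A_def B_def par_def using valid ij by (intro affine_lines_disjoint_iff) auto
  next
    fix i assume "i < n"
    have "lay i \<le> card {..<i}" unfolding lay_def by (intro card_mono) auto
    then show "lay i < n" using \<open>i < n\<close> by simp
  qed
  define s1 where "s1 = run (ones_prog ''AA'') ?s"
  define s2 where "s2 = run gram_matrix_prog s1"
  define s3 where "s3 = run (fill_prog ''par'' (det_zero_exp
      (gexp (bvec (NReg ''i'')) (bvec (NReg ''i''))) (gexp (bvec (NReg ''i'')) (bvec (NReg ''j'')))
      (gexp (bvec (NReg ''j'')) (bvec (NReg ''j''))))) s2"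
  define s where "s = run layer_prog s3"
  have t': "t = run main_prog s"
    unfolding t affine_prog_def s1_def s2_def s3_def s_def by (simp only: run.simps(4))
  note u1 = run_unchanged'[of _ "ones_prog ''AA''" ?s, folded s1_def, unfolded prog_writes]
  note u2 = run_unchanged'[of _ gram_matrix_prog s1, folded s2_def, unfolded writes_gram_matrix_prog]
  note u3 = run_unchanged'[of _ "fill_prog ''par'' (det_zero_exp
      (gexp (bvec (NReg ''i'')) (bvec (NReg ''i''))) (gexp (bvec (NReg ''i'')) (bvec (NReg ''j'')))
      (gexp (bvec (NReg ''j'')) (bvec (NReg ''j''))))" s2, folded s3_def, unfolded prog_writes]
  note u4 = run_unchanged'[of _ layer_prog s3, folded s_def, unfolded prog_writes]
  have init: "nreg ?s ''n'' = n" "nreg ?s ''m'' = m" "narr ?s = (\<lambda>_ _ _. 0)" "nreg ?s ''best'' = 0"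
    "rarr ?s ''AA'' = (\<lambda>_ _. 0)" "rarr ?s ''AB'' = (\<lambda>_ _. 0)" "rarr ?s ''BB'' = (\<lambda>_ _. 0)"
    by (simp_all add: input_state_def)
  have in_s: "rarr ?s ''a'' i k = A i k" "rarr ?s ''b'' i k = B i k" if "i < n" "k < m" for i k
    using that by (simp_all add: input_state_def A_def B_def vec_fun_def hom_fun_def)
  have last: "A i m = 1" "B i m = 0" for i
    by (simp_all add: A_def B_def hom_fun_def vec_fun_def)
  \<comment> \<open>The loops sum over \<open>m\<close> coordinates; the preset entries supply the
    missing term of the inner product in dimension \<open>Suc m\<close>.\<close>
  have gram2: "gram_ok n (Suc m) A B s2"
    unfolding gram_ok_def s2_def
    by (auto simp: rarr_gram_matrix_prog u1 init in_s ip_def last s1_def[symmetric]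
        rarr_ones_prog[of "''AA''" ?s, folded s1_def])
  have par: "narr s3 ''par'' i j = of_bool (i < nreg s2 ''n'' \<and> j < nreg s2 ''n'' \<and> par i j)" for i j
    unfolding s3_def
  proof (rule narr_fill_prog)
    fix u assume ag: "agree {''i'', ''j'', ''par''} s2 u"
      and "nreg u ''i'' < nreg s2 ''n''" "nreg u ''j'' < nreg s2 ''n''"
    then have ij: "nreg u ''i'' < n" "nreg u ''j'' < n" by (simp_all add: u1 u2 init)
    have "gram_ok n (Suc m) A B u"
      using gram_ok_agree[OF ag gram2] by simp
    then show "bval (det_zero_exp
      (gexp (bvec (NReg ''i'')) (bvec (NReg ''i''))) (gexp (bvec (NReg ''i'')) (bvec (NReg ''j'')))
      (gexp (bvec (NReg ''j'')) (bvec (NReg ''j'')))) u \<longleftrightarrow> par (nreg u ''i'') (nreg u ''j'')"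
      using ij dep_ip[of "Suc m" "B (nreg u ''i'')" "B (nreg u ''j'')"]
      by (simp add: rval_gexp vexp_def gval_eq_ip supported par_def)
  qed (simp_all add: u1 u2 init)
  have layer: "\<forall>i<n. narr s ''lay'' i 0 = lay i"
  proof (intro allI impI)
    fix i assume i: "i < n"
    have "narr s ''lay'' i 0 = card {j. j < i \<and> narr s3 ''par'' i j \<noteq> 0}"
      unfolding s_def by (rule narr_layer_prog) (use i in \<open>simp_all add: u1 u2 u3 init\<close>)
    also have "{j. j < i \<and> narr s3 ''par'' i j \<noteq> 0} = {j. j < i \<and> par i j}"
      using i by (auto simp: par u1 u2 init)
    finally show "narr s ''lay'' i 0 = lay i" by (simp add: lay_def)
  qed
  have row_par: "row_set s ''par'' i = {j. j < n \<and> par i j}" if "i < n" for i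
    using that by (auto simp: row_set_def u1 u2 u3 u4 par init)
  have clique_par: "\<forall>i<n. clique_set (row_set s ''par'' i)"
    unfolding clique_set_def
  proof (intro allI ballI impI)
    fix i j k assume i: "i < n" and "j \<in> row_set s ''par'' i" "k \<in> row_set s ''par'' i" "j \<noteq> k"
    then have jk: "j \<in> {j. j < n \<and> par i j}" "k \<in> {j. j < n \<and> par i j}" "j \<noteq> k"
      using row_par[OF i] by simp_all
    then have "par j k" using par_trans[of j i k] par_sym i by blast
    then show "?L j \<inter> ?L k = {}"
      using parallel_affine_lines[of "a j" m "b j" "a k" "b k"] valid ne[of j k] jk
      by (auto simp: par_def B_def)
  qed
  have gram: "gram_ok n (Suc m) A B s"
    using gram2 by (simp add: gram_ok_def u3 u4)
  have ready: "main_ready s" by (simp add: main_ready_def u1 u2 u3 u4 init)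
  have n_s: "nreg s ''n'' = n" by (simp add: u1 u2 u3 u4 init)
  note spec = main_prog_spec[OF n_s gram layer ready clique_par, folded t']
  \<comment> \<open>The parallel class of \<open>i\<close> contains the lines counted by
    \<open>lay i\<close> and \<open>i\<close> itself. Being a candidate for the picked clique, it is
    no larger than that clique, which bounds the number of layers.\<close>
  have "lay i < card (picked t)" if "i < n" for i
  proof -
    have "insert i {j. j < i \<and> par i j} \<subseteq> {j. j < n \<and> par i j}"
      using that par_refl by auto
    then have "card (insert i {j. j < i \<and> par i j}) \<le> card {j. j < n \<and> par i j}"
      by (intro card_mono) auto
    then show ?thesis using spec(4)[OF that] row_par[OF that] by (simp add: lay_def)
  qed
  then have "lay ` {..<n} \<subseteq> {..<card (picked t)}" by auto
  then have "card (lay ` {..<n}) \<le> card (picked t)"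
    using card_mono[of "{..<card (picked t)}"] by fastforce
  then have "card (lay ` {..<n}) * (card (picked t) * card (picked t)) \<le> card (picked t) ^ 3"
    unfolding power3_eq_cube mult.assoc by (rule mult_le_mono1)
  with spec(3) have "card ((\<lambda>i. narr t ''color'' i 0) ` {..<n}) \<le> card (picked t) ^ 3"
    by (rule le_trans)
  then show "(\<forall>i\<in>picked t. \<forall>j\<in>picked t. i \<noteq> j \<longrightarrow> ?L i \<inter> ?L j = {}) \<and>
      (\<forall>i<n. \<forall>j<n. i \<noteq> j \<longrightarrow> narr t ''color'' i 0 = narr t ''color'' j 0 \<longrightarrow> ?L i \<inter> ?L j \<noteq> {}) \<and>
      card ((\<lambda>i. narr t ''color'' i 0) ` {..<n}) \<le> card (picked t) ^ 3"
    using spec(1,2) unfolding clique_set_def by simp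
qed

theorem theorem2:
  "(\<forall>d\<ge>3. \<forall>S. finite S \<longrightarrow> S \<subseteq> affine_lines d \<longrightarrow>
      chromatic_number (disjointness_graph S) \<le> clique_number (disjointness_graph S) ^ 3) \<and>
   (\<forall>d\<ge>3. \<forall>S. finite S \<longrightarrow> S \<subseteq> proj_lines d \<longrightarrow>
      chromatic_number (disjointness_graph S) \<le> clique_number (disjointness_graph S) ^ 2) \<and>
   (\<exists>c. poly_time_clique_coloring c 3 {d. d \<ge> 3}
      (\<lambda>d p v. p \<in> carrier_vec d \<and> v \<in> carrier_vec d \<and> v \<noteq> 0\<^sub>v d) affine_line) \<and>
   (\<exists>c. poly_time_clique_coloring c 2 {d + 1 | d. d \<ge> 3} independent_pair proj_line)"
proof -
  have affine: "poly_time_clique_coloring (guarded affine_prog) 3 {d. d \<ge> 3}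
      (\<lambda>d p v. p \<in> carrier_vec d \<and> v \<in> carrier_vec d \<and> v \<noteq> 0\<^sub>v d) affine_line"
    by (rule poly_time_affine) simp
  have proj: "poly_time_clique_coloring (guarded proj_prog) 2 {d + 1 | d. d \<ge> 3} independent_pair proj_line"
    by (rule poly_time_proj) auto
  have "chromatic_number (disjointness_graph S) \<le> clique_number (disjointness_graph S) ^ 3"
    if "3 \<le> d" "finite S" "S \<subseteq> affine_lines d" for d and S :: "real vec set set"
    using poly_time_chromatic_bound[OF affine _ that(2), of d] that by (auto simp: affine_lines_def)
  moreover have "chromatic_number (disjointness_graph S) \<le> clique_number (disjointness_graph S) ^ 2"
    if "3 \<le> d" "finite S" "S \<subseteq> proj_lines d" for d and S :: "real vec set set set"
    using poly_time_chromatic_bound[OF proj _ that(2), of "d + 1"] that by (auto simp: proj_lines_def)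
  ultimately show ?thesis using affine proj by blast
qed

end
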